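(* Let $p$ be a prime and let $K$ be a field of characteristic $p>0$ equipped with a valuation $v: K^\ast \rightarrow G$ taking values in an ordered abelian group $G$. Let $\mathcal{O}_K=\{\alpha \in K: v(\alpha) \ge 0\}$ and $\mathfrak{m}_K=\{\alpha \in K: v(\alpha) > 0\}$ be the valuation ring and its maximal ideal, and suppose that the residue field $\mathcal{O}_K/\mathfrak{m}_K$ is finite, with $q$ elements. Fix an integer $d \ge 1$. If $f(x) = a_0 x^{n_0} + a_1 x^{n_1} + \cdots + a_k x^{n_k}$ is a polynomial with $k+1$ nonzero coefficients $a_i \in K^\ast$ (the exponents $n_0,\dots,n_k$ being distinct nonnegative integers), then the number of distinct zeros of $f$ in an algebraic closure $\overline{K}$ of $K$ that have degree at most $d$ over $K$ is at most $$\sum_{j=1}^d \sum_{i\mid j} q^{ik} \mu(j/i).$$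
   Context: Here $\mu$ is the Möbius function, and the inner sum runs over the positive divisors $i$ of $j$. Valuations are general Krull valuations written additively: $G$ is a totally ordered abelian group, not assumed to be discrete or of rank one, $v(\alpha\beta)=v(\alpha)+v(\beta)$ and $v(\alpha+\beta)\ge\min\{v(\alpha),v(\beta)\}$, with the convention $v(0)=+\infty$. The field $K$ is not assumed complete. Zeros are counted without multiplicity; the degree of $z\in\overline{K}$ over $K$ is $[K(z):K]$. *)

theory Defs
  imports
    "HOL-Computational_Algebra.Computational_Algebra"
    "HOL-Algebra.Algebraic_Closure_Type"
begin

text \<open>
  A general Krull valuation on a field, written additively, with values in an arbitrary totally
  ordered abelian group. The value of the function at \<open>0\<close> is junk: only its restriction to the
  nonzero elements is constrained, and the convention \<open>v(0) = \<infinity>\<close> is built into the definitions of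
  the valuation ring and the maximal ideal.
\<close>
definition krull_valuation :: "('a::field \<Rightarrow> 'g::linordered_ab_group_add) \<Rightarrow> bool" where
  "krull_valuation v \<longleftrightarrow>
     (\<forall>a b. a \<noteq> 0 \<longrightarrow> b \<noteq> 0 \<longrightarrow> v (a * b) = v a + v b) \<and>
     (\<forall>a b. a \<noteq> 0 \<longrightarrow> b \<noteq> 0 \<longrightarrow> a + b \<noteq> 0 \<longrightarrow> min (v a) (v b) \<le> v (a + b))"

definition valuation_ring :: "('a::field \<Rightarrow> 'g::linordered_ab_group_add) \<Rightarrow> 'a set" where
  "valuation_ring v = {a. a = 0 \<or> 0 \<le> v a}"

definition valuation_ideal :: "('a::field \<Rightarrow> 'g::linordered_ab_group_add) \<Rightarrow> 'a set" where
  "valuation_ideal v = {a. a = 0 \<or> 0 < v a}"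

definition residue_field :: "('a::field \<Rightarrow> 'g::linordered_ab_group_add) \<Rightarrow> 'a set set" where
  "residue_field v =
     valuation_ring v //
       {(a, b). a \<in> valuation_ring v \<and> b \<in> valuation_ring v \<and> a - b \<in> valuation_ideal v}"

definition is_subfield :: "'a::field set \<Rightarrow> bool" where
  "is_subfield L \<longleftrightarrow>
     1 \<in> L \<and> (\<forall>x\<in>L. \<forall>y\<in>L. x - y \<in> L \<and> x * y \<in> L) \<and> (\<forall>x\<in>L. inverse x \<in> L)"

text \<open>The field \<open>K(z)\<close>, for \<open>z\<close> in the algebraic closure of the field \<open>K = 'a\<close>.\<close>
definition adjoin :: "'a::field alg_closure \<Rightarrow> 'a alg_closure set" where
  "adjoin z = \<Inter>{L. is_subfield L \<and> range to_ac \<subseteq> L \<and> z \<in> L}"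

interpretation ac: vector_space "\<lambda>(c::'a::field) (x::'a alg_closure). to_ac c * x"
  by unfold_locales (simp_all add: algebra_simps)

text \<open>
  The degree \<open>[K(z) : K]\<close>. It is never the junk value \<open>0\<close> that \<^term>\<open>ac.dim\<close> assigns to
  infinite-dimensional spaces, as every element of the algebraic closure is algebraic.
\<close>
definition ext_degree :: "'a::field alg_closure \<Rightarrow> nat" where
  "ext_degree z = ac.dim (adjoin z)"

definition moebius_mu :: "nat \<Rightarrow> int" where
  "moebius_mu n = (if squarefree n then (-1) ^ card (prime_factors n) else 0)"

end

theory Submission
  imports Defs "HOL-Algebra.Exponent"
begin

text \<open>
  Extend the valuation to a valuation ring of the algebraic closure. The zeros of \<open>f\<close> are mapped
  injectively to \<open>k\<close>-tuples over an algebraic closure of \<open>\<bbbF>\<^sub>q\<close>, compatibly with an endomorphism \<open>\<sigma>\<close>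
  over \<open>K\<close> that lifts the Frobenius \<open>x \<mapsto> x\<^sup>q\<close> on the residues that matter. A zero of degree at most \<open>d\<close>
  is fixed by \<open>\<sigma>\<^sup>j\<close> for some \<open>1 \<le> j \<le> d\<close>, so its tuple has entries in the field with \<open>q\<^sup>j\<close> elements, and the
  bound of the theorem is the number of such tuples.

  The tuple records the digits of the zero at the branchings of the tree of zeros. That \<open>k\<close> digits
  suffice comes from Newton polygons: the coefficients of \<open>f(z(1+y))\<close> are the images of the vectors
  \<open>(n\<^sub>i choose j)\<^sub>i\<close> under one linear functional. On the part of the polygon describing the zeros close
  to \<open>z\<close> its vertices have distinct sizes, so the corresponding vectors over the prime field are
  linearly independent, and there are at most as many as the rank allows.
\<close>

section \<open>Valuation rings\<close>

text \<open>\<open>K\<close> is not complete, so the valuation may extend in many ways and a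
  \<open>K\<close>-embedding need not preserve the ring chosen. Instead of using a decomposition
  group, the proof asks for a Frobenius lift on finitely many residues only, and the digits have to
  live in a finite space fixed beforehand. Equal characteristic helps: the finite fields lie in the
  closure itself, so digits can be added and compared exactly. The value group may have any rank;
  sizes are compared by divisibility, and a Newton polygon is present only through the indices of
  its dominant terms. The exponent is \<open>k\<close>, one less than the number of terms, because
  f(z) = 0: the vector for j = 0 is independent of the others but belongs to no branching, and it
  uses up one of the \<open>k + 1\<close> dimensions. The degree enters through a polynomial over
  \<open>K\<close> of degree at most \<open>d\<close> that kills the zero and whose roots are
  permuted by \<sigma>.\<close>

locale valuation_subring =
  fixes R :: "'c::field set"
  assumes one_mem [simp]: "1 \<in> R"
    and diff_mem: "x \<in> R \<Longrightarrow> y \<in> R \<Longrightarrow> x - y \<in> R"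
    and mult_mem: "x \<in> R \<Longrightarrow> y \<in> R \<Longrightarrow> x * y \<in> R"
    and mem_or_inverse_mem: "x \<in> R \<or> inverse x \<in> R"
begin

lemma zero_mem [simp]: "0 \<in> R"
  using diff_mem[of 1 1] by simp

lemma uminus_mem: "x \<in> R \<Longrightarrow> - x \<in> R"
  using diff_mem[of 0 x] by simp

lemma add_mem: "x \<in> R \<Longrightarrow> y \<in> R \<Longrightarrow> x + y \<in> R"
  using diff_mem[of x "- y"] uminus_mem[of y] by simp

lemma power_mem: "x \<in> R \<Longrightarrow> x ^ n \<in> R"
  by (induction n) (auto intro: mult_mem)

lemma sum_mem: "(\<And>i. i \<in> I \<Longrightarrow> g i \<in> R) \<Longrightarrow> sum g I \<in> R"
  by (induction I rule: infinite_finite_induct) (auto intro: add_mem)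

definition max_ideal :: "'c set" where
  "max_ideal = {x \<in> R. x = 0 \<or> inverse x \<notin> R}"

lemma max_ideal_subset: "x \<in> max_ideal \<Longrightarrow> x \<in> R"
  by (simp add: max_ideal_def)

lemma zero_in_max_ideal [simp]: "0 \<in> max_ideal"
  by (simp add: max_ideal_def)

lemma one_notin_max_ideal [simp]: "1 \<notin> max_ideal"
  by (simp add: max_ideal_def)

lemma inverse_mem: "x \<in> R \<Longrightarrow> x \<notin> max_ideal \<Longrightarrow> inverse x \<in> R"
  by (simp add: max_ideal_def)

lemma inverse_in_max_ideal: "x \<notin> R \<Longrightarrow> inverse x \<in> max_ideal"
  using mem_or_inverse_mem[of x] by (simp add: max_ideal_def)

lemma max_ideal_mult:
  assumes "x \<in> max_ideal" "y \<in> R" shows "x * y \<in> max_ideal"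
proof (rule ccontr)
  assume *: "x * y \<notin> max_ideal"
  have xy: "x * y \<in> R" using assms by (auto intro: mult_mem max_ideal_subset)
  have nz: "x * y \<noteq> 0" using * by auto
  have "inverse (x * y) * y \<in> R" using inverse_mem[OF xy *] assms by (auto intro: mult_mem)
  also have "inverse (x * y) * y = inverse x" using nz by (simp add: field_simps)
  finally show False using assms nz by (simp add: max_ideal_def)
qed

lemma max_ideal_mult': "x \<in> R \<Longrightarrow> y \<in> max_ideal \<Longrightarrow> x * y \<in> max_ideal"
  using max_ideal_mult[of y x] by (simp add: mult.commute)

lemma max_ideal_uminus: "x \<in> max_ideal \<Longrightarrow> - x \<in> max_ideal"
  using max_ideal_mult[of x "-1"] uminus_mem[of 1] by simp

lemma max_ideal_prime: "x \<in> R \<Longrightarrow> y \<in> R \<Longrightarrow> x * y \<in> max_ideal \<Longrightarrow> x \<in> max_ideal \<or> y \<in> max_ideal"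
  using mult_mem[of "inverse x" "inverse y"] by (auto simp: max_ideal_def)

lemma max_ideal_add:
  assumes "x \<in> max_ideal" "y \<in> max_ideal" shows "x + y \<in> max_ideal"
proof -
  have *: "x + y \<in> max_ideal" if "x \<in> max_ideal" "y \<in> max_ideal" "x \<noteq> 0" "y / x \<in> R" for x y
  proof -
    have "x * (1 + y / x) \<in> max_ideal"
      using that by (intro max_ideal_mult add_mem) auto
    thus ?thesis using that by (simp add: distrib_left)
  qed
  show ?thesis
  proof (cases "x = 0 \<or> y = 0")
    case False
    have "y / x \<in> R \<or> x / y \<in> R"
      using mem_or_inverse_mem[of "x / y"] by (auto simp: field_simps)
    thus ?thesis using *[of x y] *[of y x] assms False by (auto simp: add.commute)
  qed (use assms in auto)
qed

lemma max_ideal_diff: "x \<in> max_ideal \<Longrightarrow> y \<in> max_ideal \<Longrightarrow> x - y \<in> max_ideal"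
  using max_ideal_add[of x "- y"] max_ideal_uminus[of y] by simp

lemma max_ideal_sum: "(\<And>i. i \<in> I \<Longrightarrow> g i \<in> max_ideal) \<Longrightarrow> sum g I \<in> max_ideal"
  by (induction I rule: infinite_finite_induct) (auto intro: max_ideal_add)

lemma max_ideal_power: "x \<in> R \<Longrightarrow> x ^ n \<in> max_ideal \<Longrightarrow> x \<in> max_ideal"
  by (induction n) (auto dest: max_ideal_prime[OF _ power_mem])

text \<open>Valuation rings are integrally closed: if \<open>x\<close> were outside
  \<open>R\<close>, then \<open>1/x\<close> would lie in the maximal ideal, and so would
  \<open>(1/x)^n * x^n = 1\<close>.\<close>

lemma mem_root:
  assumes "x ^ n \<in> R" "n > 0" shows "x \<in> R"
proof (rule ccontr)
  assume "x \<notin> R"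
  then have i: "inverse x \<in> max_ideal" by (rule inverse_in_max_ideal)
  have "inverse x * (inverse x ^ (n - 1) * x ^ n) \<in> max_ideal"
    using assms(1) power_mem[OF max_ideal_subset[OF i]] by (intro max_ideal_mult[OF i] mult_mem)
  moreover have "inverse x * (inverse x ^ (n - 1) * x ^ n) = 1"
    using assms \<open>x \<notin> R\<close> by (cases n) (auto simp: field_simps)
  ultimately show False by simp
qed

lemma max_ideal_prod:
  "finite I \<Longrightarrow> (\<And>i. i \<in> I \<Longrightarrow> g i \<in> R) \<Longrightarrow> prod g I \<in> max_ideal \<Longrightarrow> \<exists>i\<in>I. g i \<in> max_ideal"
proof (induction I rule: finite_induct)
  case (insert x F)
  have "prod g F \<in> R" using insert.prems(1) insert.hyps
  proof (induction F rule: infinite_finite_induct)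
    case (insert y F) thus ?case by (auto intro!: mult_mem)
  qed auto
  thus ?case using insert max_ideal_prime[of "g x" "prod g F"] by auto
qed auto

text \<open>In terms of a valuation this is v(x) \<ge> v(y), the comparison of absolute values.
  Divisibility in \<open>R\<close> expresses it without a value group and makes 0 the smallest size.
  Totality lets the strict order be the negated converse.\<close>

definition vle :: "'c \<Rightarrow> 'c \<Rightarrow> bool" (infix \<open>\<preceq>\<close> 50) where
  "x \<preceq> y \<longleftrightarrow> (\<exists>r\<in>R. x = r * y)"

definition vlt :: "'c \<Rightarrow> 'c \<Rightarrow> bool" (infix \<open>\<prec>\<close> 50) where
  "x \<prec> y \<longleftrightarrow> \<not> y \<preceq> x"

lemma vle_iff: "y \<noteq> 0 \<Longrightarrow> x \<preceq> y \<longleftrightarrow> x / y \<in> R"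
  unfolding vle_def by (auto intro: bexI[of _ "x / y"])

lemma vle_refl [simp]: "x \<preceq> x"
  unfolding vle_def by (rule bexI[of _ 1]) auto

lemma zero_vle [simp]: "0 \<preceq> x"
  unfolding vle_def by (rule bexI[of _ 0]) auto

lemma vle_zero_iff [simp]: "x \<preceq> 0 \<longleftrightarrow> x = 0"
  unfolding vle_def by (metis mult_zero_right zero_mem)

lemma vle_trans [trans]: "x \<preceq> y \<Longrightarrow> y \<preceq> z \<Longrightarrow> x \<preceq> z"
  unfolding vle_def by (metis mult.assoc mult_mem)

lemma vle_total: "x \<preceq> y \<or> y \<preceq> x"
proof (cases "x = 0 \<or> y = 0")
  case False
  thus ?thesis using mem_or_inverse_mem[of "x / y"] by (auto simp: vle_iff)
qed auto

lemma vlt_imp_vle: "x \<prec> y \<Longrightarrow> x \<preceq> y"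
  unfolding vlt_def using vle_total by blast

lemma vlt_vle_trans [trans]: "x \<prec> y \<Longrightarrow> y \<preceq> z \<Longrightarrow> x \<prec> z"
  unfolding vlt_def by (blast intro: vle_trans)

lemma vle_vlt_trans [trans]: "x \<preceq> y \<Longrightarrow> y \<prec> z \<Longrightarrow> x \<prec> z"
  unfolding vlt_def by (blast intro: vle_trans)

lemma vlt_trans [trans]: "x \<prec> y \<Longrightarrow> y \<prec> z \<Longrightarrow> x \<prec> z"
  using vlt_vle_trans vlt_imp_vle by blast

lemma vlt_irrefl [simp]: "\<not> x \<prec> x"
  by (simp add: vlt_def)

lemma not_vlt_zero [simp]: "\<not> x \<prec> 0"
  by (simp add: vlt_def)

lemma zero_vlt_iff [simp]: "0 \<prec> x \<longleftrightarrow> x \<noteq> 0"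
  by (simp add: vlt_def)

lemma vle_one_iff [simp]: "x \<preceq> 1 \<longleftrightarrow> x \<in> R"
  by (simp add: vle_iff)

lemma vlt_one_iff [simp]: "x \<prec> 1 \<longleftrightarrow> x \<in> max_ideal"
proof (cases "x = 0")
  case False
  thus ?thesis using mem_or_inverse_mem[of x]
    by (auto simp: vlt_def vle_iff max_ideal_def inverse_eq_divide)
qed (simp add: vlt_def)

lemma vle_mult: "a \<preceq> b \<Longrightarrow> c \<preceq> d \<Longrightarrow> a * c \<preceq> b * d"
  unfolding vle_def by (metis mult.assoc mult.left_commute mult_mem)

lemma vle_mult_cancel_right: "c \<noteq> 0 \<Longrightarrow> a * c \<preceq> b * c \<longleftrightarrow> a \<preceq> b"
  unfolding vle_def by (auto simp: mult.assoc[symmetric])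

lemma vle_mult_cancel_left: "c \<noteq> 0 \<Longrightarrow> c * a \<preceq> c * b \<longleftrightarrow> a \<preceq> b"
  using vle_mult_cancel_right[of c a b] by (simp add: mult.commute)

lemma vlt_mult_cancel_right: "c \<noteq> 0 \<Longrightarrow> a * c \<prec> b * c \<longleftrightarrow> a \<prec> b"
  by (simp add: vlt_def vle_mult_cancel_right)

lemma vlt_mult_cancel_left: "c \<noteq> 0 \<Longrightarrow> c * a \<prec> c * b \<longleftrightarrow> a \<prec> b"
  by (simp add: vlt_def vle_mult_cancel_left)

lemma vlt_iff: "y \<noteq> 0 \<Longrightarrow> x \<prec> y \<longleftrightarrow> x / y \<in> max_ideal"
  using vlt_mult_cancel_right[of y "x / y" 1] by simp

lemma vlt_mult_vle:
  assumes "a \<prec> b" "c \<preceq> d" "d \<noteq> 0" shows "a * c \<prec> b * d"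
proof -
  have "a * c \<preceq> a * d" using assms by (intro vle_mult) auto
  also have "a * d \<prec> b * d" using assms by (simp add: vlt_mult_cancel_right)
  finally show ?thesis .
qed

lemma vle_power: "a \<preceq> b \<Longrightarrow> a ^ n \<preceq> b ^ n"
  by (induction n) (auto intro: vle_mult)

lemma vlt_power: "a \<prec> b \<Longrightarrow> n > 0 \<Longrightarrow> a ^ n \<prec> b ^ n"
proof (induction n)
  case (Suc n)
  have "b \<noteq> 0" using Suc.prems by auto
  thus ?case using Suc.prems vle_power[of a b n] vlt_imp_vle[of a b]
    by (auto intro!: vlt_mult_vle)
qed auto

lemma vle_uminus [simp]: "- a \<preceq> b \<longleftrightarrow> a \<preceq> b"
  unfolding vle_def by (metis minus_mult_left minus_minus uminus_mem)

lemma vle_uminus' [simp]: "a \<preceq> - b \<longleftrightarrow> a \<preceq> b"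
  unfolding vle_def by (metis minus_mult_commute minus_minus uminus_mem)

lemma vlt_uminus [simp]: "- a \<prec> b \<longleftrightarrow> a \<prec> b"
  by (simp add: vlt_def)

lemma vle_add: "a \<preceq> c \<Longrightarrow> b \<preceq> c \<Longrightarrow> a + b \<preceq> c"
  unfolding vle_def by (metis add_mem distrib_right)

lemma vlt_add: "a \<prec> c \<Longrightarrow> b \<prec> c \<Longrightarrow> a + b \<prec> c"
  by (metis vle_add vle_total vlt_def vle_refl vle_trans)

lemma vlt_diff: "a \<prec> c \<Longrightarrow> b \<prec> c \<Longrightarrow> a - b \<prec> c"
  using vlt_add[of a c "- b"] by simp

lemma vle_sum: "(\<And>i. i \<in> I \<Longrightarrow> g i \<preceq> c) \<Longrightarrow> sum g I \<preceq> c"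
  by (induction I rule: infinite_finite_induct) (auto intro: vle_add)

lemma vlt_sum: "c \<noteq> 0 \<Longrightarrow> (\<And>i. i \<in> I \<Longrightarrow> g i \<prec> c) \<Longrightarrow> sum g I \<prec> c"
  by (induction I rule: infinite_finite_induct) (auto intro: vlt_add)

lemma vle_max_exists:
  assumes "finite I" "I \<noteq> {}" shows "\<exists>i\<in>I. \<forall>j\<in>I. g j \<preceq> g i"
  using assms
proof (induction I rule: finite_ne_induct)
  case (insert x F)
  then obtain i where i: "i \<in> F" "\<forall>j\<in>F. g j \<preceq> g i" by auto
  show ?case
    using i vle_total[of "g x" "g i"] by (auto intro: vle_trans)
qed auto

text \<open>The ultrametric equality: the other terms add up to something strictly smaller than
  \<open>g i\<close>, which cannot cancel it.\<close>

lemma vle_sum_dominant: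
  assumes "finite I" "i \<in> I" "\<And>j. j \<in> I \<Longrightarrow> j \<noteq> i \<Longrightarrow> g j \<prec> g i"
  shows "g i \<preceq> sum g I" and "sum g I \<preceq> g i"
proof -
  show "sum g I \<preceq> g i"
    using assms by (intro vle_sum) (metis vle_refl vlt_imp_vle)
  show "g i \<preceq> sum g I"
  proof (cases "g i = 0")
    case False
    have "sum g (I - {i}) \<prec> g i"
      using False assms by (intro vlt_sum) auto
    moreover have "sum g I = g i + sum g (I - {i})"
      using assms by (simp add: sum.remove)
    ultimately show ?thesis
      by (metis add_diff_cancel_right' vlt_def vle_total vlt_diff vlt_irrefl)
  qed auto
qed

end

text \<open>
  A maximal subring lying over the valuation ring \<open>S\<close> of \<open>K\<close> is a valuation ring: if it contained
  neither \<open>y\<close> nor \<open>1/y\<close>, adjoining either one would produce relations \<open>1 = a P(y)\<close> and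
  \<open>1 = b Q(1/y)\<close> with \<open>a\<close>, \<open>b\<close> in the maximal ideal of \<open>S\<close>, and the second relation lowers the degree of the first.
\<close>
lemma valuation_subring_extension:
  fixes S K :: "'c::field set"
  assumes K: "is_subfield K"
    and S: "S \<subseteq> K" "1 \<in> S" "\<And>x y. x \<in> S \<Longrightarrow> y \<in> S \<Longrightarrow> x - y \<in> S \<and> x * y \<in> S"
      "\<And>x. x \<in> K \<Longrightarrow> x \<in> S \<or> inverse x \<in> S"
  obtains R where "valuation_subring R" "R \<inter> K = S"
proof -
  define \<F> where "\<F> = {R. S \<subseteq> R \<and> R \<inter> K \<subseteq> S \<and> (\<forall>x\<in>R. \<forall>y\<in>R. x - y \<in> R \<and> x * y \<in> R)}"
  have "\<exists>R\<in>\<F>. \<forall>T\<in>\<F>. R \<subseteq> T \<longrightarrow> T = R"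
  proof (rule subset_Zorn_nonempty)
    have "S \<in> \<F>" unfolding \<F>_def using S(3) by simp
    thus "\<F> \<noteq> {}" by blast
    fix \<C> assume \<C>: "\<C> \<noteq> {}" "subset.chain \<F> \<C>"
    from \<C>(2) have \<C>F: "Z \<in> \<C> \<Longrightarrow> S \<subseteq> Z \<and> Z \<inter> K \<subseteq> S \<and> (\<forall>x\<in>Z. \<forall>y\<in>Z. x - y \<in> Z \<and> x * y \<in> Z)" for Z
      unfolding subset.chain_def \<F>_def by blast
    show "\<Union>\<C> \<in> \<F>"
      unfolding \<F>_def
    proof (intro CollectI conjI ballI)
      show "S \<subseteq> \<Union>\<C>" "\<Union>\<C> \<inter> K \<subseteq> S"
        using \<C>(1) \<C>F by blast+
      fix x y assume "x \<in> \<Union>\<C>" "y \<in> \<Union>\<C>"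
      then obtain T Y where "T \<in> \<C>" "Y \<in> \<C>" "x \<in> T" "y \<in> Y" by auto
      then obtain Z where "Z \<in> \<C>" "x \<in> Z" "y \<in> Z"
        using \<C>(2) unfolding subset.chain_def by blast
      thus "x - y \<in> \<Union>\<C>" "x * y \<in> \<Union>\<C>" using \<C>F by blast+
    qed
  qed
  then obtain R where R: "R \<in> \<F>" "\<And>T. T \<in> \<F> \<Longrightarrow> R \<subseteq> T \<Longrightarrow> T = R" by auto
  have SR: "S \<subseteq> R" and RK: "R \<inter> K \<subseteq> S"
    and diffR: "x \<in> R \<Longrightarrow> y \<in> R \<Longrightarrow> x - y \<in> R" and multR: "x \<in> R \<Longrightarrow> y \<in> R \<Longrightarrow> x * y \<in> R" for x y
    using R(1) by (auto simp: \<F>_def)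
  have oneR: "1 \<in> R" using S SR by auto
  have zeroR: "0 \<in> R" using diffR[OF oneR oneR] by simp
  have addR: "x + y \<in> R" if "x \<in> R" "y \<in> R" for x y
    using diffR[OF that(1) diffR[OF zeroR that(2)]] by simp
  have powR: "x ^ n \<in> R" if "x \<in> R" for x n using that by (induction n) (auto intro: oneR multR)
  have sumR: "sum g I \<in> R" if "\<And>i. i \<in> I \<Longrightarrow> g i \<in> R" for g :: "nat \<Rightarrow> 'c" and I
    using that by (induction I rule: infinite_finite_induct) (auto intro: zeroR addR)
  have KI: "inverse x \<in> K" if "x \<in> K" for x using K that by (auto simp: is_subfield_def)

  define J where "J = {a \<in> S. a \<noteq> 0 \<and> inverse a \<notin> S}"
  have JI: "inverse y \<in> J" if "y \<in> K" "y \<notin> S" for y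
    using that S(2) S(4)[of y] S(3)[of 1 1] by (auto simp: J_def)
  have JR: "a * r \<noteq> 1" if "a \<in> J" "r \<in> R" for a r
  proof
    assume "a * r = 1"
    hence "inverse a = r" by (metis inverse_unique)
    thus False using that RK KI[of a] S(1) by (auto simp: J_def)
  qed
  \<comment> \<open>\<open>J\<close> is the maximal ideal of \<open>S\<close> without 0. Its
    elements are comparable by divisibility in \<open>S\<close>, so a combination of two of them is
    a multiple of a single one and \<open>JR\<close> applies.\<close>
  have JR2: "a * r + b * s \<noteq> 1" if ab: "a \<in> J" "b \<in> J" and rs: "r \<in> R" "s \<in> R" for a b r s
  proof -
    have *: "a * r + b * s \<noteq> 1" if "a \<in> J" "b / a \<in> S" "r \<in> R" "s \<in> R" for a b r s
    proof -
      have "a * (r + b / a * s) \<noteq> 1"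
        using that SR by (intro JR addR multR) auto
      thus ?thesis using that by (auto simp: J_def distrib_left)
    qed
    have "a \<in> K" "b \<in> K" using ab S(1) by (auto simp: J_def)
    hence "b * inverse a \<in> K" using K by (auto simp: is_subfield_def)
    hence "b / a \<in> S \<or> a / b \<in> S"
      using S(4)[of "b / a"] ab by (auto simp: J_def field_simps)
    thus ?thesis
      using *[of a b r s] *[of b a s r] ab rs by (auto simp: add.commute)
  qed

  \<comment> \<open>Inverting the powers of \<open>u = 1 - a * r\<close> creates no new element of
    \<open>K\<close>, as \<open>u ^ n\<close> is 1 modulo \<open>a\<close>; by maximality
    \<open>1 / u\<close> lies in \<open>R\<close> already.\<close>
  have local: "inverse (1 - a * r) \<in> R" if a: "a \<in> J" and r: "r \<in> R" for a r
  proof -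
    define u where "u = 1 - a * r"
    have u0: "u \<noteq> 0" using JR[OF a r] by (simp add: u_def)
    have aR: "a \<in> R" using a SR by (auto simp: J_def)
    have uR: "u \<in> R" using a r aR by (auto simp: u_def intro!: diffR oneR multR)
    have un: "\<exists>t\<in>R. u ^ n = 1 - a * t" for n
    proof (induction n)
      case 0 thus ?case by (auto intro!: bexI[of _ 0] zeroR)
    next
      case (Suc n)
      then obtain t where "t \<in> R" "u ^ n = 1 - a * t" by auto
      have "u ^ Suc n = (1 - a * r) * (1 - a * t)"
        using \<open>u ^ n = 1 - a * t\<close> by (simp add: u_def)
      also have "\<dots> = 1 - a * (t + r - r * a * t)" by (simp add: algebra_simps)
      finally show ?case using \<open>t \<in> R\<close> r aR by (blast intro: diffR addR multR)
    qed
    define R' where "R' = {s / u ^ n | s n. s \<in> R}"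
    have "R' \<in> \<F>"
      unfolding \<F>_def
    proof (intro CollectI conjI ballI subsetI)
      fix x assume "x \<in> S" thus "x \<in> R'"
        using SR unfolding R'_def by (intro CollectI exI[of _ x] exI[of _ 0]) auto
    next
      fix x assume "x \<in> R' \<inter> K"
      then obtain s n where s: "s \<in> R" "x = s / u ^ n" "x \<in> K" by (auto simp: R'_def)
      obtain t where t: "t \<in> R" "u ^ n = 1 - a * t" using un by auto
      show "x \<in> S"
      proof (rule ccontr)
        assume "x \<notin> S"
        hence x: "inverse x \<in> J" using s by (intro JI)
        hence "x \<noteq> 0" by (auto simp: J_def)
        hence "inverse x * s = u ^ n" using s u0 by (auto simp: field_simps)
        thus False using JR2[OF a x t(1) s(1)] t(2) by simp
      qed
    next
      fix x y assume "x \<in> R'" "y \<in> R'"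
      then obtain s n t m where st: "s \<in> R" "t \<in> R" "x = s / u ^ n" "y = t / u ^ m" by (auto simp: R'_def)
      have "x - y = (s * u ^ m - t * u ^ n) / u ^ (n + m)"
        using st u0 by (simp add: diff_frac_eq power_add)
      moreover have "s * u ^ m - t * u ^ n \<in> R" using st uR by (intro diffR multR powR)
      ultimately show "x - y \<in> R'" unfolding R'_def by blast
      have "x * y = s * t / u ^ (n + m)"
        using st u0 by (simp add: power_add)
      moreover have "s * t \<in> R" using st by (intro multR)
      ultimately show "x * y \<in> R'" unfolding R'_def by blast
    qed
    moreover have "R \<subseteq> R'" unfolding R'_def by (intro subsetI CollectI, rule_tac x = x in exI, rule_tac x = 0 in exI) auto
    ultimately have "R' = R" by (rule R(2))
    moreover have "inverse u \<in> R'" unfolding R'_def using oneR u0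
      by (intro CollectI exI[of _ 1]) (auto simp: field_simps)
    ultimately show ?thesis by (simp add: u_def)
  qed

  \<comment> \<open>\<open>E y n\<close> says that adjoining \<open>y\<close> would make the maximal
    ideal of \<open>S\<close> generate 1, by a relation of degree at most \<open>n\<close>.\<close>
  define E where "E = (\<lambda>y n. \<exists>a\<in>J. \<exists>p. (\<forall>i. p i \<in> R) \<and> a * (\<Sum>i\<le>n. p i * y ^ i) = 1)"
  have E_ex: "\<exists>n. E y n" if "y \<notin> R" for y
  proof -
    define R' where "R' = {poly P y | P. \<forall>i. coeff P i \<in> R}"
    have "R \<subseteq> R'"
    proof
      fix r assume "r \<in> R"
      thus "r \<in> R'" unfolding R'_def
        by (auto intro!: exI[of _ "[:r:]"] simp: coeff_pCons zeroR split: nat.splits)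
    qed
    moreover have "y \<in> R'" unfolding R'_def
      by (auto intro!: exI[of _ "[:0, 1:]"] simp: coeff_pCons zeroR oneR split: nat.splits)
    ultimately have "R' \<notin> \<F>" using R(2)[of R'] that by auto
    moreover have "x - z \<in> R' \<and> x * z \<in> R'" if xz: "x \<in> R'" "z \<in> R'" for x z
    proof -
      obtain P Q where PQ: "x = poly P y" "z = poly Q y" "\<forall>i. coeff P i \<in> R" "\<forall>i. coeff Q i \<in> R"
        using xz by (auto simp: R'_def)
      have "x - z = poly (P - Q) y" "x * z = poly (P * Q) y" using PQ by auto
      moreover have "\<forall>i. coeff (P - Q) i \<in> R" "\<forall>i. coeff (P * Q) i \<in> R"
        using PQ by (auto simp: coeff_mult intro!: diffR sumR multR)
      ultimately show ?thesis unfolding R'_def by blast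
    qed
    ultimately have "\<not> R' \<inter> K \<subseteq> S" using \<open>R \<subseteq> R'\<close> SR by (auto simp: \<F>_def)
    then obtain P where P: "\<forall>i. coeff P i \<in> R" "poly P y \<in> K" "poly P y \<notin> S"
      by (auto simp: R'_def)
    hence "inverse (poly P y) \<in> J" by (intro JI)
    moreover have "inverse (poly P y) * (\<Sum>i\<le>degree P. coeff P i * y ^ i) = 1"
      using calculation by (simp add: poly_altdef J_def)
    ultimately show ?thesis unfolding E_def using P(1) by blast
  qed

  \<comment> \<open>After multiplication by \<open>y ^ n\<close>, the relation for
    \<open>1 / y\<close> expresses \<open>y ^ n\<close> through lower powers, since
    \<open>1 - b * q 0\<close> is a unit. This is then substituted for the top power in the relation
    for \<open>y\<close>.\<close>
  have descent: "\<exists>n'<n. E y n'" if y: "y \<noteq> 0" and En: "E y n" and Em: "E (inverse y) m" and mn: "m \<le> n" for y n m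
  proof -
    obtain a p where p: "a \<in> J" "\<And>i. p i \<in> R" "a * (\<Sum>i\<le>n. p i * y ^ i) = 1"
      using En by (auto simp: E_def)
    obtain b q where q: "b \<in> J" "\<And>i. q i \<in> R" "b * (\<Sum>i\<le>m. q i * inverse y ^ i) = 1"
      using Em by (auto simp: E_def)
    have n0: "n \<noteq> 0"
      using p(3) JR[OF p(1) p(2)[of 0]] by (intro notI) simp
    define u where "u = 1 - b * q 0"
    have u: "inverse u \<in> R" "u \<noteq> 0"
      using local[OF q(1,2)] JR[OF q(1,2)] by (auto simp: u_def)
    define q' where "q' = (\<lambda>j. if j \<le> m then q j else 0)"
    have q'R: "q' j \<in> R" for j using q zeroR by (auto simp: q'_def)
    have "u * y ^ n = y ^ n * (b * (\<Sum>j\<le>m. q j * inverse y ^ j) - b * q 0)"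
      using q(3) by (simp add: u_def)
    also have "(\<Sum>j\<le>m. q j * inverse y ^ j) = (\<Sum>j\<le>n. q' j * inverse y ^ j)"
      using mn by (intro sum.mono_neutral_cong_left) (auto simp: q'_def)
    also have "\<dots> = q 0 + (\<Sum>j\<in>{1..n}. q' j * inverse y ^ j)"
      using n0 by (simp add: sum.atLeast1_atMost_eq sum.atMost_shift atMost_atLeast0 q'_def sum.atLeast_Suc_atMost)
    finally have "u * y ^ n = b * (\<Sum>j\<in>{1..n}. q' j * (y ^ n * inverse y ^ j))"
      by (simp add: algebra_simps sum_distrib_left)
    also have "(\<Sum>j\<in>{1..n}. q' j * (y ^ n * inverse y ^ j)) = (\<Sum>j\<in>{1..n}. q' j * y ^ (n - j))"
      using y by (intro sum.cong) (auto simp: power_diff field_simps)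
    also have "\<dots> = (\<Sum>i<n. q' (n - i) * y ^ i)"
      by (rule sum.reindex_bij_witness[of _ "\<lambda>i. n - i" "\<lambda>i. n - i"]) auto
    finally have yn: "y ^ n = b * inverse u * (\<Sum>i<n. q' (n - i) * y ^ i)"
      using u by (simp add: field_simps)
    define p' where "p' = (\<lambda>i. p i + p n * b * inverse u * q' (n - i))"
    have "b \<in> R" using q(1) SR by (auto simp: J_def)
    hence p'R: "p' i \<in> R" for i
      unfolding p'_def by (intro addR multR p(2) q'R u(1))
    have "(\<Sum>i\<le>n. p i * y ^ i) = (\<Sum>i<n. p i * y ^ i) + p n * y ^ n"
      unfolding lessThan_Suc_atMost[symmetric] by (rule sum.lessThan_Suc)
    also have "\<dots> = (\<Sum>i<n. p' i * y ^ i)"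
      by (subst yn) (simp add: p'_def sum.distrib sum_distrib_left distrib_right mult.assoc)
    also have "{..<n} = {..n - 1}" using n0 by auto
    finally have "a * (\<Sum>i\<le>n - 1. p' i * y ^ i) = 1" using p(3) by simp
    hence "E y (n - 1)" using p(1) p'R unfolding E_def by blast
    thus ?thesis using n0 by (intro exI[of _ "n - 1"]) auto
  qed

  have tot: "x \<in> R \<or> inverse x \<in> R" for x
  proof (rule ccontr)
    assume *: "\<not> (x \<in> R \<or> inverse x \<in> R)"
    hence x0: "x \<noteq> 0" using zeroR by auto
    define n where "n = (LEAST n. E x n)"
    define m where "m = (LEAST n. E (inverse x) n)"
    have xR: "x \<notin> R" "inverse x \<notin> R" using * by auto
    have n: "E x n" unfolding n_def by (rule LeastI_ex[OF E_ex[OF xR(1)]])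
    have n': "\<not> E x k" if "k < n" for k using not_less_Least that unfolding n_def .
    have m: "E (inverse x) m" unfolding m_def by (rule LeastI_ex[OF E_ex[OF xR(2)]])
    have m': "\<not> E (inverse x) k" if "k < m" for k using not_less_Least that unfolding m_def .
    show False
    proof (cases "m \<le> n")
      case True thus False using descent[OF x0 n m] n' by blast
    next
      case False thus False using descent[OF _ m, of n] n m' x0 by auto
    qed
  qed
  have "valuation_subring R"
    by unfold_locales (auto intro: oneR diffR multR simp: tot)
  moreover have "R \<inter> K = S" using SR RK S(1) by auto
  ultimately show ?thesis by (rule that)
qed

section \<open>Embeddings of an algebraically closed field\<close>

definition algebraic_over :: "'c::field set \<Rightarrow> 'c \<Rightarrow> bool" where
  "algebraic_over K x \<longleftrightarrow> (\<exists>P. P \<noteq> 0 \<and> (\<forall>i. coeff P i \<in> K) \<and> poly P x = 0)"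

text \<open>A relation \<open>a + x * P(x) = 0\<close> with \<open>a \<noteq> 0\<close> gives
  \<open>1/x = - P(x) / a\<close>. The induction strips off factors of the variable until the
  constant term is nonzero.\<close>

lemma inverse_eq_poly:
  assumes K: "is_subfield K" and alg: "algebraic_over K x"
  obtains Q where "\<And>i. coeff Q i \<in> K" "inverse x = poly Q x"
proof (cases "x = 0")
  case True
  have "1 - 1 \<in> K" using K unfolding is_subfield_def by blast
  thus ?thesis using True by (intro that[of 0]) auto
next
  case x0: False
  have *: "\<exists>Q. (\<forall>i. coeff Q i \<in> K) \<and> inverse x = poly Q x" if "P \<noteq> 0" "\<And>i. coeff P i \<in> K" "poly P x = 0" for P
    using that
  proof (induction P)
    case 0 thus ?case by simp
  next
    case (pCons a P)
    have aK: "a \<in> K" and PK: "coeff P i \<in> K" for i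
      using pCons.prems(2)[of 0] pCons.prems(2)[of "Suc i"] by auto
    show ?case
    proof (cases "a = 0")
      case True
      thus ?thesis using pCons PK x0 by auto
    next
      case False
      have "(1 - 1) - inverse a \<in> K" using K aK unfolding is_subfield_def by blast
      hence "- inverse a \<in> K" by simp
      hence "- inverse a * coeff P i \<in> K" for i using K PK unfolding is_subfield_def by auto
      moreover have "a = - (x * poly P x)" using pCons.prems by (simp add: add_eq_0_iff)
      hence "inverse x = poly (Polynomial.smult (- inverse a) P) x" using False x0 by (simp add: field_simps)
      ultimately show ?thesis by (intro exI[of _ "Polynomial.smult (- inverse a) P"]) simp
    qed
  qed
  thus ?thesis using alg that unfolding algebraic_over_def by blast
qed

lemma subfield_sum: "is_subfield K \<Longrightarrow> (\<And>i. i \<in> I \<Longrightarrow> g i \<in> K) \<Longrightarrow> sum g I \<in> K"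
proof (induction I rule: infinite_finite_induct)
  case (insert i I)
  have "1 - 1 \<in> K" using insert.prems(1) unfolding is_subfield_def by blast
  hence "0 - sum g I \<in> K" using insert unfolding is_subfield_def by auto
  hence "g i - (0 - sum g I) \<in> K" using insert.prems unfolding is_subfield_def by blast
  thus ?case using insert by simp
qed (auto simp: is_subfield_def intro: diff_self[of 1, THEN subst, of "\<lambda>x. x \<in> K"])

definition embeddings :: "'c::field set \<Rightarrow> ('c \<Rightarrow> 'c) set" where
  "embeddings K = {\<sigma>. \<sigma> 1 = 1 \<and> (\<forall>x y. \<sigma> (x - y) = \<sigma> x - \<sigma> y) \<and> (\<forall>x y. \<sigma> (x * y) = \<sigma> x * \<sigma> y) \<and> (\<forall>x\<in>K. \<sigma> x = x)}"

lemma
  assumes "\<sigma> \<in> embeddings K"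
  shows embeddings_one: "\<sigma> 1 = 1"
    and embeddings_diff: "\<sigma> (x - y) = \<sigma> x - \<sigma> y"
    and embeddings_mult: "\<sigma> (x * y) = \<sigma> x * \<sigma> y"
    and embeddings_fix: "x \<in> K \<Longrightarrow> \<sigma> x = x"
    and embeddings_zero: "\<sigma> 0 = 0"
    and embeddings_uminus: "\<sigma> (- x) = - \<sigma> x"
    and embeddings_add: "\<sigma> (x + y) = \<sigma> x + \<sigma> y"
    and embeddings_power: "\<sigma> (x ^ n) = \<sigma> x ^ n"
proof -
  show 1: "\<sigma> 1 = 1" and d: "\<And>x y. \<sigma> (x - y) = \<sigma> x - \<sigma> y" and m: "\<And>x y. \<sigma> (x * y) = \<sigma> x * \<sigma> y"
    and "x \<in> K \<Longrightarrow> \<sigma> x = x"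
    using assms by (auto simp: embeddings_def)
  show 0: "\<sigma> 0 = 0" using d[of 0 0] by simp
  show u: "\<sigma> (- x) = - \<sigma> x" for x using d[of 0 x] 0 by simp
  show "\<sigma> (x + y) = \<sigma> x + \<sigma> y" using d[of x "- y"] u[of y] by simp
  show "\<sigma> (x ^ n) = \<sigma> x ^ n" by (induction n) (simp_all add: 1 m)
qed

lemma embeddings_sum: "\<sigma> \<in> embeddings K \<Longrightarrow> \<sigma> (sum g I) = (\<Sum>i\<in>I. \<sigma> (g i))"
  by (induction I rule: infinite_finite_induct) (auto simp: embeddings_zero embeddings_add)

lemma embeddings_eq_0_iff: "\<sigma> \<in> embeddings K \<Longrightarrow> \<sigma> x = 0 \<longleftrightarrow> x = 0"
  using embeddings_mult[of \<sigma> K x "inverse x"] embeddings_one[of \<sigma> K] embeddings_zero[of \<sigma> K]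
  by (cases "x = 0") auto

lemma embeddings_inj: "\<sigma> \<in> embeddings K \<Longrightarrow> inj \<sigma>"
  using embeddings_eq_0_iff[of \<sigma> K] embeddings_diff[of \<sigma> K]
  by (metis eq_iff_diff_eq_0 injI)

lemma embeddings_inverse: "\<sigma> \<in> embeddings K \<Longrightarrow> \<sigma> (inverse x) = inverse (\<sigma> x)"
  using embeddings_mult[of \<sigma> K x "inverse x"] embeddings_one[of \<sigma> K] embeddings_zero[of \<sigma> K]
  by (cases "x = 0") (auto simp: inverse_unique)

lemma embeddings_divide: "\<sigma> \<in> embeddings K \<Longrightarrow> \<sigma> (x / y) = \<sigma> x / \<sigma> y"
  by (simp add: divide_inverse embeddings_mult embeddings_inverse)

lemma embeddings_id: "id \<in> embeddings K"
  by (simp add: embeddings_def)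

lemma embeddings_comp: "\<sigma> \<in> embeddings K \<Longrightarrow> \<tau> \<in> embeddings K \<Longrightarrow> \<sigma> \<circ> \<tau> \<in> embeddings K"
  by (simp add: embeddings_def)

lemma embeddings_funpow: "\<sigma> \<in> embeddings K \<Longrightarrow> \<sigma> ^^ n \<in> embeddings K"
  by (induction n) (auto simp: embeddings_id embeddings_comp)

lemma embeddings_poly:
  assumes "\<sigma> \<in> embeddings K" shows "\<sigma> (poly P x) = poly (map_poly \<sigma> P) (\<sigma> x)"
  by (induction P) (simp_all add: map_poly_pCons assms embeddings_zero[OF assms] embeddings_add[OF assms] embeddings_mult[OF assms])

lemma embeddings_map_poly_base:
  assumes "\<sigma> \<in> embeddings K" "\<And>i. coeff P i \<in> K" shows "map_poly \<sigma> P = P"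
  using assms by (intro poly_eqI) (simp add: coeff_map_poly embeddings_zero embeddings_fix)

lemma embeddings_root:
  assumes "\<sigma> \<in> embeddings K" "\<And>i. coeff P i \<in> K" "poly P x = 0" shows "poly P (\<sigma> x) = 0"
  using embeddings_poly[OF assms(1), of P x] embeddings_map_poly_base[OF assms(1,2)] assms(3)
  by (simp add: embeddings_zero[OF assms(1)])

lemma map_poly_mult_hom:
  fixes h :: "'a::comm_semiring_0 \<Rightarrow> 'b::comm_semiring_0"
  assumes "h 0 = 0" "\<And>x y. h (x + y) = h x + h y" "\<And>x y. h (x * y) = h x * h y"
  shows "map_poly h (P * Q) = map_poly h P * map_poly h Q"
proof -
  have "h (sum g I) = (\<Sum>i\<in>I. h (g i))" for g :: "nat \<Rightarrow> 'a" and I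
    by (induction I rule: infinite_finite_induct) (auto simp: assms)
  thus ?thesis by (intro poly_eqI) (simp add: coeff_map_poly coeff_mult assms)
qed

text \<open>
  The domain is only required to be a subring, since it is automatically a field when the
  extension is algebraic.
\<close>
definition partial_embedding :: "'c::field set \<Rightarrow> ('c \<times> 'c) set \<Rightarrow> bool" where
  "partial_embedding K G \<longleftrightarrow> (\<forall>x\<in>K. (x, x) \<in> G) \<and> (\<forall>y. (0, y) \<in> G \<longrightarrow> y = 0) \<and>
     (\<forall>x x' y y'. (x, x') \<in> G \<longrightarrow> (y, y') \<in> G \<longrightarrow> (x - y, x' - y') \<in> G \<and> (x * y, x' * y') \<in> G)"

section \<open>Extension of partial embeddings to the whole field\<close>

context
  fixes K :: "'c::alg_closed_field set"
  assumes K: "is_subfield K" and alg: "\<And>x. algebraic_over K x"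
begin

lemma base_zero: "0 \<in> K"
proof -
  have "1 - 1 \<in> K" using K unfolding is_subfield_def by blast
  thus ?thesis by simp
qed

context
  fixes G assumes G: "partial_embedding K G"
begin

lemma partial_embedding_diff: "(x, x') \<in> G \<Longrightarrow> (y, y') \<in> G \<Longrightarrow> (x - y, x' - y') \<in> G"
  and partial_embedding_mult: "(x, x') \<in> G \<Longrightarrow> (y, y') \<in> G \<Longrightarrow> (x * y, x' * y') \<in> G"
  and partial_embedding_base: "x \<in> K \<Longrightarrow> (x, x) \<in> G"
  and partial_embedding_0: "(0, y) \<in> G \<Longrightarrow> y = 0"
  using G by (simp_all add: partial_embedding_def)

lemma partial_embedding_zero: "(0, 0) \<in> G"
  using partial_embedding_base[OF base_zero] .

lemma partial_embedding_add: "(x, x') \<in> G \<Longrightarrow> (y, y') \<in> G \<Longrightarrow> (x + y, x' + y') \<in> G"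
  using partial_embedding_diff[OF _ partial_embedding_diff[OF partial_embedding_zero, of y y'], of x x'] by simp

lemma partial_embedding_sum:
  "(\<And>i. i \<in> I \<Longrightarrow> (g i, g' i) \<in> G) \<Longrightarrow> (sum g I, sum g' I) \<in> G"
  by (induction I rule: infinite_finite_induct) (auto intro: partial_embedding_zero partial_embedding_add)

lemma partial_embedding_unique: "(x, y) \<in> G \<Longrightarrow> (x, y') \<in> G \<Longrightarrow> y = y'"
  using partial_embedding_0[of "y - y'"] partial_embedding_diff[of x y x y'] by simp

text \<open>\<open>1/x\<close> is a polynomial in \<open>x\<close> over \<open>K\<close>, so it lies
  in the domain as well; its product with \<open>x\<close> would then send 1 to 0.\<close>

lemma partial_embedding_nonzero:
  assumes "(x, 0) \<in> G" shows "x = 0"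
proof (rule ccontr)
  assume x0: "x \<noteq> 0"
  have one: "(1, 1) \<in> G" using K by (auto intro!: partial_embedding_base simp: is_subfield_def)
  obtain Q where Q: "\<And>i. coeff Q i \<in> K" "inverse x = poly Q x"
    using inverse_eq_poly[OF K alg] by blast
  have "\<exists>y. (x ^ i, y) \<in> G" for i
  proof (induction i)
    case 0 thus ?case using one by auto
  next
    case (Suc i) thus ?case using assms by (auto intro: partial_embedding_mult)
  qed
  then obtain y where y: "\<And>i. (x ^ i, y i) \<in> G" by metis
  have "(\<Sum>i\<le>degree Q. coeff Q i * x ^ i, \<Sum>i\<le>degree Q. coeff Q i * y i) \<in> G"
    by (intro partial_embedding_sum partial_embedding_mult partial_embedding_base Q y)
  hence "(inverse x, \<Sum>i\<le>degree Q. coeff Q i * y i) \<in> G" by (simp add: Q(2) poly_altdef)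
  from partial_embedding_mult[OF assms this] have "(1, 0) \<in> G" using x0 by simp
  thus False using partial_embedding_unique[OF one] by fastforce
qed

definition poly_pairs :: "('c poly \<times> 'c poly) set" where
  "poly_pairs = {(P, P'). \<forall>i. (coeff P i, coeff P' i) \<in> G}"

lemma poly_pairs_diff: "(P, P') \<in> poly_pairs \<Longrightarrow> (Q, Q') \<in> poly_pairs \<Longrightarrow> (P - Q, P' - Q') \<in> poly_pairs"
  by (auto simp: poly_pairs_def intro: partial_embedding_diff)

lemma poly_pairs_mult: "(P, P') \<in> poly_pairs \<Longrightarrow> (Q, Q') \<in> poly_pairs \<Longrightarrow> (P * Q, P' * Q') \<in> poly_pairs"
  by (auto simp: poly_pairs_def coeff_mult intro!: partial_embedding_sum partial_embedding_mult)

lemma poly_pairs_monom: "(a, b) \<in> G \<Longrightarrow> (monom a n, monom b n) \<in> poly_pairs"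
  by (auto simp: poly_pairs_def partial_embedding_zero)

lemma poly_pairs_degree:
  assumes "(P, P') \<in> poly_pairs" shows "degree P' = degree P"
proof -
  have "coeff P i = 0 \<longleftrightarrow> coeff P' i = 0" for i
    using assms partial_embedding_0 partial_embedding_nonzero unfolding poly_pairs_def by (metis (mono_tags, lifting) case_prodD mem_Collect_eq)
  thus ?thesis by (simp add: degree_def)
qed

text \<open>Pseudo-division by \<open>h\<close>, carried out on both sides in parallel: minimality
  of \<open>degree h\<close> makes the remainder of \<open>P\<close> vanish, and \<open>h'\<close>
  kills \<beta>. Cross-multiplication with leading coefficients replaces division, for which
  inverses in the domain would be required.\<close>

lemma poly_pairs_root:
  assumes h: "(h, h') \<in> poly_pairs" "h \<noteq> 0" and root: "poly h' \<beta> = 0"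
    and min: "\<forall>(P, P')\<in>poly_pairs. P \<noteq> 0 \<longrightarrow> poly P \<alpha> = 0 \<longrightarrow> degree h \<le> degree P"
    and h\<alpha>: "poly h \<alpha> = 0"
  shows "(P, P') \<in> poly_pairs \<Longrightarrow> poly P \<alpha> = 0 \<Longrightarrow> poly P' \<beta> = 0"
proof (induction "if P = 0 then 0 else Suc (degree P)" arbitrary: P P' rule: less_induct)
  case less
  show ?case
  proof (cases "P = 0")
    case True
    have "P' = 0"
      using less.prems(1) partial_embedding_0 unfolding True poly_pairs_def by (auto intro: poly_eqI)
    thus ?thesis by simp
  next
    case False
    define m where "m = degree P - degree h"
    define a a' b b' where "a = lead_coeff h" "a' = lead_coeff h'" "b = lead_coeff P" "b' = lead_coeff P'"
    have le: "degree h \<le> degree P" using min less.prems False by blast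
    have aG: "(a, a') \<in> G" "(b, b') \<in> G"
      using h(1) less.prems(1) poly_pairs_degree[OF h(1)] poly_pairs_degree[OF less.prems(1)]
      by (auto simp: poly_pairs_def a_a'_b_b'_def)
    have a0: "a \<noteq> 0" using h by (simp add: a_a'_b_b'_def)
    hence a'0: "a' \<noteq> 0" using aG partial_embedding_nonzero by auto
    define Q where "Q = monom a 0 * P - monom b m * h"
    define Q' where "Q' = monom a' 0 * P' - monom b' m * h'"
    have QQ: "(Q, Q') \<in> poly_pairs"
      unfolding Q_def Q'_def using aG h(1) less.prems(1)
      by (intro poly_pairs_diff poly_pairs_mult poly_pairs_monom)
    have b0: "b \<noteq> 0" using False by (simp add: a_a'_b_b'_def)
    have d1: "degree (monom a 0 * P) = degree P" "degree (monom b m * h) = degree P"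
      using a0 b0 h False le by (simp_all add: degree_mult_eq degree_monom_eq m_def)
    have "coeff (monom b m * h) (degree P) = b * a"
      using le by (simp add: coeff_monom_mult m_def a_a'_b_b'_def)
    hence "coeff Q (degree P) = 0"
      by (simp add: Q_def coeff_monom_mult a_a'_b_b'_def)
    moreover have "degree Q \<le> degree P"
      unfolding Q_def using d1 by (metis degree_diff_le order_refl)
    ultimately have "Q = 0 \<or> degree Q < degree P"
      by (metis leading_coeff_0_iff le_neq_implies_less)
    moreover have "poly Q \<alpha> = 0" using less.prems h\<alpha> by (simp add: Q_def poly_monom)
    ultimately have "poly Q' \<beta> = 0" using less.hyps[OF _ QQ] False by auto
    thus ?thesis using root a'0 by (simp add: Q'_def poly_monom)
  qed
qed

lemma partial_embedding_extend:
  assumes h: "(h, h') \<in> poly_pairs" "h \<noteq> 0" and root: "poly h' \<beta> = 0"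
    and min: "\<forall>(P, P')\<in>poly_pairs. P \<noteq> 0 \<longrightarrow> poly P \<alpha> = 0 \<longrightarrow> degree h \<le> degree P"
    and h\<alpha>: "poly h \<alpha> = 0"
  obtains G' where "partial_embedding K G'" "G \<subseteq> G'" "(\<alpha>, \<beta>) \<in> G'"
proof -
  define G' where "G' = {(poly P \<alpha>, poly P' \<beta>) | P P'. (P, P') \<in> poly_pairs}"
  have GG: "(x, y) \<in> G'" if "(x, y) \<in> G" for x y
    unfolding G'_def using poly_pairs_monom[OF that, of 0]
    by (intro CollectI exI[of _ "monom x 0"] exI[of _ "monom y 0"]) (simp add: poly_monom)
  have "(1, 1) \<in> G" using K by (auto intro!: partial_embedding_base simp: is_subfield_def)
  from poly_pairs_monom[OF this, of 1] have "(\<alpha>, \<beta>) \<in> G'"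
    unfolding G'_def by (intro CollectI exI[of _ "monom 1 1"]) (simp add: poly_monom)
  moreover have "partial_embedding K G'"
    unfolding partial_embedding_def
  proof (intro conjI ballI allI impI)
    fix x assume "x \<in> K" thus "(x, x) \<in> G'" by (intro GG partial_embedding_base)
  next
    fix y assume "(0, y) \<in> G'"
    thus "y = 0" unfolding G'_def using poly_pairs_root[OF h root min h\<alpha>] by auto
  next
    fix x x' y y' assume "(x, x') \<in> G'" "(y, y') \<in> G'"
    then obtain P P' Q Q' where PQ: "(P, P') \<in> poly_pairs" "(Q, Q') \<in> poly_pairs"
      "x = poly P \<alpha>" "x' = poly P' \<beta>" "y = poly Q \<alpha>" "y' = poly Q' \<beta>"
      by (auto simp: G'_def)
    have "x - y = poly (P - Q) \<alpha>" "x' - y' = poly (P' - Q') \<beta>"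
      "x * y = poly (P * Q) \<alpha>" "x' * y' = poly (P' * Q') \<beta>" using PQ by auto
    thus "(x - y, x' - y') \<in> G'" "(x * y, x' * y') \<in> G'"
      unfolding G'_def using poly_pairs_diff[OF PQ(1,2)] poly_pairs_mult[OF PQ(1,2)] by blast+
  qed
  ultimately show ?thesis using GG by (intro that[of G']) auto
qed

end

lemma min_poly_pair_exists:
  assumes "partial_embedding K G"
  obtains h h' where "(h, h') \<in> poly_pairs G" "h \<noteq> 0" "poly h \<alpha> = 0"
    "\<forall>(P, P')\<in>poly_pairs G. P \<noteq> 0 \<longrightarrow> poly P \<alpha> = 0 \<longrightarrow> degree h \<le> degree P"
proof -
  obtain P where P: "P \<noteq> 0" "\<And>i. coeff P i \<in> K" "poly P \<alpha> = 0" using alg[of \<alpha>] unfolding algebraic_over_def by blast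
  hence "(P, P) \<in> poly_pairs G" using partial_embedding_base[OF assms] by (auto simp: poly_pairs_def[OF assms])
  hence "\<exists>n h h'. (h, h') \<in> poly_pairs G \<and> h \<noteq> 0 \<and> poly h \<alpha> = 0 \<and> degree h = n" using P by auto
  from exists_least_iff[THEN iffD1, OF this] obtain n h h' where
    nh: "\<And>m. m < n \<Longrightarrow> \<not> (\<exists>h h'. (h, h') \<in> poly_pairs G \<and> h \<noteq> 0 \<and> poly h \<alpha> = 0 \<and> degree h = m)"
    "(h, h') \<in> poly_pairs G" "h \<noteq> 0" "poly h \<alpha> = 0" "degree h = n" by blast
  show ?thesis
    by (rule that[OF nh(2-4)]) (use nh(1,5) not_le in blast)
qed

text \<open>A maximal extension is defined everywhere: the image of a minimal polynomial of \<alpha>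
  over the domain has a root in the algebraically closed field, and \<alpha> can be sent
  there.\<close>

lemma embedding_extending:
  assumes "partial_embedding K G"
  obtains \<sigma> where "\<sigma> \<in> embeddings K" "\<And>x y. (x, y) \<in> G \<Longrightarrow> \<sigma> x = y"
proof -
  define \<F> where "\<F> = {G'. partial_embedding K G' \<and> G \<subseteq> G'}"
  have "\<exists>M\<in>\<F>. \<forall>T\<in>\<F>. M \<subseteq> T \<longrightarrow> T = M"
  proof (rule subset_Zorn_nonempty)
    show "\<F> \<noteq> {}" using assms by (auto simp: \<F>_def)
    fix \<C> assume \<C>: "\<C> \<noteq> {}" "subset.chain \<F> \<C>"
    have sub: "partial_embedding K Z" "G \<subseteq> Z" if "Z \<in> \<C>" for Z
      using \<C>(2) that unfolding subset.chain_def \<F>_def by blast+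
    have "partial_embedding K (\<Union>\<C>)"
      unfolding partial_embedding_def
    proof (intro conjI ballI allI impI)
      fix x assume "x \<in> K" thus "(x, x) \<in> \<Union>\<C>" using \<C>(1) sub(1) partial_embedding_base by blast
    next
      fix y assume "(0, y) \<in> \<Union>\<C>" thus "y = 0" using sub(1) partial_embedding_0 by blast
    next
      fix x x' y y' assume "(x, x') \<in> \<Union>\<C>" "(y, y') \<in> \<Union>\<C>"
      then obtain Z where "Z \<in> \<C>" "(x, x') \<in> Z" "(y, y') \<in> Z"
        using \<C>(2) unfolding subset.chain_def by blast
      thus "(x - y, x' - y') \<in> \<Union>\<C>" "(x * y, x' * y') \<in> \<Union>\<C>"
        using partial_embedding_diff partial_embedding_mult sub(1) by blast+
    qed
    thus "\<Union>\<C> \<in> \<F>" using \<C>(1) sub(2) unfolding \<F>_def by blast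
  qed
  then obtain M where M: "partial_embedding K M" "G \<subseteq> M" "\<And>T. partial_embedding K T \<Longrightarrow> M \<subseteq> T \<Longrightarrow> T = M"
    unfolding \<F>_def by auto
  have "\<exists>\<beta>. (\<alpha>, \<beta>) \<in> M" for \<alpha>
  proof -
    obtain h h' where h: "(h, h') \<in> poly_pairs M" "h \<noteq> 0" "poly h \<alpha> = 0"
      "\<forall>(P, P')\<in>poly_pairs M. P \<noteq> 0 \<longrightarrow> poly P \<alpha> = 0 \<longrightarrow> degree h \<le> degree P"
      using min_poly_pair_exists[OF M(1)] by blast
    have "degree h \<noteq> 0"
    proof
      assume "degree h = 0"
      then obtain c where "h = [:c:]" by (rule degree_eq_zeroE)
      thus False using h(2,3) by simp
    qed
    hence "degree h' > 0" using poly_pairs_degree[OF M(1) h(1)] by simp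
    then obtain \<beta> where "poly h' \<beta> = 0" using alg_closed_imp_poly_has_root by blast
    from partial_embedding_extend[OF M(1) h(1,2) this h(4,3)] show ?thesis using M(3) by blast
  qed
  then obtain \<sigma> where \<sigma>: "\<And>x. (x, \<sigma> x) \<in> M" by metis
  have \<sigma>': "\<sigma> x = y" if "(x, y) \<in> M" for x y
    using partial_embedding_unique[OF M(1) \<sigma> that] .
  have "\<sigma> \<in> embeddings K"
    unfolding embeddings_def using K
    by (auto intro!: \<sigma>' partial_embedding_diff[OF M(1)] partial_embedding_mult[OF M(1)] \<sigma>
             partial_embedding_base[OF M(1)] simp: is_subfield_def)
  thus ?thesis using \<sigma>' M(2) by (intro that) auto
qed

text \<open>Every root of the minimal polynomial of \<open>y\<close> is an image of
  \<open>y\<close>, so the polynomial is a multiple of \<open>(X - y)^m\<close>. If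
  \<open>m = p ^ N * r\<close> with \<open>p\<close> not dividing \<open>r\<close>, the binomial
  coefficient of \<open>m\<close> over \<open>p ^ N\<close> is prime to \<open>p\<close>, and the
  coefficient of \<open>X^(m - p^N)\<close> exhibits \<open>y ^ (p ^ N)\<close> as an element of
  \<open>K\<close>.\<close>

lemma fixed_imp_purely_inseparable:
  assumes p: "prime p" "CHAR('c) = p" and fixed: "\<And>\<sigma>. \<sigma> \<in> embeddings K \<Longrightarrow> \<sigma> y = y"
  shows "\<exists>N. y ^ (p ^ N) \<in> K"
proof -
  define G where "G = {(x, x) | x. x \<in> K}"
  have G: "partial_embedding K G"
    using K unfolding partial_embedding_def G_def is_subfield_def by auto
  obtain h h' where h: "(h, h') \<in> poly_pairs G" "h \<noteq> 0" "poly h y = 0"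
      "\<forall>(P, P')\<in>poly_pairs G. P \<noteq> 0 \<longrightarrow> poly P y = 0 \<longrightarrow> degree h \<le> degree P"
    using min_poly_pair_exists[OF G] by blast
  have "(coeff h i, coeff h' i) \<in> G" for i using h(1) by (simp add: poly_pairs_def[OF G])
  hence hK: "coeff h i \<in> K" and "coeff h' i = coeff h i" for i by (auto simp: G_def)
  hence h': "h' = h" by (intro poly_eqI) auto
  have root: "y' = y" if "poly h y' = 0" for y'
  proof -
    have "poly h' y' = 0" using that h' by simp
    from partial_embedding_extend[OF G h(1,2) this h(4,3)]
    obtain G' where G': "partial_embedding K G'" "(y, y') \<in> G'" by blast
    obtain \<sigma> where "\<sigma> \<in> embeddings K" "\<sigma> y = y'"
      using embedding_extending[OF G'(1)] G'(2) by metis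
    thus ?thesis using fixed by auto
  qed
  obtain A where A: "size A = degree h" "h = Polynomial.smult (lead_coeff h) (\<Prod>x\<in>#A. [:-x, 1:])"
    using alg_closed_imp_factorization[OF h(2)] by auto
  have "x = y" if "x \<in># A" for x
  proof (rule root)
    have "[:-x, 1:] dvd (\<Prod>x\<in>#A. [:-x, 1:])" using that by (intro dvd_prod_mset) auto
    hence "[:-x, 1:] dvd h" by (subst A(2)) (rule dvd_smult)
    thus "poly h x = 0" by (simp add: poly_eq_0_iff_dvd)
  qed
  hence "A = replicate_mset (degree h) y"
    using A(1) by (metis set_mset_subset_singletonD singletonI subsetI)
  hence heq: "h = Polynomial.smult (lead_coeff h) ([:-y, 1:] ^ degree h)"
    using A(2) by simp
  define m where "m = degree h"
  have m0: "m > 0"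
  proof (rule Nat.gr0I)
    assume "m = 0"
    then obtain c where "h = [:c:]" unfolding m_def by (rule degree_eq_zeroE)
    thus False using h(2,3) by simp
  qed
  obtain N r where Nr: "m = p ^ N * r" "\<not> p dvd r"
    using m0 p prime_power_canonical[of p m] by (metis mult.commute)
  have r0: "r > 0" using Nr m0 by (intro Nat.gr0I) auto
  have "multiplicity p (m choose (p ^ N)) = multiplicity p r"
    using const_p_fac[of r p N] r0 p Nr by simp
  hence "\<not> p dvd (m choose (p ^ N))"
    using Nr r0 m0 p(1) by (metis One_nat_def dvd_imp_le le_add1 mult.right_neutral mult_le_mono2
        not_dvd_imp_multiplicity_0 not_less_eq_eq prime_multiplicity_gt_zero_iff prime_imp_prime_elem
        zero_less_binomial_iff less_irrefl add.commute plus_1_eq_Suc Suc_leI neq0_conv)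
  hence b0: "(of_nat (m choose (p ^ N)) :: 'c) \<noteq> 0"
    using p by (simp add: of_nat_eq_0_iff_char_dvd)
  have le: "p ^ N \<le> m" using Nr r0 by simp
  have "coeff h (m - p ^ N) = lead_coeff h * (of_nat (m choose (p ^ N)) * (-y) ^ (p ^ N))"
    using le by (subst heq) (simp add: coeff_linear_poly_power m_def[symmetric] binomial_symmetric[OF le])
  hence "(-y) ^ (p ^ N) = coeff h (m - p ^ N) * inverse (lead_coeff h) * inverse (of_nat (m choose (p ^ N)))"
    using b0 h(2) by (simp add: field_simps)
  moreover have "(of_nat n :: 'c) \<in> K" for n
  proof (induction n)
    case (Suc n)
    have "of_nat n - (0 - 1) \<in> K" using K Suc base_zero unfolding is_subfield_def by blast
    thus ?case by (simp add: add.commute)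
  qed (simp add: base_zero)
  ultimately have "(-y) ^ (p ^ N) \<in> K"
    using hK K by (simp add: is_subfield_def)
  moreover from this have "0 - (-y) ^ (p ^ N) \<in> K"
    using K base_zero unfolding is_subfield_def by blast
  ultimately have "y ^ (p ^ N) \<in> K" by (cases "even (p ^ N)") simp_all
  thus ?thesis by blast
qed

end

section \<open>Lifting the Frobenius automorphism\<close>

lemma poly_map_poly_hom:
  fixes h :: "'a::comm_semiring_0 \<Rightarrow> 'b::comm_semiring_0"
  assumes "h 0 = 0" "\<And>x y. h (x + y) = h x + h y" "\<And>x y. h (x * y) = h x * h y"
  shows "poly (map_poly h P) (h x) = h (poly P x)"
  by (induction P) (simp_all add: map_poly_pCons assms)

lemma map_poly_add_hom:
  assumes "h 0 = 0" "\<And>x y. h (x + y) = h x + h y"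
  shows "map_poly h (P + Q) = map_poly h P + map_poly h Q"
  by (intro poly_eqI) (simp add: coeff_map_poly assms)

lemma freshmans_dream_diff:
  fixes x y :: "'a::comm_ring_1"
  assumes "prime CHAR('a)" "m = CHAR('a) ^ n"
  shows "(x - y) ^ m = x ^ m - y ^ m"
  using freshmans_dream'[of m n "x - y" y] assms by (simp add: algebra_simps)

section \<open>Gauss's lemma over a valuation ring\<close>

context valuation_subring
begin

lemma coeff_mult_mem:
  assumes "\<And>i. coeff P i \<in> R" "\<And>i. coeff Q i \<in> R" shows "coeff (P * Q) i \<in> R"
  using assms by (auto simp: coeff_mult intro!: sum_mem mult_mem)

lemma coeff_power_mem:
  assumes "\<And>i. coeff P i \<in> R" shows "coeff (P ^ n) i \<in> R"
proof (induction n arbitrary: i)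
  case (Suc n)
  show ?case unfolding power_Suc by (rule coeff_mult_mem[OF assms Suc])
qed (simp add: coeff_1)

definition primitive :: "'c poly \<Rightarrow> bool" where
  "primitive P \<longleftrightarrow> (\<forall>i. coeff P i \<in> R) \<and> (\<exists>i. coeff P i \<notin> max_ideal)"

text \<open>Gauss's lemma: if \<open>i\<close> and \<open>j\<close> are the first positions with
  coefficients outside the maximal ideal, all other contributions to the coefficient at
  \<open>i + j\<close> lie in it.\<close>

lemma primitive_mult:
  assumes P: "primitive P" and Q: "primitive Q" shows "primitive (P * Q)"
proof -
  obtain i where i: "coeff P i \<notin> max_ideal" and i': "\<And>k. k < i \<Longrightarrow> coeff P k \<in> max_ideal"
    using P exists_least_iff[of "\<lambda>i. coeff P i \<notin> max_ideal"] unfolding primitive_def by blast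
  obtain j where j: "coeff Q j \<notin> max_ideal" and j': "\<And>k. k < j \<Longrightarrow> coeff Q k \<in> max_ideal"
    using Q exists_least_iff[of "\<lambda>i. coeff Q i \<notin> max_ideal"] unfolding primitive_def by blast
  have PR: "coeff P k \<in> R" and QR: "coeff Q k \<in> R" for k using P Q by (auto simp: primitive_def)
  define S where "S = (\<Sum>k\<in>{..i + j} - {i}. coeff P k * coeff Q (i + j - k))"
  have S: "S \<in> max_ideal"
    unfolding S_def
  proof (rule max_ideal_sum)
    fix k assume k: "k \<in> {..i + j} - {i}"
    show "coeff P k * coeff Q (i + j - k) \<in> max_ideal"
    proof (cases "k < i")
      case True thus ?thesis by (intro max_ideal_mult i' QR)
    next
      case False thus ?thesis using k by (intro max_ideal_mult' j' PR) auto
    qed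
  qed
  have eq: "coeff (P * Q) (i + j) = coeff P i * coeff Q j + S"
    unfolding S_def coeff_mult by (subst sum.remove[of _ i]) auto
  have "coeff (P * Q) (i + j) \<notin> max_ideal"
  proof
    assume "coeff (P * Q) (i + j) \<in> max_ideal"
    from max_ideal_diff[OF this S] have "coeff P i * coeff Q j \<in> max_ideal" by (simp add: eq)
    thus False using max_ideal_prime[OF PR QR] i j by blast
  qed
  thus ?thesis unfolding primitive_def using coeff_mult_mem[OF PR QR] by blast
qed

lemma primitive_prod:
  "finite I \<Longrightarrow> (\<And>i. i \<in> I \<Longrightarrow> primitive (g i)) \<Longrightarrow> primitive (prod g I)"
proof (induction I rule: finite_induct)
  case empty show ?case by (auto simp: primitive_def coeff_1 intro!: exI[of _ 0])
qed (auto intro: primitive_mult)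

text \<open>Conjugates \<open>v\<close> of an integral polynomial need not be integral. Here
  \<open>e\<close> is 1 or the largest coefficient of \<open>v\<close>; in the second case
  \<open>w / e\<close> reduces to 0, and the coefficient 1 of \<open>v / e\<close> makes the
  difference primitive.\<close>

lemma primitive_diff_scaled:
  assumes w: "\<And>i. coeff w i \<in> R" and v: "coeff (w - v) i \<notin> max_ideal"
  obtains e where "e \<noteq> 0" "inverse e \<in> R" "\<And>i. inverse e * coeff v i \<in> R"
    "primitive (Polynomial.smult (inverse e) (w - v))"
proof (cases "\<forall>i. coeff v i \<in> R")
  case True
  thus ?thesis using w v by (intro that[of 1]) (auto simp: primitive_def intro: diff_mem)
next
  case False
  then obtain k where k: "coeff v k \<notin> R" by auto
  obtain j where j: "\<And>i. i \<le> degree v \<Longrightarrow> coeff v i \<preceq> coeff v j"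
    using vle_max_exists[of "{..degree v}" "coeff v"] by auto
  define e where "e = coeff v j"
  have all: "coeff v i \<preceq> e" for i
    using j[of i] by (cases "i \<le> degree v") (auto simp: e_def coeff_eq_0)
  have "\<not> e \<preceq> 1" using k vle_trans[OF all[of k], of 1] by auto
  hence eR: "e \<notin> R" by simp
  hence e0: "e \<noteq> 0" and ie: "inverse e \<in> max_ideal" by (auto intro: inverse_in_max_ideal)
  have v': "inverse e * coeff v i \<in> R" for i
    using all[of i] e0 by (simp add: vle_iff divide_inverse mult.commute)
  have w': "inverse e * coeff w i \<in> max_ideal" for i
    using ie w by (intro max_ideal_mult)
  have "primitive (Polynomial.smult (inverse e) (w - v))"
    unfolding primitive_def
  proof (intro conjI allI exI)
    fix i show "coeff (Polynomial.smult (inverse e) (w - v)) i \<in> R"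
      using v'[of i] w'[of i] by (auto simp: right_diff_distrib intro!: diff_mem dest: max_ideal_subset)
    have "coeff (Polynomial.smult (inverse e) (w - v)) j = inverse e * coeff w j - 1"
      using e0 by (simp add: right_diff_distrib e_def)
    moreover have "inverse e * coeff w j - 1 \<notin> max_ideal"
      using max_ideal_diff[OF w'[of j], of "inverse e * coeff w j - 1"] by auto
    ultimately show "coeff (Polynomial.smult (inverse e) (w - v)) j \<notin> max_ideal" by simp
  qed
  thus ?thesis using e0 ie v' by (intro that[of e]) (auto dest: max_ideal_subset)
qed

end

text \<open>Finiteness of the residue field is present as \<open>frob_base\<close>: residues from
  \<open>K\<close> are fixed by the \<open>q\<close>-th power. This power is additive, since
  \<open>q\<close> is a power of the characteristic.\<close>

locale residually_finite = valuation_subring R for R :: "'c::alg_closed_field set" +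
  fixes K :: "'c set" and p s q :: nat
  assumes K: "is_subfield K" and alg: "\<And>x. algebraic_over K x"
    and p: "prime p" "CHAR('c) = p" and q: "q = p ^ s" and s: "s > 0"
    and frob_base: "\<And>x. x \<in> K \<Longrightarrow> x \<in> R \<Longrightarrow> x ^ q - x \<in> max_ideal"
begin

lemma q_gt_1: "q > 1"
  unfolding q using one_less_power[OF prime_gt_1_nat[OF p(1)] s] .

lemma power_q_add: "(x + y) ^ q = x ^ q + y ^ q" for x y :: 'c
  using freshmans_dream'[of q s x y] p q by simp

text \<open>Some \<open>c ^ (p ^ N)\<close> lies in \<open>K\<close> and satisfies the congruence.
  Powers with exponent \<open>p ^ N\<close> are additive, so what is known is the
  \<open>p ^ N\<close>-th power of what is wanted, and the maximal ideal is radical.\<close>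

lemma fixed_frob:
  assumes "c \<in> R" "\<And>\<sigma>. \<sigma> \<in> embeddings K \<Longrightarrow> \<sigma> c = c" shows "c ^ q - c \<in> max_ideal"
proof -
  obtain N where N: "c ^ (p ^ N) \<in> K"
    using fixed_imp_purely_inseparable[OF K alg p] assms(2) by blast
  have "(c ^ (p ^ N)) ^ q - c ^ (p ^ N) \<in> max_ideal"
    using N assms(1) by (intro frob_base power_mem)
  also have "(c ^ (p ^ N)) ^ q - c ^ (p ^ N) = (c ^ q - c) ^ (p ^ N)"
    using freshmans_dream_diff[of "p ^ N" N "c ^ q" c] p by (simp add: mult.commute flip: power_mult)
  finally show ?thesis by (rule max_ideal_power[rotated]) (use assms(1) in \<open>auto intro: diff_mem power_mem\<close>)
qed

lemma finite_orbit: "finite ((\<lambda>\<sigma>. \<sigma> x) ` embeddings K)"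
proof -
  obtain P where P: "P \<noteq> 0" "\<And>i. coeff P i \<in> K" "poly P x = 0"
    using alg[of x] unfolding algebraic_over_def by blast
  show ?thesis
    by (rule finite_subset[OF _ poly_roots_finite[OF P(1)]]) (use P(1) embeddings_root[OF _ P(2,3)] in auto)
qed

text \<open>
  The product of \<open>Y - v(T)\<close> over the conjugates \<open>v\<close> of \<open>u \<in> R[T]\<close> has, after normalisation, a
  reduction with coefficients in the field of \<open>q\<close> elements. It vanishes at \<open>Y = u\<close>, so also at the Frobenius
  twist of \<open>u\<close>; by Gauss's lemma one of the factors must then reduce to zero at that place.
\<close>
lemma frobenius_lift:
  assumes A: "finite A" "A \<subseteq> R"
  obtains \<sigma> where "\<sigma> \<in> embeddings K" "\<And>x. x \<in> A \<Longrightarrow> \<sigma> x - x ^ q \<in> max_ideal"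
proof -
  obtain xs where xs: "set xs = A" using finite_list A by blast
  \<comment> \<open>Packing the elements of \<open>A\<close> into one polynomial makes a single
    conjugate, and hence a single \<sigma>, serve all of them.\<close>
  define u where "u = Poly xs"
  have uc: "coeff u i \<in> R" for i
    using A xs by (auto simp: u_def nth_default_def)
  define conj where "conj = (\<lambda>\<sigma>. map_poly \<sigma> u) ` embeddings K"
  define G where "G = (\<Prod>v\<in>conj. [:-v, 1:])"
  have fin: "finite conj"
  proof -
    define S where "S = (\<Union>x\<in>A. (\<lambda>\<sigma>. \<sigma> x) ` embeddings K)"
    have "finite S" unfolding S_def using A finite_orbit by auto
    have "conj \<subseteq> Poly ` {ys. set ys \<subseteq> S \<and> length ys = length xs}"
    proof
      fix v assume "v \<in> conj"
      then obtain \<sigma> where \<sigma>: "\<sigma> \<in> embeddings K" "v = map_poly \<sigma> u" by (auto simp: conj_def)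
      have "v = Poly (map \<sigma> xs)"
        using \<sigma> by (intro poly_eqI) (auto simp: u_def coeff_map_poly embeddings_zero nth_default_def)
      moreover have "set (map \<sigma> xs) \<subseteq> S" using \<sigma> xs by (auto simp: S_def)
      ultimately show "v \<in> Poly ` {ys. set ys \<subseteq> S \<and> length ys = length xs}" by auto
    qed
    thus ?thesis using finite_lists_length_eq[OF \<open>finite S\<close>] finite_subset by blast
  qed
  have fixG: "\<tau> (coeff (coeff G a) b) = coeff (coeff G a) b" if \<tau>: "\<tau> \<in> embeddings K" for \<tau> a b
  proof -
    let ?h = "map_poly \<tau>"
    have "?h (x * y) = ?h x * ?h y" for x y
      using \<tau> by (intro map_poly_mult_hom) (auto simp: embeddings_zero embeddings_add embeddings_mult)
    moreover have "?h 0 = 0" "?h (x + y) = ?h x + ?h y" "?h 1 = 1" "?h (-x) = - ?h x" for x y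
      using \<tau> by (auto intro!: map_poly_add_hom poly_eqI
        simp: coeff_map_poly embeddings_zero embeddings_add embeddings_one embeddings_uminus map_poly_1')
    ultimately have h: "?h 0 = 0" "?h (x + y) = ?h x + ?h y" "?h (x * y) = ?h x * ?h y" "?h 1 = 1" "?h (-x) = - ?h x" for x y
      by blast+
    have prod: "map_poly ?h (prod g I) = (\<Prod>i\<in>I. map_poly ?h (g i))" for g :: "'c poly \<Rightarrow> 'c poly poly" and I
      by (induction I rule: infinite_finite_induct) (auto simp: map_poly_mult_hom h map_poly_1')
    have inj: "inj_on ?h conj"
      using embeddings_inj[OF \<tau>] \<tau>
      by (intro inj_onI poly_eqI) (metis coeff_map_poly embeddings_zero injD)
    have "?h ` conj \<subseteq> conj"
    proof
      fix v assume "v \<in> ?h ` conj"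
      then obtain \<sigma> where \<sigma>: "\<sigma> \<in> embeddings K" "v = ?h (map_poly \<sigma> u)" by (auto simp: conj_def)
      have "v = map_poly (\<tau> \<circ> \<sigma>) u"
        using \<sigma> \<tau> by (intro poly_eqI) (simp add: coeff_map_poly embeddings_zero)
      thus "v \<in> conj" using embeddings_comp[OF \<tau> \<sigma>(1)] by (auto simp: conj_def)
    qed
    hence im: "?h ` conj = conj" using endo_inj_surj[OF fin _ inj] by blast
    have "map_poly ?h G = (\<Prod>v\<in>conj. [:- ?h v, 1:])"
      unfolding G_def prod by (intro prod.cong) (auto simp: map_poly_pCons h)
    also have "\<dots> = (\<Prod>v\<in>?h ` conj. [:- v, 1:])"
      by (simp add: prod.reindex[OF inj])
    also have "\<dots> = G" by (simp only: im G_def)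
    finally have "coeff (coeff (map_poly ?h G) a) b = coeff (coeff G a) b" by simp
    thus ?thesis using h \<tau> by (simp add: coeff_map_poly embeddings_zero)
  qed
  have Gnz: "G \<noteq> 0" using fin by (simp add: G_def)
  obtain a0 b0 where ab0: "\<And>a b. a \<le> degree G \<Longrightarrow> b \<le> degree (coeff G a) \<Longrightarrow> coeff (coeff G a) b \<preceq> coeff (coeff G a0) b0"
    using vle_max_exists[of "Sigma {..degree G} (\<lambda>a. {..degree (coeff G a)})" "\<lambda>(a, b). coeff (coeff G a) b"]
    by fastforce
  \<comment> \<open>\<open>G\<close> need not be integral, because its factors need not be. Division
    by its largest coefficient gives an integral \<open>H\<close> whose coefficients are still fixed
    by all embeddings.\<close>
  define g where "g = coeff (coeff G a0) b0"
  have gmax: "coeff (coeff G a) b \<preceq> g" for a b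
    using ab0[of a b] by (cases "a \<le> degree G"; cases "b \<le> degree (coeff G a)") (auto simp: g_def coeff_eq_0)
  have g0: "g \<noteq> 0"
  proof
    assume "g = 0"
    hence "coeff (coeff G a) b = 0" for a b using gmax[of a b] by simp
    hence "G = 0" by (intro poly_eqI) simp
    thus False using Gnz by simp
  qed
  define H where "H = Polynomial.smult [:inverse g:] G"
  have coeffH: "coeff (coeff H a) b = coeff (coeff G a) b / g" for a b
    by (simp add: H_def divide_inverse mult.commute)
  have HR: "coeff (coeff H a) b \<in> R" for a b
    using gmax[of a b] g0 by (simp add: coeffH vle_iff)
  have Hfrob: "coeff (coeff H a) b ^ q - coeff (coeff H a) b \<in> max_ideal" for a b
  proof (rule fixed_frob[OF HR])
    fix \<sigma> assume \<sigma>: "\<sigma> \<in> embeddings K"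
    show "\<sigma> (coeff (coeff H a) b) = coeff (coeff H a) b"
      unfolding coeffH by (simp add: embeddings_divide[OF \<sigma>] fixG[OF \<sigma>] g_def)
  qed

  let ?F = "map_poly (\<lambda>x. x ^ q) :: 'c poly \<Rightarrow> 'c poly"
  have q0: "(0::'c) ^ q = 0" using q_gt_1 by simp
  have F: "?F 0 = 0" "?F (x + y) = ?F x + ?F y" "?F (x * y) = ?F x * ?F y" for x y
    using q0 by (auto intro!: map_poly_add_hom map_poly_mult_hom simp: power_q_add power_mult_distrib)
  define w where "w = ?F u"
  have wR: "coeff w i \<in> R" for i
    using uc q0 by (simp add: w_def coeff_map_poly power_mem)
  have "u \<in> conj" unfolding conj_def
    by (rule image_eqI[of _ _ id]) (simp_all add: embeddings_id)
  hence "poly H u = 0"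
    unfolding H_def G_def using fin by (auto simp: poly_prod)
  hence tw0: "poly (map_poly ?F H) w = 0"
    unfolding w_def poly_map_poly_hom[of ?F, OF F] by simp
  have small: "coeff (poly H w) i \<in> max_ideal" for i
  proof -
    \<comment> \<open>The coefficients of \<open>H\<close> agree with their \<open>q\<close>-th
      powers modulo the maximal ideal. As the twist of \<open>H\<close> vanishes at
      \<open>w\<close>, the value \<open>H(w)\<close> reduces to 0.\<close>
    define D where "D = H - map_poly ?F H"
    have D: "coeff (coeff D a) b \<in> max_ideal" for a b
      using Hfrob[of a b] q0 max_ideal_uminus[OF Hfrob[of a b]] by (simp add: D_def coeff_map_poly)
    have "poly H w = poly D w" by (simp add: D_def tw0)
    also have "\<dots> = (\<Sum>a\<le>degree D. coeff D a * w ^ a)" by (simp add: poly_altdef)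
    also have "coeff \<dots> i \<in> max_ideal"
      unfolding coeff_sum coeff_mult
      by (intro max_ideal_sum max_ideal_mult D coeff_power_mem wR)
    finally show ?thesis .
  qed

  have "\<exists>v\<in>conj. \<forall>i. coeff (w - v) i \<in> max_ideal"
  proof (rule ccontr)
    assume "\<not> ?thesis"
    hence "\<forall>v\<in>conj. \<exists>e. e \<noteq> 0 \<and> inverse e \<in> R \<and> (\<forall>i. inverse e * coeff v i \<in> R) \<and>
      primitive (Polynomial.smult (inverse e) (w - v))"
      using primitive_diff_scaled[OF wR] by metis
    then obtain e where e: "\<And>v. v \<in> conj \<Longrightarrow> e v \<noteq> 0" "\<And>v. v \<in> conj \<Longrightarrow> inverse (e v) \<in> R"
      "\<And>v i. v \<in> conj \<Longrightarrow> inverse (e v) * coeff v i \<in> R"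
      "\<And>v. v \<in> conj \<Longrightarrow> primitive (Polynomial.smult (inverse (e v)) (w - v))"
      by metis
    define E where "E = (\<Prod>v\<in>conj. e v)"
    have E0: "E \<noteq> 0" using e(1) fin by (simp add: E_def)
    define G' where "G' = (\<Prod>v\<in>conj. [:- Polynomial.smult (inverse (e v)) v, [:inverse (e v):]:])"
    have constprod: "(\<Prod>v\<in>I. [:c v:]) = [:\<Prod>v\<in>I. c v:]" for c :: "'c poly \<Rightarrow> 'b::comm_ring_1" and I
      by (induction I rule: infinite_finite_induct) (auto simp: one_pCons)
    have "G = (\<Prod>v\<in>conj. [:[:e v:]:] * [:- Polynomial.smult (inverse (e v)) v, [:inverse (e v):]:])"
      unfolding G_def using e(1) by (intro prod.cong) (auto simp: one_pCons)
    hence GG': "G = [:[:E:]:] * G'"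
      by (simp only: prod.distrib constprod E_def G'_def)
    have "coeff (coeff G' a) b \<in> R" for a b
    proof -
      define RR where "RR = {P. \<forall>a b. coeff (coeff P a) b \<in> R}"
      have "P * Q \<in> RR" if "P \<in> RR" "Q \<in> RR" for P Q
        using that unfolding RR_def by (auto simp: coeff_mult[where 'a = "'c poly"] coeff_sum intro!: sum_mem coeff_mult_mem)
      moreover have "1 \<in> RR" by (auto simp: RR_def coeff_1)
      moreover have "[:- Polynomial.smult (inverse (e v)) v, [:inverse (e v):]:] \<in> RR" if "v \<in> conj" for v
        using e(2,3)[OF that] by (auto simp: RR_def coeff_pCons intro!: uminus_mem split: nat.splits)
      ultimately have "prod (\<lambda>v. [:- Polynomial.smult (inverse (e v)) v, [:inverse (e v):]:]) I \<in> RR" if "I \<subseteq> conj" for I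
        using that by (induction I rule: infinite_finite_induct) (auto simp del: mult_pCons_left)
      thus ?thesis unfolding G'_def RR_def by blast
    qed
    \<comment> \<open>\<open>G = E * G'\<close> with \<open>G'\<close> integral, so the coefficient
      \<open>g\<close> of \<open>G\<close> is divisible by \<open>E\<close>. The primitive
      polynomial \<open>Pm\<close> is \<open>g / E\<close> times \<open>H(w)\<close> and would
      reduce to 0.\<close>
    hence "g / E \<in> R" unfolding g_def GG' using E0 by simp
    define Pm where "Pm = (\<Prod>v\<in>conj. Polynomial.smult (inverse (e v)) (w - v))"
    have "primitive Pm" unfolding Pm_def using fin e(4) by (intro primitive_prod)
    then obtain i where i: "coeff Pm i \<notin> max_ideal" by (auto simp: primitive_def)
    have "poly H w = Polynomial.smult (inverse g) (\<Prod>v\<in>conj. w - v)"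
      unfolding H_def G_def by (simp add: poly_prod)
    also have "(\<Prod>v\<in>conj. w - v) = (\<Prod>v\<in>conj. [:e v:] * Polynomial.smult (inverse (e v)) (w - v))"
      using e(1) by (intro prod.cong) auto
    also have "\<dots> = Polynomial.smult E Pm"
      unfolding prod.distrib constprod E_def[symmetric] Pm_def[symmetric] by simp
    finally have "coeff Pm i = g / E * coeff (poly H w) i"
      using g0 E0 by simp
    thus False using max_ideal_mult'[OF \<open>g / E \<in> R\<close> small[of i]] i by simp
  qed
  then obtain \<sigma> where \<sigma>: "\<sigma> \<in> embeddings K" "\<And>i. coeff (w - map_poly \<sigma> u) i \<in> max_ideal"
    unfolding conj_def by blast
  have "\<sigma> x - x ^ q \<in> max_ideal" if xA: "x \<in> A" for x
  proof -
    obtain i where i: "i < length xs" "xs ! i = x"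
      using xA unfolding xs[symmetric] in_set_conv_nth by blast
    hence "coeff u i = x" by (simp add: u_def nth_default_def)
    hence "coeff (w - map_poly \<sigma> u) i = x ^ q - \<sigma> x"
      using \<sigma>(1) q0 by (simp add: w_def coeff_map_poly embeddings_zero)
    thus ?thesis using max_ideal_uminus[OF \<sigma>(2)[of i]] by simp
  qed
  thus ?thesis using \<sigma>(1) that by blast
qed

end

section \<open>Digit expansions\<close>

lemma separable_poly_factorization:
  fixes P :: "'c::alg_closed_field poly"
  assumes P: "P \<noteq> 0" and sep: "\<And>x. poly P x = 0 \<Longrightarrow> poly (pderiv P) x \<noteq> 0"
  shows "P = Polynomial.smult (lead_coeff P) (\<Prod>x | poly P x = 0. [:-x, 1:])"
    and "card {x. poly P x = 0} = degree P"
proof -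
  obtain A where A: "size A = degree P" "P = Polynomial.smult (lead_coeff P) (\<Prod>x\<in>#A. [:-x, 1:])"
    using alg_closed_imp_factorization[OF P] by auto
  define Q where "Q = (\<Prod>x\<in>#A. [:-x, 1:])"
  have PQ: "P = Polynomial.smult (lead_coeff P) Q" using A by (simp add: Q_def)
  have root: "poly P x = 0 \<longleftrightarrow> x \<in># A" for x
    using P by (subst PQ) (auto simp: Q_def poly_prod_mset)
  have count: "count A x = 1" if "x \<in># A" for x
  proof (rule ccontr)
    assume "count A x \<noteq> 1"
    with that obtain B where "A = add_mset x (add_mset x B)"
      by (metis count_add_mset count_eq_zero_iff insert_DiffM One_nat_def)
    hence T: "P = [:-x, 1:] * T" if "T = Polynomial.smult (lead_coeff P) ([:-x, 1:] * (\<Prod>x\<in>#B. [:-x, 1:]))" for T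
      using that by (subst PQ) (simp add: Q_def)
    define T where "T = Polynomial.smult (lead_coeff P) ([:-x, 1:] * (\<Prod>x\<in>#B. [:-x, 1:]))"
    have T: "P = [:-x, 1:] * T" "poly T x = 0" by (rule T[OF T_def]) (simp add: T_def)
    have "pderiv P = [:-x, 1:] * pderiv T + T * pderiv [:-x, 1:]" unfolding T(1) by (rule pderiv_mult)
    hence "poly (pderiv P) x = 0" using T(2) by simp
    moreover have "poly P x = 0" unfolding T(1) by simp
    ultimately show False using sep by blast
  qed
  have "Q = (\<Prod>x\<in>set_mset A. [:-x, 1:] ^ count A x)"
    unfolding Q_def by (rule image_prod_mset_multiplicity)
  also have "\<dots> = (\<Prod>x\<in>set_mset A. [:-x, 1:])"
    using count by (intro prod.cong) auto
  finally show "P = Polynomial.smult (lead_coeff P) (\<Prod>x | poly P x = 0. [:-x, 1:])"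
    using PQ root by simp
  have "size A = (\<Sum>x\<in>set_mset A. count A x)" by (rule size_multiset_overloaded_eq)
  also have "\<dots> = card (set_mset A)" using count by simp
  finally show "card {x. poly P x = 0} = degree P" using A root by simp
qed

text \<open>Pigeonhole among the first \<open>card S + 1\<close> iterates gives a repetition, and
  injectivity cancels the part before it, so that \<open>z\<close> itself recurs.\<close>

lemma funpow_return:
  assumes inj: "inj f" and S: "finite S" "z \<in> S" "\<And>x. x \<in> S \<Longrightarrow> f x \<in> S"
  obtains j where "1 \<le> j" "j \<le> card S" "(f ^^ j) z = z"
proof -
  have mem: "(f ^^ i) z \<in> S" for i by (induction i) (use S in auto)
  have "\<not> inj_on (\<lambda>i. (f ^^ i) z) {..card S}"
  proof
    assume "inj_on (\<lambda>i. (f ^^ i) z) {..card S}"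
    hence "card {..card S} \<le> card S" by (rule card_inj_on_le) (use mem S in auto)
    thus False by simp
  qed
  then obtain a b where ab: "a < b" "b \<le> card S" "(f ^^ a) z = (f ^^ b) z"
    unfolding inj_on_def by (metis atMost_iff nat_neq_iff)
  have "(f ^^ a) ((f ^^ (b - a)) z) = (f ^^ a) z"
    using ab by (simp flip: funpow_add comp_apply[of "f ^^ a"])
  moreover have "inj (f ^^ a)" using inj by (rule inj_fn)
  ultimately have "(f ^^ (b - a)) z = z" by (simp add: inj_eq)
  thus ?thesis using ab by (intro that[of "b - a"]) auto
qed

section \<open>Finite subfields of the closure\<close>

context residually_finite
begin

text \<open>For \<open>m > 0\<close> this is the subfield with \<open>q ^ m\<close> elements. It
  meets the maximal ideal only in 0, so its elements are exact representatives of residues. For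
  \<open>m = 0\<close> the condition is void and gives the whole field.\<close>

definition frob_fixed :: "nat \<Rightarrow> 'c set" where
  "frob_fixed m = {x. x ^ (q ^ m) = x}"

lemma q_power: "q ^ m = p ^ (s * m)"
  by (simp add: q power_mult)

lemma
  assumes "m > 0"
  shows frob_fixed_prod: "x ^ (q ^ m) - x = (\<Prod>c\<in>frob_fixed m. x - c)"
    and card_frob_fixed: "card (frob_fixed m) = q ^ m"
    and finite_frob_fixed: "finite (frob_fixed m)"
proof -
  define Q where "Q = q ^ m"
  have Q1: "Q > 1" unfolding Q_def using q_gt_1 assms by (rule one_less_power)
  define P :: "'c poly" where "P = monom 1 Q - monom 1 1"
  have deg: "degree P = Q"
    using degree_add_eq_left[of "- monom 1 1" "monom (1::'c) Q"] Q1 by (simp add: P_def degree_monom_eq)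
  have P0: "P \<noteq> 0" using deg Q1 by auto
  have lc: "lead_coeff P = 1" using deg Q1 by (simp add: P_def)
  have poly: "poly P x = x ^ Q - x" for x by (simp add: P_def poly_monom)
  have roots: "{x. poly P x = 0} = frob_fixed m" by (auto simp: poly frob_fixed_def Q_def)
  have "p dvd Q" using s assms by (simp add: Q_def q_power)
  hence "(of_nat Q :: 'c) = 0" using p by (simp add: of_nat_eq_0_iff_char_dvd)
  hence "pderiv P = - 1" using Q1 by (simp add: P_def pderiv_diff pderiv_monom monom_0 one_pCons)
  hence sep: "poly (pderiv P) x \<noteq> 0" for x by simp
  show "card (frob_fixed m) = q ^ m"
    using separable_poly_factorization(2)[OF P0] sep deg roots by (simp add: Q_def)
  show "finite (frob_fixed m)" using poly_roots_finite[OF P0] roots by simp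
  have "P = (\<Prod>c\<in>frob_fixed m. [:-c, 1:])"
    using separable_poly_factorization(1)[OF P0] sep lc roots by simp
  hence "poly P x = poly (\<Prod>c\<in>frob_fixed m. [:-c, 1:]) x" by simp
  thus "x ^ (q ^ m) - x = (\<Prod>c\<in>frob_fixed m. x - c)"
    by (simp add: poly poly_prod Q_def)
qed

lemma frob_fixed_add: "x \<in> frob_fixed m \<Longrightarrow> y \<in> frob_fixed m \<Longrightarrow> x + y \<in> frob_fixed m"
  using freshmans_dream'[of "q ^ m" "s * m" x y] p by (simp add: frob_fixed_def q_power)

lemma frob_fixed_diff: "x \<in> frob_fixed m \<Longrightarrow> y \<in> frob_fixed m \<Longrightarrow> x - y \<in> frob_fixed m"
  using freshmans_dream_diff[of "q ^ m" "s * m" x y] p by (simp add: frob_fixed_def q_power)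

lemma frob_fixed_mult: "x \<in> frob_fixed m \<Longrightarrow> y \<in> frob_fixed m \<Longrightarrow> x * y \<in> frob_fixed m"
  by (simp add: frob_fixed_def power_mult_distrib)

lemma frob_fixed_inverse: "x \<in> frob_fixed m \<Longrightarrow> inverse x \<in> frob_fixed m"
  by (simp add: frob_fixed_def power_inverse)

lemma frob_fixed_0 [simp]: "0 \<in> frob_fixed m" and frob_fixed_1 [simp]: "1 \<in> frob_fixed m"
  using q_gt_1 by (simp_all add: frob_fixed_def)

lemma frob_fixed_power: "x \<in> frob_fixed m \<Longrightarrow> x ^ n \<in> frob_fixed m"
  by (induction n) (auto intro: frob_fixed_mult)

lemma frob_fixed_sum: "(\<And>i. i \<in> I \<Longrightarrow> g i \<in> frob_fixed m) \<Longrightarrow> sum g I \<in> frob_fixed m"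
  by (induction I rule: infinite_finite_induct) (auto intro: frob_fixed_add)

lemma frob_fixed_mono:
  assumes "x \<in> frob_fixed m" shows "x \<in> frob_fixed (m * n)"
proof (induction n)
  case 0 show ?case by (simp add: frob_fixed_def)
next
  case (Suc n)
  have "x ^ (q ^ (m * Suc n)) = (x ^ (q ^ m)) ^ (q ^ (m * n))" by (simp add: power_add flip: power_mult)
  thus ?case using Suc assms by (simp add: frob_fixed_def)
qed

lemma frob_fixed_mem:
  assumes "x \<in> frob_fixed m" "m > 0" shows "x \<in> R"
proof (cases "x = 0")
  case False
  have Q: "q ^ m > 1" using q_gt_1 assms(2) by (rule one_less_power)
  have "x ^ (q ^ m) = x * x ^ (q ^ m - 1)" using Q
    by (metis One_nat_def Suc_pred less_trans power_Suc zero_less_one)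
  hence "x ^ (q ^ m - 1) = 1" using assms(1) False by (simp add: frob_fixed_def)
  thus ?thesis using mem_root[of x "q ^ m - 1"] Q by simp
qed simp

lemma frob_fixed_max_ideal:
  assumes "x \<in> frob_fixed m" "m > 0" "x \<in> max_ideal" shows "x = 0"
  using frob_fixed_mem[OF frob_fixed_inverse[OF assms(1)] assms(2)] assms(3) by (auto simp: max_ideal_def)

lemma frob_fixed_approx:
  assumes x: "x \<in> R" "x ^ q - x \<in> max_ideal"
  obtains c where "c \<in> frob_fixed 1" "x - c \<in> max_ideal"
proof -
  have "(\<Prod>c\<in>frob_fixed 1. x - c) \<in> max_ideal"
    using x frob_fixed_prod[of 1 x] by simp
  moreover have "x - c \<in> R" if "c \<in> frob_fixed 1" for c
    using diff_mem[OF x(1) frob_fixed_mem[OF that]] by simp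
  ultimately have "\<exists>c\<in>frob_fixed 1. x - c \<in> max_ideal"
    using max_ideal_prod[OF finite_frob_fixed[of 1]] by simp
  thus ?thesis using that by blast
qed

text \<open>The smaller fields together have fewer than \<open>q ^ n\<close> elements. The
  conjugates \<open>\<zeta> ^ (q ^ j)\<close> with \<open>0 < j < n\<close> then differ from
  \<zeta>, as the interpolation in \<open>digit_expansion\<close> requires.\<close>

lemma frob_primitive_element:
  assumes "n > 0"
  obtains \<zeta> where "\<zeta> \<in> frob_fixed n" "\<And>j. 0 < j \<Longrightarrow> j < n \<Longrightarrow> \<zeta> \<notin> frob_fixed j"
proof -
  have geo: "(\<Sum>j<n. q ^ j) < q ^ n" for n
  proof (induction n)
    case (Suc n)
    have "(\<Sum>j<Suc n. q ^ j) < q ^ n + q ^ n" using Suc by simp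
    also have "\<dots> \<le> q ^ Suc n" using q_gt_1 by (simp flip: mult_2)
    finally show ?case .
  qed simp
  have "card (\<Union>j\<in>{1..<n}. frob_fixed j) \<le> (\<Sum>j\<in>{1..<n}. card (frob_fixed j))"
    by (rule card_UN_le) simp
  also have "\<dots> = (\<Sum>j\<in>{1..<n}. q ^ j)" by (intro sum.cong) (auto simp: card_frob_fixed)
  also have "\<dots> \<le> (\<Sum>j<n. q ^ j)" by (intro sum_mono2) auto
  also have "\<dots> < card (frob_fixed n)" using geo assms by (simp add: card_frob_fixed)
  finally have "\<not> frob_fixed n \<subseteq> (\<Union>j\<in>{1..<n}. frob_fixed j)"
    by (metis (no_types, lifting) assms card_mono finite_UN finite_atLeastLessThan finite_frob_fixed
        atLeastLessThan_iff less_le_trans not_less zero_less_one)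
  thus ?thesis using that by force
qed

text \<open>By \<open>approx\<close> each size contributes at most one dimension over the field with
  \<open>q\<close> elements, so one element of every size occurring in \<open>W\<close> suffices:
  subtracting a multiple of it makes \<open>x\<close> smaller, and fewer sizes remain below.\<close>

lemma graded_basis:
  assumes W: "finite W" "0 \<in> W" "\<And>x y c. x \<in> W \<Longrightarrow> y \<in> W \<Longrightarrow> c \<in> frob_fixed 1 \<Longrightarrow> x - c * y \<in> W"
    and approx: "\<And>x y. x \<in> W \<Longrightarrow> y \<in> W \<Longrightarrow> y \<noteq> 0 \<Longrightarrow> x \<preceq> y \<Longrightarrow> \<exists>c\<in>frob_fixed 1. x - c * y \<prec> y"
  obtains I where "I \<subseteq> W - {0}" "\<And>v w. v \<in> I \<Longrightarrow> w \<in> I \<Longrightarrow> v \<noteq> w \<Longrightarrow> v \<prec> w \<or> w \<prec> v"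
    "\<And>x. x \<in> W \<Longrightarrow> \<exists>c. (\<forall>w. c w \<in> frob_fixed 1) \<and> x = (\<Sum>w\<in>I. c w * w)"
proof -
  define r where "r = (\<lambda>x. SOME y. y \<in> W - {0} \<and> y \<preceq> x \<and> x \<preceq> y)"
  have r: "r x \<in> W - {0} \<and> r x \<preceq> x \<and> x \<preceq> r x" if "x \<in> W - {0}" for x
    unfolding r_def by (rule someI[of _ x]) (use that in auto)
  have r_cong: "r x = r y" if "x \<preceq> y" "y \<preceq> x" for x y
    unfolding r_def using that by (intro arg_cong[of _ _ Eps] ext) (blast intro: vle_trans)
  define I where "I = r ` (W - {0})"
  have IW: "I \<subseteq> W - {0}" using r by (auto simp: I_def)
  have finI: "finite I" using W by (simp add: I_def)
  have dist: "v \<prec> w \<or> w \<prec> v" if vw: "v \<in> I" "w \<in> I" "v \<noteq> w" for v w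
  proof (rule ccontr)
    assume "\<not> (v \<prec> w \<or> w \<prec> v)"
    hence eq: "v \<preceq> w" "w \<preceq> v" by (auto simp: vlt_def)
    obtain x y where "v = r x" "w = r y" "x \<in> W - {0}" "y \<in> W - {0}" using vw by (auto simp: I_def)
    moreover from this have "x \<preceq> y" "y \<preceq> x" using r eq by (metis vle_trans)+
    ultimately show False using r_cong vw by blast
  qed
  have "\<exists>c. (\<forall>w. c w \<in> frob_fixed 1) \<and> x = (\<Sum>w\<in>I. c w * w)" if "x \<in> W" for x
    using that
  proof (induction "card {w\<in>I. w \<preceq> x}" arbitrary: x rule: less_induct)
    case less
    show ?case
    proof (cases "x = 0")
      case True
      thus ?thesis by (intro exI[of _ "\<lambda>_. 0"]) auto
    next
      case False
      define y where "y = r x"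
      have y: "y \<in> I" "y \<in> W" "y \<noteq> 0" "y \<preceq> x" "x \<preceq> y"
        using r[of x] False less.prems by (auto simp: y_def I_def)
      obtain c where c: "c \<in> frob_fixed 1" "x - c * y \<prec> y"
        using approx[OF less.prems y(2,3,5)] by auto
      have "{w\<in>I. w \<preceq> x - c * y} \<subset> {w\<in>I. w \<preceq> x}"
        using y c(2) by (auto simp: vlt_def intro: vle_trans dest: vle_trans vlt_imp_vle[unfolded vlt_def])
      hence "card {w\<in>I. w \<preceq> x - c * y} < card {w\<in>I. w \<preceq> x}"
        using finI by (intro psubset_card_mono) auto
      from less.hyps[OF this W(3)[OF less.prems y(2) c(1)]] obtain d
        where d: "\<And>w. d w \<in> frob_fixed 1" "x - c * y = (\<Sum>w\<in>I. d w * w)" by blast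
      have "x = (\<Sum>w\<in>I. d w * w) + c * y" by (simp add: d(2)[symmetric])
      also have "c * y = (\<Sum>w\<in>I. (if w = y then c else 0) * w)"
        using y(1) finI by (simp add: if_distrib[of "\<lambda>x. x * _"] cong: if_cong)
      also have "(\<Sum>w\<in>I. d w * w) + \<dots> = (\<Sum>w\<in>I. (d w + (if w = y then c else 0)) * w)"
        by (simp add: sum.distrib distrib_right)
      finally show ?thesis using d(1) c(1)
        by (intro exI[of _ "\<lambda>w. d w + (if w = y then c else 0)"]) (auto intro!: frob_fixed_add)
    qed
  qed
  thus ?thesis using that[of I] IW dist by blast
qed

lemma frob_fixed_scale:
  assumes "c \<in> frob_fixed m" "m > 0"
  shows "c * v \<preceq> v" "c \<noteq> 0 \<Longrightarrow> v \<preceq> c * v"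
proof -
  show "c * v \<preceq> v"
    using vle_mult[of c 1 v v] frob_fixed_mem[OF assms] by simp
  assume "c \<noteq> 0"
  thus "v \<preceq> c * v"
    using vle_mult[of "inverse c" 1 "c * v" "c * v"]
      frob_fixed_mem[OF frob_fixed_inverse[OF assms(1)] assms(2)] by (simp add: mult.assoc[symmetric])
qed

text \<open>Nonzero digits are units and the places in \<open>I\<close> have different sizes, so the
  largest place with a nonzero digit outweighs the rest. Hence digits are unique, and a difference
  has the size of the first place where the digits differ.\<close>

lemma dominant_digit:
  assumes I: "finite I" "0 \<notin> I" "\<And>v w. v \<in> I \<Longrightarrow> w \<in> I \<Longrightarrow> v \<noteq> w \<Longrightarrow> v \<prec> w \<or> w \<prec> v"
    and c: "\<And>w. w \<in> I \<Longrightarrow> c w \<in> frob_fixed m" "m > 0" and nz: "\<exists>w\<in>I. c w \<noteq> 0"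
  obtains w where "w \<in> I" "c w \<noteq> 0" "\<And>v. v \<in> I \<Longrightarrow> w \<prec> v \<Longrightarrow> c v = 0"
    "w \<preceq> (\<Sum>w\<in>I. c w * w)" "(\<Sum>w\<in>I. c w * w) \<preceq> w"
proof -
  obtain w where w: "w \<in> I" "c w \<noteq> 0" "\<And>v. v \<in> I \<Longrightarrow> c v \<noteq> 0 \<Longrightarrow> v \<preceq> w"
  proof -
    have "\<exists>i\<in>{w\<in>I. c w \<noteq> 0}. \<forall>j\<in>{w\<in>I. c w \<noteq> 0}. id j \<preceq> id i"
      by (intro vle_max_exists) (use I(1) nz in auto)
    thus ?thesis using that by auto
  qed
  note unit = frob_fixed_scale[OF c(1) c(2)]
  have dom: "c v * v \<prec> c w * w" if "v \<in> I" "v \<noteq> w" for v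
  proof (cases "c v = 0")
    case True
    thus ?thesis using w I(2) by auto
  next
    case False
    hence "v \<prec> w" using w(3)[OF that(1)] I(3)[OF that(1) w(1) that(2)] by (auto simp: vlt_def)
    thus ?thesis using unit(1)[OF that(1)] unit(2)[OF w(1,2)] by (blast intro: vle_vlt_trans vlt_vle_trans)
  qed
  note D = vle_sum_dominant[of I w "\<lambda>w. c w * w", OF I(1) w(1) dom]
  show ?thesis
  proof (rule that[OF w(1,2)])
    show "c v = 0" if "v \<in> I" "w \<prec> v" for v using w(3)[of v] that by (auto simp: vlt_def)
    show "w \<preceq> (\<Sum>w\<in>I. c w * w)" using unit(2)[OF w(1,2)] D(1) by (rule vle_trans)
    show "(\<Sum>w\<in>I. c w * w) \<preceq> w" using D(2) unit(1)[OF w(1)] by (rule vle_trans)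
  qed
qed

text \<open>
  Galois descent: the order \<open>n\<close> of \<open>\<sigma>\<close> on \<open>Z\<close> is controlled before \<open>\<sigma>\<close> is known, so that the space \<open>V\<close> spanned by \<open>Z\<close>
  over the field with \<open>q\<^sup>n\<close> elements is finite and a Frobenius lift \<open>\<sigma>\<close> can be chosen for all integral
  quotients of elements of \<open>V\<close> at once. Then \<open>Z\<close> lies in the span of the \<open>\<sigma>\<close>-fixed traces, on
  which quotients reduce to the field with \<open>q\<close> elements.
\<close>
lemma digit_expansion:
  assumes Z: "finite Z" "\<And>\<sigma> z. \<sigma> \<in> embeddings K \<Longrightarrow> z \<in> Z \<Longrightarrow> \<sigma> z \<in> Z"
  obtains \<sigma> I c n where "\<sigma> \<in> embeddings K" "n > 0" "finite I" "0 \<notin> I"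
    "\<And>v w. v \<in> I \<Longrightarrow> w \<in> I \<Longrightarrow> v \<noteq> w \<Longrightarrow> v \<prec> w \<or> w \<prec> v"
    "\<And>z w. z \<in> Z \<Longrightarrow> c z w \<in> frob_fixed n"
    "\<And>z. z \<in> Z \<Longrightarrow> z = (\<Sum>w\<in>I. c z w * w)"
    "\<And>z w. z \<in> Z \<Longrightarrow> w \<in> I \<Longrightarrow> c (\<sigma> z) w = c z w ^ q"
proof -
  \<comment> \<open>Every orbit has at most \<open>card Z\<close> elements, so its length divides
    this factorial, whichever \<sigma> is chosen later.\<close>
  define n :: nat where "n = fact (card Z)"
  have n0: "n > 0" by (simp add: n_def)
  let ?F = "frob_fixed n"
  have finF: "finite ?F" using finite_frob_fixed[OF n0] .
  obtain \<zeta> where \<zeta>: "\<zeta> \<in> ?F" "\<And>j. 0 < j \<Longrightarrow> j < n \<Longrightarrow> \<zeta> \<notin> frob_fixed j"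
    using frob_primitive_element[OF n0] by blast
  define V where "V = (\<lambda>g. \<Sum>z\<in>Z. g z * z) ` (Z \<rightarrow>\<^sub>E ?F)"
  have finV: "finite V" unfolding V_def using Z(1) finF by (intro finite_imageI finite_PiE) auto
  have VI: "(\<Sum>z\<in>Z. g z * z) \<in> V" if "\<And>z. z \<in> Z \<Longrightarrow> g z \<in> ?F" for g
    unfolding V_def by (rule image_eqI[of _ _ "restrict g Z"]) (use that in auto)
  have ZV: "z \<in> V" if "z \<in> Z" for z
  proof -
    have "(\<Sum>x\<in>Z. (if x = z then 1 else 0) * x) \<in> V" by (rule VI) auto
    thus ?thesis using that Z(1) by (simp add: if_distrib[of "\<lambda>x. x * _"] cong: if_cong)
  qed
  have Vcomb: "x + c * y \<in> V" if xy: "x \<in> V" "y \<in> V" "c \<in> ?F" for x y c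
  proof -
    obtain g h where g: "g \<in> Z \<rightarrow>\<^sub>E ?F" "x = (\<Sum>z\<in>Z. g z * z)" and h: "h \<in> Z \<rightarrow>\<^sub>E ?F" "y = (\<Sum>z\<in>Z. h z * z)"
      using xy by (auto simp: V_def)
    have "x + c * y = (\<Sum>z\<in>Z. (g z + c * h z) * z)"
      by (simp add: g h sum.distrib sum_distrib_left distrib_right mult.assoc)
    also have "\<dots> \<in> V" using g h xy(3) by (intro VI) (auto intro!: frob_fixed_add frob_fixed_mult)
    finally show ?thesis .
  qed
  have V0: "0 \<in> V" using VI[of "\<lambda>_. 0"] by simp
  have Vsum: "(\<Sum>i\<in>J. c i * g i) \<in> V" if "\<And>i. i \<in> J \<Longrightarrow> c i \<in> ?F" "\<And>i. i \<in> J \<Longrightarrow> g i \<in> V" for J :: "nat set" and c g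
    using that
  proof (induction J rule: infinite_finite_induct)
    case (insert i J)
    thus ?case using Vcomb[of "\<Sum>i\<in>J. c i * g i" "g i" "c i"] by (simp add: add.commute)
  qed (simp_all add: V0)

  \<comment> \<open>The constants \<open>?F\<close> are included so that \<sigma> agrees with the
    \<open>q\<close>-th power on them exactly: the difference is a constant in the maximal ideal,
    hence 0.\<close>
  define A where "A = ((\<lambda>(x, y). x / y) ` (V \<times> V) \<inter> R) \<union> ?F"
  have "finite A" using finV finF by (simp add: A_def)
  moreover have "A \<subseteq> R" using frob_fixed_mem n0 by (auto simp: A_def)
  ultimately obtain \<sigma> where \<sigma>: "\<sigma> \<in> embeddings K" "\<And>x. x \<in> A \<Longrightarrow> \<sigma> x - x ^ q \<in> max_ideal"
    using frobenius_lift by blast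
  have \<sigma>F: "\<sigma> c = c ^ q" if c: "c \<in> ?F" for c
  proof -
    have "\<sigma> c \<in> ?F" using c embeddings_power[OF \<sigma>(1), of c "q ^ n"] by (simp add: frob_fixed_def)
    hence "\<sigma> c - c ^ q \<in> ?F" using c by (intro frob_fixed_diff frob_fixed_power)
    moreover have "\<sigma> c - c ^ q \<in> max_ideal" using c by (intro \<sigma>(2)) (simp add: A_def)
    ultimately show ?thesis using frob_fixed_max_ideal n0 by (metis eq_iff_diff_eq_0)
  qed
  have \<sigma>Z: "(\<sigma> ^^ j) z \<in> Z" if "z \<in> Z" for j z
    using that Z(2)[OF embeddings_funpow[OF \<sigma>(1)]] by blast
  have \<sigma>n: "(\<sigma> ^^ n) z = z" if zZ: "z \<in> Z" for z
  proof -
    obtain j where j: "1 \<le> j" "j \<le> card Z" "(\<sigma> ^^ j) z = z"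
      using funpow_return[OF embeddings_inj[OF \<sigma>(1)] Z(1) zZ Z(2)[OF \<sigma>(1)]] by blast
    then obtain k where "n = j * k" using dvd_fact[of j "card Z"] by (auto simp: n_def)
    moreover have "((\<sigma> ^^ j) ^^ k) z = z" by (induction k) (auto simp: j)
    ultimately show ?thesis by (simp add: funpow_mult mult.commute)
  qed

  define W where "W = {x \<in> V. \<sigma> x = x}"
  have "finite W" "0 \<in> W" using finV V0 by (auto simp: W_def embeddings_zero[OF \<sigma>(1)])
  have F1: "c \<in> ?F" if "c \<in> frob_fixed 1" for c using frob_fixed_mono[OF that, of n] by simp
  have Wcomb: "x - c * y \<in> W" if "x \<in> W" "y \<in> W" "c \<in> frob_fixed 1" for x y c
  proof -
    have "x + (0 - c) * y \<in> V" using that by (intro Vcomb frob_fixed_diff F1) (auto simp: W_def)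
    moreover have "\<sigma> c = c" using \<sigma>F[OF F1[OF that(3)]] that(3) by (simp add: frob_fixed_def)
    ultimately show ?thesis
      using that by (simp add: W_def embeddings_diff[OF \<sigma>(1)] embeddings_mult[OF \<sigma>(1)])
  qed
  have approx: "\<exists>c\<in>frob_fixed 1. x - c * y \<prec> y" if xy: "x \<in> W" "y \<in> W" "y \<noteq> 0" "x \<preceq> y" for x y
  proof -
    have "x / y \<in> A" using xy by (auto simp: A_def W_def vle_iff)
    hence "x / y - (x / y) ^ q \<in> max_ideal"
      using \<sigma>(2)[of "x / y"] xy by (simp add: W_def embeddings_divide[OF \<sigma>(1)])
    hence "(x / y) ^ q - x / y \<in> max_ideal" using max_ideal_uminus by fastforce
    moreover have "x / y \<in> R" using xy by (simp add: vle_iff)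
    ultimately obtain c where c: "c \<in> frob_fixed 1" "x / y - c \<in> max_ideal"
      using frob_fixed_approx by blast
    have "(x - c * y) / y = x / y - c" using xy by (simp add: field_simps)
    hence "x - c * y \<prec> y" using c(2) xy(3) by (simp add: vlt_iff)
    thus ?thesis using c(1) by blast
  qed
  obtain I where I: "I \<subseteq> W - {0}" "\<And>v w. v \<in> I \<Longrightarrow> w \<in> I \<Longrightarrow> v \<noteq> w \<Longrightarrow> v \<prec> w \<or> w \<prec> v"
    "\<And>x. x \<in> W \<Longrightarrow> \<exists>c. (\<forall>w. c w \<in> frob_fixed 1) \<and> x = (\<Sum>w\<in>I. c w * w)"
    using graded_basis[OF \<open>finite W\<close> \<open>0 \<in> W\<close> Wcomb approx] by blast
  have finI: "finite I" using I(1) \<open>finite W\<close> finite_subset by blast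
  have I0: "0 \<notin> I" using I(1) by auto
  obtain e where e: "\<And>x w. x \<in> W \<Longrightarrow> e x w \<in> frob_fixed 1" "\<And>x. x \<in> W \<Longrightarrow> x = (\<Sum>w\<in>I. e x w * w)"
    using I(3) by metis

  \<comment> \<open>The sum over \<open>j\<close> of
    \<open>(\<sigma> ^^ j) (\<zeta> ^ i * z)\<close>, a trace for the cyclic action; on \<zeta> the
    map \<sigma> is the \<open>q\<close>-th power.\<close>
  define t where "t = (\<lambda>z i. \<Sum>j<n. \<zeta> ^ (i * q ^ j) * (\<sigma> ^^ j) z)"
  have tW: "t z i \<in> W" if z: "z \<in> Z" for z i
  proof -
    have "t z i \<in> V" unfolding t_def by (intro Vsum frob_fixed_power \<zeta> ZV \<sigma>Z z)
    moreover have "\<sigma> (t z i) = t z i"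
    proof -
      define g where "g = (\<lambda>j. \<zeta> ^ (i * q ^ j) * (\<sigma> ^^ j) z)"
      have "\<zeta> ^ (i * q ^ n) = \<zeta> ^ i"
        using \<zeta>(1) by (simp add: frob_fixed_def mult.commute[of i] power_mult)
      hence gn: "g n = g 0" using \<sigma>n[OF z] by (simp add: g_def)
      have "\<sigma> (t z i) = (\<Sum>j<n. g (Suc j))"
        unfolding t_def embeddings_sum[OF \<sigma>(1)] g_def
        by (intro sum.cong) (simp_all add: embeddings_mult[OF \<sigma>(1)] \<sigma>F frob_fixed_power \<zeta>(1) mult.assoc mult.commute[of q] flip: power_mult)
      also have "\<dots> = (\<Sum>j<n. g j)"
        using sum.lessThan_Suc_shift[of g n] sum.lessThan_Suc[of g n] gn by simp
      finally show ?thesis by (simp add: t_def g_def)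
    qed
    ultimately show ?thesis by (simp add: W_def)
  qed

  \<comment> \<open>Normalised, this is the Lagrange polynomial that is 1 at \<zeta> and 0 at its
    other conjugates; its coefficients recover \<open>z\<close> from the traces
    \<open>t z i\<close>.\<close>
  define P0 where "P0 = (\<Prod>j\<in>{1..<n}. [:- (\<zeta> ^ (q ^ j)), 1:])"
  define P where "P = Polynomial.smult (inverse (poly P0 \<zeta>)) P0"
  have \<zeta>j: "\<zeta> ^ (q ^ j) \<noteq> \<zeta>" if "j \<in> {1..<n}" for j
    using \<zeta>(2)[of j] that by (auto simp: frob_fixed_def)
  have P0nz: "poly P0 \<zeta> \<noteq> 0"
  proof
    assume "poly P0 \<zeta> = 0"
    then obtain j where "j \<in> {1..<n}" "\<zeta> - \<zeta> ^ (q ^ j) = 0" by (auto simp: P0_def poly_prod)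
    thus False using \<zeta>j[of j] by simp
  qed
  have P1: "poly P \<zeta> = 1" using P0nz by (simp add: P_def)
  have Pj: "poly P (\<zeta> ^ (q ^ j)) = 0" if "j \<in> {1..<n}" for j
    using that by (auto simp: P_def P0_def poly_prod)
  have P0F: "coeff (\<Prod>j\<in>J. [:- (\<zeta> ^ (q ^ j)), 1:]) i \<in> ?F" for J i
  proof (induction J arbitrary: i rule: infinite_finite_induct)
    case (insert j J)
    have "coeff [:- (\<zeta> ^ (q ^ j)), 1:] i \<in> ?F" for i
      using frob_fixed_diff[OF frob_fixed_0 frob_fixed_power[OF \<zeta>(1), of "q ^ j"]]
      by (auto simp: coeff_pCons split: nat.splits)
    thus ?case unfolding prod.insert[OF insert.hyps(1,2)] coeff_mult
      by (intro frob_fixed_sum frob_fixed_mult insert.IH)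
  qed (auto simp: coeff_1)
  have PF: "coeff P i \<in> ?F" for i
    unfolding P_def using P0F
    by (auto intro!: frob_fixed_mult frob_fixed_inverse frob_fixed_sum frob_fixed_power \<zeta>(1) simp: P0_def poly_altdef)
  have expand: "z = (\<Sum>i\<le>degree P. coeff P i * t z i)" if z: "z \<in> Z" for z
  proof -
    have "(\<Sum>i\<le>degree P. coeff P i * t z i) = (\<Sum>i\<le>degree P. \<Sum>j<n. coeff P i * (\<zeta> ^ (q ^ j)) ^ i * (\<sigma> ^^ j) z)"
      by (simp add: t_def sum_distrib_left mult.assoc mult.commute[of _ "q ^ _"] power_mult)
    also have "\<dots> = (\<Sum>j<n. poly P (\<zeta> ^ (q ^ j)) * (\<sigma> ^^ j) z)"
      by (subst sum.swap) (simp add: poly_altdef sum_distrib_right)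
    also have "\<dots> = (\<Sum>j\<in>{0}. poly P (\<zeta> ^ (q ^ j)) * (\<sigma> ^^ j) z)"
      using n0 Pj by (intro sum.mono_neutral_right) auto
    also have "\<dots> = z" using P1 by simp
    finally show ?thesis by simp
  qed

  define c where "c = (\<lambda>z w. \<Sum>i\<le>degree P. coeff P i * e (t z i) w)"
  have cF: "c z w \<in> ?F" if "z \<in> Z" for z w
    unfolding c_def using that by (intro frob_fixed_sum frob_fixed_mult PF F1 e tW)
  have cz: "z = (\<Sum>w\<in>I. c z w * w)" if z: "z \<in> Z" for z
  proof -
    have "(\<Sum>w\<in>I. c z w * w) = (\<Sum>i\<le>degree P. coeff P i * (\<Sum>w\<in>I. e (t z i) w * w))"
      unfolding c_def sum_distrib_left sum_distrib_right by (subst sum.swap) (simp add: mult.assoc)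
    also have "\<dots> = (\<Sum>i\<le>degree P. coeff P i * t z i)"
      using e(2)[OF tW[OF z], symmetric] by simp
    finally show ?thesis using expand[OF z] by simp
  qed
  \<comment> \<open>Applying \<sigma> to the expansion of \<open>z\<close> fixes the places and
    raises the digits to the \<open>q\<close>-th power. The result is the expansion of
    \<open>\<sigma> z\<close>, since a nontrivial combination of places of different sizes is not
    0.\<close>
  have c\<sigma>: "c (\<sigma> z) w = c z w ^ q" if z: "z \<in> Z" and w: "w \<in> I" for z w
  proof (rule ccontr)
    assume neq: "c (\<sigma> z) w \<noteq> c z w ^ q"
    define d where "d = (\<lambda>w. c (\<sigma> z) w - c z w ^ q)"
    have dF: "d w \<in> ?F" for w unfolding d_def
      using cF[OF z] cF[OF Z(2)[OF \<sigma>(1) z]] by (intro frob_fixed_diff frob_fixed_power)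
    have "\<sigma> z = \<sigma> (\<Sum>w\<in>I. c z w * w)" using cz[OF z] by simp
    also have "\<dots> = (\<Sum>w\<in>I. c z w ^ q * w)"
      unfolding embeddings_sum[OF \<sigma>(1)] using I(1)
      by (intro sum.cong) (auto simp: embeddings_mult[OF \<sigma>(1)] \<sigma>F[OF cF[OF z]] W_def)
    finally have d0: "(\<Sum>w\<in>I. d w * w) = 0"
      using cz[OF Z(2)[OF \<sigma>(1) z]] by (simp add: d_def left_diff_distrib sum_subtractf)
    have "\<exists>w\<in>I. d w \<noteq> 0" using neq w by (auto simp: d_def)
    from dominant_digit[OF finI I0 I(2) dF n0 this]
    obtain v where "v \<in> I" "v \<preceq> (\<Sum>w\<in>I. d w * w)" by blast
    thus False using I0 d0 by auto
  qed
  show ?thesis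
    by (rule that[OF \<sigma>(1) n0 finI I0 I(2) cF cz c\<sigma>])
qed

end

section \<open>Newton polygons of sparse polynomials\<close>

lemma smult_sum_right: "Polynomial.smult c (sum g I) = (\<Sum>i\<in>I. Polynomial.smult c (g i))"
  by (induction I rule: infinite_finite_induct) (simp_all add: smult_add_right)

context valuation_subring
begin

text \<open>Convexity of Newton polygons: the term that wins at the larger argument cannot have the
  smaller exponent. Otherwise the two comparisons combine to \<open>x' ^ r \<preceq> x ^ r\<close>
  with \<open>r > 0\<close>.\<close>

lemma exponent_le:
  assumes x: "x \<noteq> 0" "x \<prec> x'" and a: "a \<noteq> 0"
    and le: "a' * x ^ m' \<preceq> a * x ^ m" "a * x' ^ m \<preceq> a' * x' ^ m'"
  shows "m \<le> m'"
proof (rule ccontr)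
  assume "\<not> m \<le> m'"
  then obtain r where r: "m = r + m'" "r > 0" by (metis add.commute le_add_diff_inverse nat_le_linear not_le zero_less_diff)
  have x': "x' \<noteq> 0" using x(2) by auto
  have "(a * x' ^ r) * x' ^ m' \<preceq> a' * x' ^ m'" using le(2) by (simp add: r power_add mult.assoc)
  hence "a * x' ^ r \<preceq> a'" using x' by (simp add: vle_mult_cancel_right)
  also have "a' * x ^ m' \<preceq> (a * x ^ r) * x ^ m'" using le(1) by (simp add: r power_add mult.assoc)
  hence "a' \<preceq> a * x ^ r" using x by (simp add: vle_mult_cancel_right)
  finally have "x' ^ r \<preceq> x ^ r" using a by (simp add: vle_mult_cancel_left)
  thus False using vlt_power[OF x(2) r(2)] by (simp add: vlt_def)
qed

text \<open>A sum can vanish only if its largest size is attained twice. The injective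
  \<open>h\<close>, an exponent in the applications, tells the two terms apart and orders
  them.\<close>

lemma two_dominant_terms:
  fixes g :: "nat \<Rightarrow> 'c"
  assumes "finite I" "(\<Sum>j\<in>I. g j) = 0" "\<exists>j\<in>I. g j \<noteq> 0" "inj_on h I"
  obtains i j where "i \<in> I" "j \<in> I" "(h i :: nat) < h j" "g i \<noteq> 0" "\<And>l. l \<in> I \<Longrightarrow> g l \<preceq> g i" "g i \<preceq> g j"
proof -
  obtain i where i: "i \<in> I" "\<And>l. l \<in> I \<Longrightarrow> g l \<preceq> g i"
    using vle_max_exists[of I g] assms by blast
  have gi: "g i \<noteq> 0" using assms(3) i(2) by fastforce
  have "\<exists>j\<in>I. j \<noteq> i \<and> g i \<preceq> g j"
  proof (rule ccontr)
    assume "\<not> ?thesis"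
    hence "g i \<preceq> sum g I" by (intro vle_sum_dominant assms i) (auto simp: vlt_def)
    thus False using assms gi by simp
  qed
  then obtain j where j: "j \<in> I" "j \<noteq> i" "g i \<preceq> g j" by blast
  have hij: "h i \<noteq> h j" using assms(4) i j by (auto simp: inj_on_def)
  have gj: "g j \<noteq> 0" using j gi by auto
  have jmax: "g l \<preceq> g j" if "l \<in> I" for l using i(2)[OF that] j(3) by (rule vle_trans)
  show ?thesis
  proof (cases "h i < h j")
    case True thus ?thesis using that[of i j] i j gi by blast
  next
    case False thus ?thesis using that[of j i] i j gj jmax hij by auto
  qed
qed

end

section \<open>Dominant terms and Taylor coefficients of a sparse polynomial\<close>

locale sparse_polynomial = residually_finite R K p s q
  for R K :: "'c::alg_closed_field set" and p s q :: nat +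
  fixes k :: nat and a :: "nat \<Rightarrow> 'c" and n :: "nat \<Rightarrow> nat"
  assumes a_nonzero: "i \<le> k \<Longrightarrow> a i \<noteq> 0" and a_base: "i \<le> k \<Longrightarrow> a i \<in> K" and n_inj: "inj_on n {..k}"
begin

definition zeros :: "'c set" where
  "zeros = {z. (\<Sum>i\<le>k. a i * z ^ n i) = 0}"

definition f_poly :: "'c poly" where
  "f_poly = (\<Sum>i\<le>k. monom (a i) (n i))"

lemma coeff_f_poly: "i \<le> k \<Longrightarrow> coeff f_poly (n i) = a i"
proof -
  assume i: "i \<le> k"
  have "coeff f_poly (n i) = (\<Sum>j\<le>k. if j = i then a j else 0)"
    unfolding f_poly_def coeff_sum using n_inj i by (intro sum.cong) (auto simp: inj_on_def)
  thus ?thesis using i by simp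
qed

lemma f_poly_nonzero: "f_poly \<noteq> 0"
  using coeff_f_poly[of 0] a_nonzero[of 0] by auto

lemma zeros_eq: "zeros = {z. poly f_poly z = 0}"
  by (simp add: zeros_def f_poly_def poly_sum poly_monom)

lemma finite_zeros: "finite zeros"
  unfolding zeros_eq using f_poly_nonzero by (rule poly_roots_finite)

lemma embeddings_zeros:
  assumes \<sigma>: "\<sigma> \<in> embeddings K" and z: "z \<in> zeros" shows "\<sigma> z \<in> zeros"
proof -
  have "\<sigma> (\<Sum>i\<le>k. a i * z ^ n i) = (\<Sum>i\<le>k. a i * \<sigma> z ^ n i)"
    unfolding embeddings_sum[OF \<sigma>]
    by (intro sum.cong) (simp_all add: embeddings_mult[OF \<sigma>] embeddings_power[OF \<sigma>] embeddings_fix[OF \<sigma> a_base])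
  thus ?thesis using z by (simp add: zeros_def embeddings_zero[OF \<sigma>])
qed

text \<open>The indices on the side of the Newton polygon that belongs to the size of
  \<open>x\<close>, or its vertex if there is no such side.\<close>

definition dominant :: "'c \<Rightarrow> nat \<Rightarrow> bool" where
  "dominant x i \<longleftrightarrow> i \<le> k \<and> (\<forall>j\<le>k. a j * x ^ n j \<preceq> a i * x ^ n i)"

lemma dominant_exists: "\<exists>i. dominant x i"
  using vle_max_exists[of "{..k}" "\<lambda>i. a i * x ^ n i"] by (auto simp: dominant_def)

lemma dominant_mono:
  assumes "x \<noteq> 0" "x \<prec> x'" "dominant x i" "dominant x' i'" shows "n i \<le> n i'"
  using assms by (intro exponent_le[of x x' "a i" "a i'"]) (auto simp: dominant_def a_nonzero)

text \<open>The coefficient of \<open>y\<^sup>j\<close> in \<open>f(x(1+y))\<close>.\<close>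
definition taylor :: "'c \<Rightarrow> nat \<Rightarrow> 'c" where
  "taylor x j = (\<Sum>i\<le>k. a i * x ^ n i * of_nat (n i choose j))"

definition deg_bound :: nat where
  "deg_bound = (\<Sum>i\<le>k. n i)"

lemma n_le_deg_bound: "i \<le> k \<Longrightarrow> n i \<le> deg_bound"
  unfolding deg_bound_def by (intro member_le_sum) auto

lemma power_one_plus:
  fixes y :: "'d::comm_semiring_1"
  assumes "m \<le> D" shows "(y + 1) ^ m = (\<Sum>j\<le>D. of_nat (m choose j) * y ^ j)"
proof -
  have "(y + 1) ^ m = (\<Sum>j\<le>m. of_nat (m choose j) * y ^ j)" by (simp add: binomial_ring)
  also have "\<dots> = (\<Sum>j\<le>D. of_nat (m choose j) * y ^ j)"
  proof (intro sum.mono_neutral_left ballI)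
    fix i assume "i \<in> {..D} - {..m}"
    hence "m choose i = 0" by (simp add: binomial_eq_0)
    thus "of_nat (m choose i) * y ^ i = 0" by (simp add: binomial_eq_0)
  qed (use assms in auto)
  finally show ?thesis .
qed

lemma taylor_expansion:
  "(\<Sum>i\<le>k. a i * (x * (y + 1)) ^ n i) = (\<Sum>j\<le>deg_bound. taylor x j * y ^ j)"
proof -
  have "(\<Sum>i\<le>k. a i * (x * (y + 1)) ^ n i) = (\<Sum>i\<le>k. \<Sum>j\<le>deg_bound. a i * x ^ n i * of_nat (n i choose j) * y ^ j)"
    by (intro sum.cong) (simp_all add: power_mult_distrib power_one_plus[OF n_le_deg_bound] sum_distrib_left mult.assoc)
  also have "\<dots> = (\<Sum>j\<le>deg_bound. taylor x j * y ^ j)"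
    by (subst sum.swap) (simp add: taylor_def sum_distrib_right)
  finally show ?thesis .
qed

lemma of_nat_mem: "of_nat m \<in> R"
  by (induction m) (auto intro: add_mem)

lemma taylor_le: "dominant x i \<Longrightarrow> taylor x j \<preceq> a i * x ^ n i"
  unfolding taylor_def dominant_def
  by (intro vle_sum) (metis (no_types) atMost_iff mult.right_neutral of_nat_mem vle_mult vle_one_iff)

text \<open>Passing from powers of \<open>y\<close> back to powers of \<open>1 + y\<close> has
  integral coefficients. If all Taylor coefficients were smaller than the dominant term, so would be
  every coefficient of \<open>f(x(1+y))\<close> in powers of \<open>1 + y\<close>, and the dominant
  term is one of them.\<close>

lemma taylor_dominant_exists:
  assumes x: "x \<noteq> 0" and i: "dominant x i"
  shows "\<exists>j. a i * x ^ n i \<preceq> taylor x j"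
proof (rule ccontr)
  assume "\<not> ?thesis"
  hence small: "taylor x j \<prec> a i * x ^ n i" for j by (auto simp: vlt_def)
  define L where "L = [:-1, 1 :: 'c:]"
  have "monom 1 m = (L + 1) ^ m" for m by (simp add: L_def monom_altdef one_pCons)
  hence mon: "monom c m = (\<Sum>j\<le>deg_bound. Polynomial.smult (c * of_nat (m choose j)) (L ^ j))" if "m \<le> deg_bound" for c m
  proof -
    assume *: "\<And>m. monom 1 m = (L + 1) ^ m"
    have "monom c m = Polynomial.smult c (monom 1 m)" by (simp add: smult_monom)
    thus ?thesis unfolding * power_one_plus[OF that]
      by (simp add: smult_sum_right of_nat_poly)
  qed
  have "(\<Sum>l\<le>k. monom (a l * x ^ n l) (n l)) = (\<Sum>l\<le>k. \<Sum>j\<le>deg_bound. Polynomial.smult (a l * x ^ n l * of_nat (n l choose j)) (L ^ j))"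
    by (intro sum.cong) (simp_all add: mon[OF n_le_deg_bound])
  also have "\<dots> = (\<Sum>j\<le>deg_bound. Polynomial.smult (taylor x j) (L ^ j))"
    by (subst sum.swap) (simp add: taylor_def smult_sum)
  finally have eq: "(\<Sum>l\<le>k. monom (a l * x ^ n l) (n l)) = \<dots>" .
  have ik: "i \<le> k" using i by (simp add: dominant_def)
  have nz: "a i * x ^ n i \<noteq> 0" using x a_nonzero ik by simp
  have XR: "coeff (L ^ j) m \<in> R" for j m
    by (rule coeff_power_mem) (auto simp: L_def coeff_pCons uminus_mem split: nat.splits)
  have "(\<Sum>j\<le>deg_bound. taylor x j * coeff (L ^ j) (n i)) \<prec> a i * x ^ n i"
    using nz
  proof (rule vlt_sum)
    fix j
    have "taylor x j * coeff (L ^ j) (n i) \<preceq> taylor x j * 1"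
      using XR by (intro vle_mult) auto
    thus "taylor x j * coeff (L ^ j) (n i) \<prec> a i * x ^ n i" using small by (simp add: vle_vlt_trans)
  qed
  also have "(\<Sum>j\<le>deg_bound. taylor x j * coeff (L ^ j) (n i)) = coeff (\<Sum>l\<le>k. monom (a l * x ^ n l) (n l)) (n i)"
    unfolding eq by (simp add: coeff_sum)
  also have "\<dots> = (\<Sum>l\<le>k. if l = i then a l * x ^ n l else 0)"
    unfolding coeff_sum using n_inj ik by (intro sum.cong) (auto simp: inj_on_def)
  also have "\<dots> = a i * x ^ n i" using ik by simp
  finally show False by simp
qed

text \<open>
  The multiplicity of the residue class of \<open>x\<close> as a root of the reduction of \<open>f\<close>, rescaled to the
  circle through \<open>x\<close>.
\<close>
definition res_mult :: "'c \<Rightarrow> nat" where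
  "res_mult x = (LEAST j. \<exists>i. dominant x i \<and> a i * x ^ n i \<preceq> taylor x j)"

lemma res_mult_attained:
  assumes "x \<noteq> 0" "dominant x i" shows "a i * x ^ n i \<preceq> taylor x (res_mult x)"
proof -
  have "\<exists>i. dominant x i \<and> a i * x ^ n i \<preceq> taylor x (res_mult x)"
    unfolding res_mult_def by (rule LeastI_ex) (use taylor_dominant_exists assms in blast)
  thus ?thesis using assms(2) unfolding dominant_def by (blast intro: vle_trans)
qed

lemma taylor_below_res_mult:
  assumes "dominant x i" "j < res_mult x" shows "taylor x j \<prec> a i * x ^ n i"
  using not_less_Least[OF assms(2)[unfolded res_mult_def]] assms(1) by (auto simp: vlt_def)

lemma taylor_le_res_mult:
  assumes "x \<noteq> 0" shows "taylor x j \<preceq> taylor x (res_mult x)"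
  using dominant_exists[of x] taylor_le res_mult_attained[OF assms] by (blast intro: vle_trans)

lemma taylor_res_mult_nonzero:
  assumes "x \<noteq> 0" shows "taylor x (res_mult x) \<noteq> 0"
proof -
  obtain i where i: "dominant x i" using dominant_exists by blast
  hence "a i * x ^ n i \<noteq> 0" using assms a_nonzero by (simp add: dominant_def)
  thus ?thesis using res_mult_attained[OF assms i] by auto
qed

lemma res_mult_le:
  assumes "x \<noteq> 0" shows "res_mult x \<le> deg_bound"
proof (rule ccontr)
  assume "\<not> res_mult x \<le> deg_bound"
  hence "n i choose res_mult x = 0" if "i \<le> k" for i
    using n_le_deg_bound[OF that] by (simp add: binomial_eq_0)
  hence "taylor x (res_mult x) = 0" unfolding taylor_def by (intro sum.neutral) (auto simp: binomial_eq_0)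
  thus False using taylor_res_mult_nonzero[OF assms] by simp
qed

lemma taylor_zero: "z \<in> zeros \<Longrightarrow> taylor z 0 = 0"
  by (simp add: zeros_def taylor_def)

text \<open>Here \<open>i\<close> and \<open>j\<close> lie on the edge of the Newton polygon of \<open>f(z(1+y))\<close> that belongs to \<open>z'\<close>.\<close>
lemma branch_index:
  assumes z: "z \<in> zeros" "z \<noteq> 0" and z': "z' \<in> zeros" "z' \<noteq> z" "z' - z \<prec> z"
  obtains i j where "0 < i" "i < j" "i < res_mult z" "taylor z i \<noteq> 0" "taylor z i \<prec> taylor z j"
    "\<And>l. l \<le> deg_bound \<Longrightarrow> taylor z l * ((z' - z) / z) ^ l \<preceq> taylor z i * ((z' - z) / z) ^ i"
    "taylor z i * ((z' - z) / z) ^ i \<preceq> taylor z j * ((z' - z) / z) ^ j" "i \<le> deg_bound" "j \<le> deg_bound"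
proof -
  define y where "y = (z' - z) / z"
  have y: "y \<noteq> 0" "y \<in> max_ideal" "z' = z * (y + 1)"
    using z z' by (auto simp: y_def vlt_iff field_simps)
  have "(\<Sum>j\<le>deg_bound. taylor z j * y ^ j) = 0"
    using taylor_expansion[of z y] z'(1) y(3) by (simp add: zeros_def)
  moreover have "\<exists>j\<le>deg_bound. taylor z j * y ^ j \<noteq> 0"
    using res_mult_le[OF z(2)] taylor_res_mult_nonzero[OF z(2)] y by (intro exI[of _ "res_mult z"]) auto
  ultimately obtain i j where ij: "i \<le> deg_bound" "j \<le> deg_bound" "i < j" "taylor z i * y ^ i \<noteq> 0"
     "\<And>l. l \<le> deg_bound \<Longrightarrow> taylor z l * y ^ l \<preceq> taylor z i * y ^ i" "taylor z i * y ^ i \<preceq> taylor z j * y ^ j"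
    using two_dominant_terms[of "{..deg_bound}" "\<lambda>j. taylor z j * y ^ j" "\<lambda>j. j"] by auto
  \<comment> \<open>As \<open>y\<close> is in the maximal ideal, a term of higher exponent keeps up
    only with a larger coefficient. No coefficient is larger than the one at
    \<open>res_mult z\<close>, which yields \<open>i < res_mult z\<close> below.\<close>
  have step: "taylor z l \<prec> taylor z j" if l: "l < j" "taylor z l * y ^ l \<preceq> taylor z j * y ^ j" "taylor z j \<noteq> 0" for l
  proof -
    have "taylor z l * y ^ l \<preceq> (taylor z j * y ^ (j - l)) * y ^ l"
      using l by (simp add: mult.assoc flip: power_add)
    hence "taylor z l \<preceq> taylor z j * y ^ (j - l)" using y by (simp add: vle_mult_cancel_right)
    also have "taylor z j * y ^ (j - l) \<prec> taylor z j * 1"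
    proof -
      have "y ^ (j - l) \<prec> 1 ^ (j - l)" using y l by (intro vlt_power) auto
      thus ?thesis using l vlt_mult_cancel_left[of "taylor z j" "y ^ (j - l)" 1] by simp
    qed
    finally show ?thesis by simp
  qed
  have tj: "taylor z j \<noteq> 0" using ij(4,6) by auto
  have "i < res_mult z"
  proof (rule ccontr)
    assume "\<not> i < res_mult z"
    hence "res_mult z < j" using ij by simp
    moreover have "taylor z (res_mult z) * y ^ res_mult z \<preceq> taylor z j * y ^ j"
      using ij(5)[OF res_mult_le[OF z(2)]] ij(6) by (rule vle_trans)
    ultimately have "taylor z (res_mult z) \<prec> taylor z j" using step tj by blast
    thus False using taylor_le_res_mult[OF z(2), of j] by (simp add: vlt_def)
  qed
  moreover have "i > 0" using ij(4) taylor_zero[OF z(1)] by (intro Nat.gr0I) auto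
  ultimately show ?thesis
    using that[of i j] ij step[OF ij(3,6) tj] unfolding y_def by auto
qed

text \<open>If \<open>x\<close> is nearer to \<open>z\<close> than \<open>y\<close>, convexity puts
  the upper index on the edge of \<open>x\<close> at or before the lower index \<open>J y\<close>.
  Coefficients grow strictly from the lower to the upper index of an edge and do not shrink on the
  way to \<open>J y\<close>, so the lower indices get coefficients of different sizes.\<close>

lemma branch_indices:
  assumes z: "z \<in> zeros" "z \<noteq> 0" and B: "B \<subseteq> zeros" "\<And>z'. z' \<in> B \<Longrightarrow> z' \<noteq> z \<and> z' - z \<prec> z"
  obtains J where "\<And>z'. z' \<in> B \<Longrightarrow> 0 < J z' \<and> J z' < res_mult z \<and> taylor z (J z') \<noteq> 0"
    "\<And>x y. x \<in> B \<Longrightarrow> y \<in> B \<Longrightarrow> x - z \<prec> y - z \<Longrightarrow> taylor z (J x) \<prec> taylor z (J y)"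
proof -
  let ?y = "\<lambda>z'. (z' - z) / z"
  have "\<forall>z'\<in>B. \<exists>i j. 0 < i \<and> i < j \<and> i < res_mult z \<and> taylor z i \<noteq> 0 \<and> taylor z i \<prec> taylor z j \<and>
    (\<forall>l\<le>deg_bound. taylor z l * ?y z' ^ l \<preceq> taylor z i * ?y z' ^ i) \<and> taylor z i * ?y z' ^ i \<preceq> taylor z j * ?y z' ^ j
    \<and> i \<le> deg_bound \<and> j \<le> deg_bound"
  proof
    fix z' assume z': "z' \<in> B"
    show "\<exists>i j. 0 < i \<and> i < j \<and> i < res_mult z \<and> taylor z i \<noteq> 0 \<and> taylor z i \<prec> taylor z j \<and>
    (\<forall>l\<le>deg_bound. taylor z l * ?y z' ^ l \<preceq> taylor z i * ?y z' ^ i) \<and> taylor z i * ?y z' ^ i \<preceq> taylor z j * ?y z' ^ j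
    \<and> i \<le> deg_bound \<and> j \<le> deg_bound"
      by (rule branch_index[OF z, of z']) (use z' B in blast)+
  qed
  then obtain J J' where J: "\<And>z'. z' \<in> B \<Longrightarrow> 0 < J z' \<and> J z' < J' z' \<and> J z' < res_mult z \<and> taylor z (J z') \<noteq> 0 \<and> taylor z (J z') \<prec> taylor z (J' z') \<and>
    (\<forall>l\<le>deg_bound. taylor z l * ?y z' ^ l \<preceq> taylor z (J z') * ?y z' ^ J z') \<and> taylor z (J z') * ?y z' ^ J z' \<preceq> taylor z (J' z') * ?y z' ^ J' z'
    \<and> J z' \<le> deg_bound \<and> J' z' \<le> deg_bound" by metis
  show ?thesis
  proof (rule that[of J])
    show "0 < J z' \<and> J z' < res_mult z \<and> taylor z (J z') \<noteq> 0" if "z' \<in> B" for z' using J[OF that] by blast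
    fix x y assume xy: "x \<in> B" "y \<in> B" "x - z \<prec> y - z"
    have lt: "?y x \<prec> ?y y"
      using vlt_mult_cancel_right[of "inverse z" "x - z" "y - z"] xy(3) z(2) by (simp add: divide_inverse)
    have yR: "?y y \<in> R" using B(2)[OF xy(2)] z(2) vlt_iff[of z "y - z"] by (auto dest: max_ideal_subset)
    have x0: "?y x \<noteq> 0" using B(2)[OF xy(1)] z(2) by simp
    have J'x: "taylor z (J' x) \<noteq> 0" using J[OF xy(1)] by (metis not_vlt_zero)
    have le1: "taylor z (J y) * ?y x ^ J y \<preceq> taylor z (J' x) * ?y x ^ J' x"
      using J[OF xy(1)] J[OF xy(2)] by (blast intro: vle_trans)
    have le2: "taylor z (J' x) * ?y y ^ J' x \<preceq> taylor z (J y) * ?y y ^ J y"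
      using J[OF xy(1)] J[OF xy(2)] by blast
    have JJ: "J' x \<le> J y" by (rule exponent_le[OF x0 lt J'x le1 le2])
    have y0: "?y y \<noteq> 0" using lt by auto
    have "taylor z (J' x) * ?y y ^ J' x \<preceq> (taylor z (J y) * ?y y ^ (J y - J' x)) * ?y y ^ J' x"
      using le2 JJ by (simp add: mult.assoc flip: power_add)
    hence "taylor z (J' x) \<preceq> taylor z (J y) * ?y y ^ (J y - J' x)"
      using y0 by (simp add: vle_mult_cancel_right)
    also have "\<dots> \<preceq> taylor z (J y) * 1" using power_mem[OF yR] by (intro vle_mult) auto
    finally have "taylor z (J' x) \<preceq> taylor z (J y)" by simp
    thus "taylor z (J x) \<prec> taylor z (J y)" using J[OF xy(1)] by (blast intro: vlt_vle_trans)
  qed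
qed

end

context residually_finite
begin

lemma frob_fixed_of_nat: "of_nat j \<in> frob_fixed m"
  by (induction j) (auto intro: frob_fixed_add)

end

context sparse_polynomial
begin

text \<open>Here \<open>lam x\<close> is the right end of the side of the Newton polygon of \<open>f\<close> that belongs to \<open>x\<close>.\<close>
lemma last_dominant:
  obtains lam where "\<And>x. dominant x (lam x)" "\<And>x i. dominant x i \<Longrightarrow> n i \<le> n (lam x)"
    "\<And>x x'. x \<in> zeros \<Longrightarrow> x' \<in> zeros \<Longrightarrow> x \<noteq> 0 \<Longrightarrow> x \<prec> x' \<Longrightarrow> n (lam x) < n (lam x')"
proof -
  have "\<exists>i. dominant x i \<and> (\<forall>j. dominant x j \<longrightarrow> n j \<le> n i)" for x
  proof -
    obtain i0 where "dominant x i0" using dominant_exists by blast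
    moreover have "\<forall>j. dominant x j \<longrightarrow> n j \<le> deg_bound" using n_le_deg_bound by (auto simp: dominant_def)
    ultimately show ?thesis
      using ex_has_greatest_nat[of "dominant x" i0 n "Suc deg_bound"] by (auto simp: less_Suc_eq_le)
  qed
  then obtain lam where lam: "\<And>x. dominant x (lam x)" "\<And>x i. dominant x i \<Longrightarrow> n i \<le> n (lam x)" by metis
  have "n (lam x) < n (lam x')" if xx: "x \<in> zeros" "x' \<in> zeros" "x \<noteq> 0" "x \<prec> x'" for x x'
  proof -
    have x'0: "x' \<noteq> 0" using xx by auto
    have s0: "(\<Sum>i\<le>k. a i * x' ^ n i) = 0" using xx(2) by (simp add: zeros_def)
    have s1: "\<exists>i\<in>{..k}. a i * x' ^ n i \<noteq> 0" using a_nonzero[of 0] x'0 by (intro bexI[of _ 0]) auto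
    obtain i j where ij: "i \<in> {..k}" "j \<in> {..k}" "n i < n j"
      "\<And>l. l \<in> {..k} \<Longrightarrow> a l * x' ^ n l \<preceq> a i * x' ^ n i" "a i * x' ^ n i \<preceq> a j * x' ^ n j"
      by (rule two_dominant_terms[OF finite_atMost s0 s1 n_inj]) (assumption | rule that)+
    hence "dominant x' i" "dominant x' j" by (auto simp: dominant_def intro: vle_trans)
    thus ?thesis using dominant_mono[OF xx(3,4) lam(1)] lam(2) ij(3) by (meson le_less_trans less_le_trans)
  qed
  thus ?thesis using that lam by blast
qed

text \<open>
  The functionals \<open>u\<^sub>j = (n\<^sub>i choose j)\<^sub>i\<close> attached to the branchings below \<open>z\<close>, together with \<open>u\<^sub>0\<close>, are
  independent over \<open>\<bbbF>\<^sub>q\<close>, since the values \<open>taylor z j\<close> have different sizes and \<open>f z = 0\<close>. They stay independent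
  when the last index of every side through a point of \<open>S\<close> is dropped, because the residual polynomials
  of these sides vanish to order at least \<open>res_mult z\<close>. Counting combinations gives the bound.
\<close>
lemma rank_bound:
  assumes z: "z \<in> zeros" "z \<noteq> 0"
    and B: "B \<subseteq> zeros" "\<And>z'. z' \<in> B \<Longrightarrow> z' \<noteq> z \<and> z' - z \<prec> z"
    and Bdist: "\<And>x y. x \<in> B \<Longrightarrow> y \<in> B \<Longrightarrow> x \<noteq> y \<Longrightarrow> x - z \<prec> y - z \<or> y - z \<prec> x - z"
    and S: "S \<subseteq> zeros - {0}" "\<And>x y. x \<in> S \<Longrightarrow> y \<in> S \<Longrightarrow> x \<noteq> y \<Longrightarrow> x \<prec> y \<or> y \<prec> x"
    and N: "\<And>x. x \<in> S \<Longrightarrow> res_mult z \<le> res_mult x"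
  shows "card B + card S \<le> k"
proof -
  have finB: "finite B" and finS: "finite S" using B(1) S(1) finite_zeros finite_subset by blast+
  obtain J where J: "\<And>z'. z' \<in> B \<Longrightarrow> 0 < J z' \<and> J z' < res_mult z \<and> taylor z (J z') \<noteq> 0"
    "\<And>x y. x \<in> B \<Longrightarrow> y \<in> B \<Longrightarrow> x - z \<prec> y - z \<Longrightarrow> taylor z (J x) \<prec> taylor z (J y)"
    using branch_indices[OF z B] by blast
  obtain lam where lam: "\<And>x. dominant x (lam x)" "\<And>x i. dominant x i \<Longrightarrow> n i \<le> n (lam x)"
    "\<And>x x'. x \<in> zeros \<Longrightarrow> x' \<in> zeros \<Longrightarrow> x \<noteq> 0 \<Longrightarrow> x \<prec> x' \<Longrightarrow> n (lam x) < n (lam x')"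
    using last_dominant by blast
  have Jinj: "inj_on J B"
    using J(2) Bdist by (intro inj_onI) (metis vlt_irrefl)
  have laminj: "inj_on lam S"
    using lam(3) S by (intro inj_onI) (metis DiffE insertI1 less_irrefl subsetD)
  define Js where "Js = insert 0 (J ` B)"
  have finJs: "finite Js" using finB by (simp add: Js_def)
  have "0 \<notin> J ` B" using J(1) by fastforce
  hence cardJs: "card Js = card B + 1"
    using finB card_image[OF Jinj] unfolding Js_def by (subst card_insert_disjoint) auto
  have zpos: "0 < res_mult z" using taylor_res_mult_nonzero[OF z(2)] taylor_zero[OF z(1)] by (intro Nat.gr0I) auto
  have Jslt: "j < res_mult z" if "j \<in> Js" for j using that J(1) zpos by (auto simp: Js_def)
  let ?F = "frob_fixed 1"
  define u where "u = (\<lambda>c i. \<Sum>j\<in>Js. c j * of_nat (n i choose j) :: 'c)"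
  have uF: "u c i \<in> ?F" if "\<And>j. j \<in> Js \<Longrightarrow> c j \<in> ?F" for c i
    unfolding u_def using that by (intro frob_fixed_sum frob_fixed_mult frob_fixed_of_nat)
  \<comment> \<open>The functional with weights \<open>a i * x ^ n i\<close> sends the vector of
    binomials for \<open>j\<close> to \<open>taylor x j\<close>.\<close>
  have u_taylor: "(\<Sum>i\<le>k. u c i * (a i * x ^ n i)) = (\<Sum>j\<in>Js. c j * taylor x j)" for c x
    unfolding u_def taylor_def sum_distrib_left sum_distrib_right
    by (subst sum.swap) (simp add: mult_ac)

  have kernel: "\<forall>j\<in>Js. c j = 0" if cF: "\<And>j. j \<in> Js \<Longrightarrow> c j \<in> ?F"
    and u0: "\<And>i. i \<in> {..k} - lam ` S \<Longrightarrow> u c i = 0" for c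
  proof -
    have "u c (lam x) = 0" if xS: "x \<in> S" for x
    proof (rule ccontr)
      assume "u c (lam x) \<noteq> 0"
      with xS have "x \<in> S \<and> u c (lam x) \<noteq> 0" by blast
      \<comment> \<open>Among the dropped indices with a nonzero entry, take one of least exponent.
        At its point \<open>y\<close> the entries for smaller sides are 0 and the last indices of
        larger sides are not dominant, so this one term gives the sum the full size
        \<open>\<mu>\<close>; yet all Taylor coefficients below \<open>res_mult y\<close> are
        smaller than \<open>\<mu>\<close>.\<close>
      hence "\<exists>y. (y \<in> S \<and> u c (lam y) \<noteq> 0) \<and> (\<forall>x'. x' \<in> S \<and> u c (lam x') \<noteq> 0 \<longrightarrow> n (lam y) \<le> n (lam x'))"
        by (rule ex_has_least_nat)
      then obtain y where y: "y \<in> S" "u c (lam y) \<noteq> 0"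
        "\<And>x'. x' \<in> S \<Longrightarrow> u c (lam x') \<noteq> 0 \<Longrightarrow> n (lam y) \<le> n (lam x')"
        by blast
      have yz: "y \<in> zeros" "y \<noteq> 0" using y S by auto
      define \<mu> where "\<mu> = a (lam y) * y ^ n (lam y)"
      have \<mu>0: "\<mu> \<noteq> 0" using yz a_nonzero lam(1)[of y] by (simp add: \<mu>_def dominant_def)
      have "(\<Sum>j\<in>Js. c j * taylor y j) \<prec> \<mu>"
      proof (rule vlt_sum[OF \<mu>0])
        fix j assume j: "j \<in> Js"
        have "taylor y j \<prec> \<mu>" unfolding \<mu>_def
          using taylor_below_res_mult[OF lam(1)] Jslt[OF j] N[OF y(1)] by simp
        thus "c j * taylor y j \<prec> \<mu>"
          using frob_fixed_scale(1)[OF cF[OF j], where v = "taylor y j"] by (simp add: vle_vlt_trans)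
      qed
      moreover have "u c (lam y) * \<mu> \<preceq> (\<Sum>i\<le>k. u c i * (a i * y ^ n i))"
        unfolding \<mu>_def
      proof (rule vle_sum_dominant(1))
        show "lam y \<in> {..k}" using lam(1)[of y] by (simp add: dominant_def)
        fix i assume i: "i \<in> {..k}" "i \<noteq> lam y"
        have big: "\<mu> \<preceq> u c (lam y) * \<mu>" using frob_fixed_scale(2)[OF uF[OF cF]] y(2) by simp
        show "u c i * (a i * y ^ n i) \<prec> u c (lam y) * (a (lam y) * y ^ n (lam y))"
        proof (cases "u c i = 0")
          case True
          thus ?thesis using \<mu>0 y(2) by (simp add: \<mu>_def)
        next
          case False
          then obtain x' where x': "x' \<in> S" "i = lam x'" using u0[of i] i by auto
          have "\<not> x' \<prec> y" using lam(3)[of x' y] y(3)[OF x'(1)] x' yz S False by force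
          hence "y \<prec> x'" using S(2)[OF x'(1) y(1)] i x' by auto
          hence "n (lam y) < n i" using lam(3)[of y x'] x' yz S by auto
          hence "\<not> dominant y i" using lam(2)[of y i] by auto
          then obtain l where "l \<le> k" "a i * y ^ n i \<prec> a l * y ^ n l"
            using i(1) by (auto simp: dominant_def vlt_def)
          moreover have "a l * y ^ n l \<preceq> \<mu>"
            using lam(1)[of y] \<open>l \<le> k\<close> by (simp add: \<mu>_def dominant_def)
          ultimately have "a i * y ^ n i \<prec> \<mu>" by (blast intro: vlt_vle_trans)
          hence "u c i * (a i * y ^ n i) \<prec> u c (lam y) * \<mu>"
            using frob_fixed_scale(1)[OF uF[OF cF], where v = "a i * y ^ n i"] big
            by (meson vle_vlt_trans vlt_vle_trans zero_less_one)
          thus ?thesis by (simp add: \<mu>_def)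
        qed
      qed simp
      moreover have "\<mu> \<preceq> u c (lam y) * \<mu>" using frob_fixed_scale(2)[OF uF[OF cF]] y(2) by simp
      ultimately have "\<mu> \<prec> \<mu>" unfolding u_taylor by (meson vle_trans vle_vlt_trans)
      thus False by simp
    qed
    hence u0': "u c i = 0" if "i \<le> k" for i using u0[of i] that by auto
    have sum0: "(\<Sum>j\<in>Js. c j * taylor z j) = 0"
      using u_taylor[of c z] u0' by simp
    have cJ: "c j = 0" if j: "j \<in> J ` B" for j
    proof (rule ccontr)
      assume "c j \<noteq> 0"
      with j have ne: "{j \<in> J ` B. c j \<noteq> 0} \<noteq> {}" by blast
      obtain m where m: "m \<in> J ` B" "c m \<noteq> 0"
        "\<And>l. l \<in> J ` B \<Longrightarrow> c l \<noteq> 0 \<Longrightarrow> taylor z l \<preceq> taylor z m"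
        using vle_max_exists[OF _ ne, of "taylor z"] finB by auto
      have tm: "taylor z m \<noteq> 0" using m(1) J(1) by auto
      have mJs: "m \<in> Js" using m(1) by (auto simp: Js_def)
      have "c m * taylor z m \<preceq> (\<Sum>j\<in>Js. c j * taylor z j)"
      proof (rule vle_sum_dominant(1)[OF finJs mJs])
        fix l assume l: "l \<in> Js" "l \<noteq> m"
        show "c l * taylor z l \<prec> c m * taylor z m"
        proof (cases "c l * taylor z l = 0")
          case True
          show ?thesis unfolding True using m(2) tm by simp
        next
          case False
          hence "l \<noteq> 0" using taylor_zero[OF z(1)] by (intro notI) simp
          then obtain x y where xy: "x \<in> B" "y \<in> B" "l = J x" "m = J y" using l m by (auto simp: Js_def)
          hence "\<not> taylor z m \<prec> taylor z l" using m(3)[of l] False by (auto simp: vlt_def)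
          hence "\<not> y - z \<prec> x - z" using J(2)[OF xy(2,1)] xy by blast
          hence "x - z \<prec> y - z" using Bdist[OF xy(1,2)] l xy by auto
          hence "taylor z l \<prec> taylor z m" using J(2)[OF xy(1,2)] xy by blast
          thus ?thesis
            using frob_fixed_scale(1)[OF cF[OF l(1)], where v = "taylor z l"] frob_fixed_scale(2)[OF cF[OF mJs] _ m(2), where v = "taylor z m"]
            by (meson vle_vlt_trans vlt_vle_trans zero_less_one)
        qed
      qed
      thus False using sum0 m(2) tm by simp
    qed
    \<comment> \<open>The functional at \<open>z\<close> does not see \<open>c 0\<close>, because
      \<open>taylor z 0 = 0\<close>. But with the other coefficients gone, the combination is
      \<open>c 0\<close> times the vector of ones, and it vanishes.\<close>
    have "u c 0 = c 0"
      unfolding u_def using finJs cJ by (subst sum.remove[of _ 0]) (auto simp: Js_def intro!: sum.neutral)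
    hence "c 0 = 0" using u0'[of 0] by simp
    thus ?thesis using cJ by (auto simp: Js_def)
  qed

  define \<Phi> where "\<Phi> = (\<lambda>c. restrict (u c) ({..k} - lam ` S))"
  have "inj_on \<Phi> (Js \<rightarrow>\<^sub>E ?F)"
  proof (rule inj_onI)
    fix c c' assume c: "c \<in> Js \<rightarrow>\<^sub>E ?F" "c' \<in> Js \<rightarrow>\<^sub>E ?F" "\<Phi> c = \<Phi> c'"
    have "\<forall>j\<in>Js. c j - c' j = 0"
    proof (rule kernel)
      show "c j - c' j \<in> ?F" if "j \<in> Js" for j using c that by (intro frob_fixed_diff) auto
      fix i assume i: "i \<in> {..k} - lam ` S"
      have "u (\<lambda>j. c j - c' j) i = u c i - u c' i"
        by (simp add: u_def left_diff_distrib sum_subtractf)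
      also have "u c i = u c' i" using fun_cong[OF c(3), of i] i by (simp add: \<Phi>_def)
      finally show "u (\<lambda>j. c j - c' j) i = 0" by simp
    qed
    thus "c = c'" using c by (intro PiE_ext[of c Js _ c']) auto
  qed
  moreover have "\<Phi> ` (Js \<rightarrow>\<^sub>E ?F) \<subseteq> ({..k} - lam ` S) \<rightarrow>\<^sub>E ?F"
    unfolding \<Phi>_def by (intro image_subsetI restrict_PiE_iff[THEN iffD2] ballI uF) auto
  moreover have "finite (({..k} - lam ` S) \<rightarrow>\<^sub>E ?F)"
    using finite_frob_fixed[of 1] by (intro finite_PiE) auto
  ultimately have "card (Js \<rightarrow>\<^sub>E ?F) \<le> card (({..k} - lam ` S) \<rightarrow>\<^sub>E ?F)"
    by (rule card_inj_on_le)
  hence "q ^ card Js \<le> q ^ card ({..k} - lam ` S)"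
    using finJs by (simp add: card_PiE card_frob_fixed[of 1, simplified])
  hence "card Js \<le> card ({..k} - lam ` S)" using q_gt_1 power_le_imp_le_exp by blast
  moreover have "lam ` S \<subseteq> {..k}" using lam(1) by (auto simp: dominant_def)
  hence "card ({..k} - lam ` S) + card S = k + 1"
    using card_image[OF laminj] finS by (subst card_Diff_subset) (auto dest: card_mono[rotated])
  ultimately show ?thesis using cardJs by simp
qed

end

section \<open>Zeros as tuples\<close>

context sparse_polynomial
begin

text \<open>
  The sides of the Newton polygon are numbered by decreasing \<open>res_mult\<close>. A nonzero root on side \<open>t\<close> is
  sent to the tuple of \<open>t - 1\<close> entries \<open>0\<close>, its leading digit, its digits at the branchings below, and
  entries \<open>0\<close> again; by \<open>rank_bound\<close> there is room for all of them.
\<close>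
lemma tuple_embedding:
  obtains \<sigma> \<Phi> where "\<sigma> \<in> embeddings K" "inj_on \<Phi> zeros" "\<Phi> ` zeros \<subseteq> extensional {1..k}"
    "\<And>z j m. z \<in> zeros \<Longrightarrow> (\<sigma> ^^ j) z = z \<Longrightarrow> m \<in> {1..k} \<Longrightarrow> \<Phi> z m \<in> frob_fixed j"
proof -
  obtain \<sigma> I c N where \<sigma>: "\<sigma> \<in> embeddings K" and N: "N > 0" and finI: "finite I" and I0: "0 \<notin> I"
    and Idist: "\<And>v w. v \<in> I \<Longrightarrow> w \<in> I \<Longrightarrow> v \<noteq> w \<Longrightarrow> v \<prec> w \<or> w \<prec> v"
    and cF: "\<And>z w. z \<in> zeros \<Longrightarrow> c z w \<in> frob_fixed N"
    and cz: "\<And>z. z \<in> zeros \<Longrightarrow> z = (\<Sum>w\<in>I. c z w * w)"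
    and c\<sigma>: "\<And>z w. z \<in> zeros \<Longrightarrow> w \<in> I \<Longrightarrow> c (\<sigma> z) w = c z w ^ q"
  proof (rule digit_expansion[of zeros])
    show "finite zeros" by (rule finite_zeros)
    show "\<sigma> z \<in> zeros" if "\<sigma> \<in> embeddings K" "z \<in> zeros" for \<sigma> z using that by (rule embeddings_zeros)
  qed (rule that; assumption)
  have Ieq: "v = w" if "v \<in> I" "w \<in> I" "v \<preceq> w" "w \<preceq> v" for v w
    using Idist[OF that(1,2)] that(3,4) by (auto simp: vlt_def)
  \<comment> \<open>Reading from the largest place downwards, \<open>w\<close> is the first one
    where the digits of \<open>z\<close> and \<open>z'\<close> differ; it has the size of
    \<open>z - z'\<close>.\<close>
  define fd where "fd = (\<lambda>z z' w. w \<in> I \<and> c z w \<noteq> c z' w \<and> (\<forall>v\<in>I. w \<prec> v \<longrightarrow> c z v = c z' v))"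
  have fd_sym: "fd z z' w \<Longrightarrow> fd z' z w" for z z' w by (auto simp: fd_def)
  have fd_ex: "\<exists>w. fd z z' w \<and> w \<preceq> z - z' \<and> z - z' \<preceq> w" if zz: "z \<in> zeros" "z' \<in> zeros" "z \<noteq> z'" for z z'
  proof -
    define d where "d = (\<lambda>w. c z w - c z' w)"
    have dz: "(\<Sum>w\<in>I. d w * w) = z - z'"
      using cz[OF zz(1)] cz[OF zz(2)] by (simp add: d_def left_diff_distrib sum_subtractf)
    have dF: "d w \<in> frob_fixed N" for w unfolding d_def using cF zz by (intro frob_fixed_diff)
    have "\<exists>w\<in>I. d w \<noteq> 0"
    proof (rule ccontr)
      assume "\<not> ?thesis"
      hence "(\<Sum>w\<in>I. d w * w) = 0" by (intro sum.neutral) auto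
      thus False using dz zz by simp
    qed
    from dominant_digit[OF finI I0 Idist dF N this] obtain w where w: "w \<in> I" "d w \<noteq> 0"
      "\<And>v. v \<in> I \<Longrightarrow> w \<prec> v \<Longrightarrow> d v = 0" "w \<preceq> (\<Sum>w\<in>I. d w * w)" "(\<Sum>w\<in>I. d w * w) \<preceq> w" by blast
    thus ?thesis using dz by (intro exI[of _ w]) (auto simp: fd_def d_def)
  qed
  have fd_unique: "v = w" if "fd z z' v" "fd z z' w" for z z' v w
    using Idist[of v w] that by (auto simp: fd_def)
  have fd_size: "w \<preceq> z - z'" "z - z' \<preceq> w" if "z \<in> zeros" "z' \<in> zeros" "fd z z' w" for z z' w
  proof -
    have "z \<noteq> z'" using that(3) by (auto simp: fd_def)
    thus "w \<preceq> z - z'" "z - z' \<preceq> w" using fd_ex[OF that(1,2)] fd_unique[OF that(3)] by blast+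
  qed

  have "\<exists>w. w \<in> I \<and> c z w \<noteq> 0 \<and> (\<forall>v\<in>I. w \<prec> v \<longrightarrow> c z v = 0) \<and> w \<preceq> z \<and> z \<preceq> w" if z: "z \<in> zeros - {0}" for z
  proof -
    have "\<exists>w\<in>I. c z w \<noteq> 0"
    proof (rule ccontr)
      assume "\<not> ?thesis"
      hence "(\<Sum>w\<in>I. c z w * w) = 0" by (intro sum.neutral) auto
      thus False using cz[of z] z by simp
    qed
    from dominant_digit[OF finI I0 Idist _ N this] cF z obtain w where w: "w \<in> I" "c z w \<noteq> 0"
      "\<And>v. v \<in> I \<Longrightarrow> w \<prec> v \<Longrightarrow> c z v = 0" "w \<preceq> (\<Sum>w\<in>I. c z w * w)" "(\<Sum>w\<in>I. c z w * w) \<preceq> w" by blast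
    thus ?thesis using cz[of z] z by auto
  qed
  then obtain ld where ld: "\<And>z. z \<in> zeros - {0} \<Longrightarrow> ld z \<in> I \<and> c z (ld z) \<noteq> 0 \<and> (\<forall>v\<in>I. ld z \<prec> v \<longrightarrow> c z v = 0) \<and> ld z \<preceq> z \<and> z \<preceq> ld z"
    by metis

  define L where "L = ld ` (zeros - {0})"
  have finL: "finite L" using finite_zeros by (simp add: L_def)
  have LI: "L \<subseteq> I" using ld by (auto simp: L_def)
  have "\<exists>z. z \<in> zeros - {0} \<and> ld z = l \<and> (\<forall>z'. z' \<in> zeros - {0} \<and> ld z' = l \<longrightarrow> res_mult z' \<le> res_mult z)" if lL: "l \<in> L" for l
  proof -
    obtain z0 where z0: "z0 \<in> zeros - {0} \<and> ld z0 = l" using lL by (auto simp: L_def)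
    have "\<forall>z'. z' \<in> zeros - {0} \<and> ld z' = l \<longrightarrow> res_mult z' < Suc deg_bound"
      using res_mult_le by (auto simp: less_Suc_eq_le)
    from ex_has_greatest_nat[where P = "\<lambda>z. z \<in> zeros - {0} \<and> ld z = l", OF z0 this] show ?thesis by blast
  qed
  \<comment> \<open>Maximality of \<open>res_mult\<close> on its side lets the representative meet
    the last hypothesis of \<open>rank_bound\<close> for every zero of that side.\<close>
  then obtain rep where rep: "\<And>l. l \<in> L \<Longrightarrow> rep l \<in> zeros - {0}" "\<And>l. l \<in> L \<Longrightarrow> ld (rep l) = l"
    "\<And>l z'. l \<in> L \<Longrightarrow> z' \<in> zeros - {0} \<Longrightarrow> ld z' = l \<Longrightarrow> res_mult z' \<le> res_mult (rep l)"
    by metis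
  \<comment> \<open>Sides with equal \<open>res_mult\<close> are separated by size, which makes the
    order antisymmetric on \<open>L\<close>. The rank \<open>t l\<close> counts \<open>l\<close>
    itself and so starts at 1.\<close>
  define ge where "ge = (\<lambda>l' l. res_mult (rep l) < res_mult (rep l') \<or> res_mult (rep l) = res_mult (rep l') \<and> l' \<preceq> l)"
  define t where "t = (\<lambda>l. card {l'\<in>L. ge l' l})"
  have ge_refl: "ge l l" for l by (simp add: ge_def)
  have ge_trans: "ge x y \<Longrightarrow> ge y z \<Longrightarrow> ge x z" for x y z by (auto simp: ge_def intro: vle_trans)
  have ge_antisym: "x = y" if "x \<in> L" "y \<in> L" "ge x y" "ge y x" for x y
    using that LI Ieq[of x y] by (auto simp: ge_def)
  have ge_total: "ge x y \<or> ge y x" for x y using vle_total[of x y] by (auto simp: ge_def)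
  have t_less: "t l' < t l" if "l \<in> L" "l' \<in> L" "ge l' l" "l \<noteq> l'" for l l'
    unfolding t_def
  proof (rule psubset_card_mono)
    have "{x\<in>L. ge x l'} \<subseteq> {x\<in>L. ge x l}" using that(3) ge_trans by blast
    moreover have "l \<in> {x\<in>L. ge x l}" "l \<notin> {x\<in>L. ge x l'}" using that ge_refl ge_antisym by auto
    ultimately show "{x\<in>L. ge x l'} \<subset> {x\<in>L. ge x l}" by blast
  qed (use finL in simp)
  have t_inj: "l = l'" if "l \<in> L" "l' \<in> L" "t l = t l'" for l l'
    using t_less[OF that(1,2)] t_less[OF that(2,1)] ge_total[of l l'] that(3) by fastforce
  have t_pos: "1 \<le> t l" if "l \<in> L" for l
  proof -
    have "{l'\<in>L. ge l' l} \<noteq> {}" using that ge_refl by blast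
    hence "0 < card {l'\<in>L. ge l' l}" using finL by (simp add: card_gt_0_iff)
    thus ?thesis by (simp add: t_def)
  qed

  \<comment> \<open>The places below the leading one at which some other zero parts from
    \<open>z\<close>.\<close>
  define Br where "Br = (\<lambda>z. {w\<in>I. w \<prec> ld z \<and> (\<exists>z'\<in>zeros. fd z z' w)})"
  have finBr: "finite (Br z)" for z using finI by (simp add: Br_def)
  have bound: "card (Br z) + t (ld z) \<le> k" if z: "z \<in> zeros - {0}" for z
  proof -
    have zL: "ld z \<in> L" using z by (simp add: L_def)
    have "\<forall>w\<in>Br z. \<exists>z'. z' \<in> zeros \<and> fd z z' w" by (auto simp: Br_def)
    then obtain g where g: "\<And>w. w \<in> Br z \<Longrightarrow> g w \<in> zeros" "\<And>w. w \<in> Br z \<Longrightarrow> fd z (g w) w" by metis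
    have gs: "w \<preceq> g w - z" "g w - z \<preceq> w" if "w \<in> Br z" for w
    proof -
      have "fd (g w) z w" using g(2)[OF that] fd_sym by blast
      thus "w \<preceq> g w - z" "g w - z \<preceq> w" using fd_size[of "g w" z w] g(1)[OF that] z by auto
    qed
    have ginj: "inj_on g (Br z)" using g(2) fd_unique by (intro inj_onI) metis
    have comp: "g v - z \<prec> g w - z" if "v \<in> Br z" "w \<in> Br z" "v \<prec> w" for v w
      using gs(2)[OF that(1)] gs(1)[OF that(2)] that(3) by (blast intro: vle_vlt_trans vlt_vle_trans)
    define S where "S = rep ` {l'\<in>L. ge l' (ld z)}"
    have repinj: "inj_on rep L" using rep(2) by (intro inj_onI) metis
    have rs: "l \<preceq> rep l" "rep l \<preceq> l" if "l \<in> L" for l using ld[OF rep(1)[OF that]] rep(2)[OF that] by auto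
    have "card (g ` Br z) + card S \<le> k"
    proof (rule rank_bound)
      show "z \<in> zeros" "z \<noteq> 0" using z by auto
      show "g ` Br z \<subseteq> zeros" using g(1) by auto
      show "z' \<noteq> z \<and> z' - z \<prec> z" if z': "z' \<in> g ` Br z" for z'
      proof -
        obtain w where w: "w \<in> Br z" "z' = g w" using z' by auto
        have "w \<prec> ld z" using w by (simp add: Br_def)
        hence "z' - z \<prec> z" using gs(2)[OF w(1)] ld[OF z] w(2) by (blast intro: vle_vlt_trans vlt_vle_trans)
        thus ?thesis using g(2)[OF w(1)] w(2) by (auto simp: fd_def)
      qed
      show "x - z \<prec> y - z \<or> y - z \<prec> x - z" if xy: "x \<in> g ` Br z" "y \<in> g ` Br z" "x \<noteq> y" for x y
      proof -
        obtain v w where vw: "v \<in> Br z" "x = g v" "w \<in> Br z" "y = g w" using xy by auto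
        hence "v \<prec> w \<or> w \<prec> v" using xy(3) by (intro Idist) (auto simp: Br_def)
        thus ?thesis using comp vw by blast
      qed
      show "S \<subseteq> zeros - {0}" using rep(1) by (auto simp: S_def)
      show "x \<prec> y \<or> y \<prec> x" if xy: "x \<in> S" "y \<in> S" "x \<noteq> y" for x y
      proof -
        obtain v w where vw: "v \<in> L" "x = rep v" "w \<in> L" "y = rep w" using xy by (auto simp: S_def)
        hence "v \<prec> w \<or> w \<prec> v" using xy(3) LI by (intro Idist) auto
        thus ?thesis using rs[OF vw(1)] rs[OF vw(3)] vw(2,4) by (blast intro: vle_vlt_trans vlt_vle_trans)
      qed
      show "res_mult z \<le> res_mult x" if "x \<in> S" for x
        using that rep(3)[OF zL z refl] by (auto simp: S_def ge_def)
    qed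
    moreover have "card S = t (ld z)"
      unfolding S_def t_def by (rule card_image) (rule inj_on_subset[OF repinj], auto)
    ultimately show ?thesis using card_image[OF ginj] by simp
  qed

  define Br' where "Br' = (\<lambda>z. insert (ld z) (Br z))"
  have finBr': "finite (Br' z)" for z using finBr by (simp add: Br'_def)
  have cardBr': "card (Br' z) = Suc (card (Br z))" for z
    unfolding Br'_def using finBr by (intro card_insert_disjoint) (auto simp: Br_def)
  have Br'I: "Br' z \<subseteq> I" if "z \<in> zeros - {0}" for z using ld[OF that] by (auto simp: Br'_def Br_def)
  \<comment> \<open>Places of decreasing size get consecutive positions from \<open>t (ld z)\<close>
    on, the leading place coming first.\<close>
  define pos where "pos = (\<lambda>z w. t (ld z) + card {v\<in>Br' z. w \<prec> v})"
  have pos_le: "pos z w \<in> {1..k}" if z: "z \<in> zeros - {0}" and w: "w \<in> Br' z" for z w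
  proof -
    have "{v\<in>Br' z. w \<prec> v} \<subseteq> Br' z - {w}" by auto
    hence "card {v\<in>Br' z. w \<prec> v} \<le> card (Br' z - {w})" using finBr' by (intro card_mono) auto
    also have "\<dots> = card (Br z)" using w cardBr'[of z] finBr' by simp
    finally show ?thesis using bound[OF z] t_pos[of "ld z"] z by (auto simp: pos_def L_def)
  qed
  have pos_ld: "pos z (ld z) = t (ld z)" for z
  proof -
    have *: "{v\<in>Br' z. ld z \<prec> v} = {}" by (auto simp: Br'_def Br_def dest: vlt_trans)
    show ?thesis unfolding pos_def * by simp
  qed
  have pos_less: "pos z w < pos z v" if "v \<in> Br' z" "w \<in> Br' z" "v \<prec> w" for z v w
  proof -
    have "{x\<in>Br' z. w \<prec> x} \<subseteq> {x\<in>Br' z. v \<prec> x}" using that(3) by (blast intro: vlt_trans)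
    moreover have "w \<in> {x\<in>Br' z. v \<prec> x}" "w \<notin> {x\<in>Br' z. w \<prec> x}" using that by auto
    ultimately have "{x\<in>Br' z. w \<prec> x} \<subset> {x\<in>Br' z. v \<prec> x}" by blast
    thus ?thesis unfolding pos_def using finBr' by (simp add: psubset_card_mono)
  qed
  have pos_inj: "v = w" if "z \<in> zeros - {0}" "v \<in> Br' z" "w \<in> Br' z" "pos z v = pos z w" for z v w
    using Idist[of v w] Br'I[OF that(1)] pos_less[OF that(2,3)] pos_less[OF that(3,2)] that by auto

  define \<Phi> where "\<Phi> = (\<lambda>z. restrict (\<lambda>m. if z \<noteq> 0 \<and> (\<exists>w\<in>Br' z. pos z w = m)
    then c z (THE w. w \<in> Br' z \<and> pos z w = m) else 0) {1..k})"
  have \<Phi>_pos: "\<Phi> z (pos z w) = c z w" if z: "z \<in> zeros - {0}" and w: "w \<in> Br' z" for z w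
  proof -
    have "(THE v. v \<in> Br' z \<and> pos z v = pos z w) = w"
      using w pos_inj[OF z] by (intro the_equality) auto
    thus ?thesis using pos_le[OF z w] z w by (auto simp: \<Phi>_def)
  qed
  have \<Phi>_0: "\<Phi> z m = 0" if "m \<in> {1..k}" "z = 0 \<or> m < t (ld z)" for z m
    using that by (auto simp: \<Phi>_def pos_def)
  have \<Phi>_t: "\<Phi> z (t (ld z)) \<noteq> 0" and t_mem: "t (ld z) \<in> {1..k}" if z: "z \<in> zeros - {0}" for z
  proof -
    have "ld z \<in> Br' z" by (simp add: Br'_def)
    from \<Phi>_pos[OF z this] pos_le[OF z this] show "\<Phi> z (t (ld z)) \<noteq> 0" "t (ld z) \<in> {1..k}"
      using ld[OF z] by (simp_all add: pos_ld)
  qed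
  have "inj_on \<Phi> zeros"
  proof (rule inj_onI, rule ccontr)
    fix z z' assume zz: "z \<in> zeros" "z' \<in> zeros" and eq: "\<Phi> z = \<Phi> z'" and ne: "z \<noteq> z'"
    have nz: "x \<noteq> 0" if "x \<in> zeros" "y \<in> zeros" "x \<noteq> y" "\<Phi> x = \<Phi> y" for x y
      using \<Phi>_0[OF t_mem[of y], of x] \<Phi>_t[of y] that by auto
    have z0: "z \<in> zeros - {0}" "z' \<in> zeros - {0}" using nz[OF zz ne eq] nz[OF zz(2,1)] ne eq zz by auto
    \<comment> \<open>\<open>t (ld z)\<close> is the first nonzero position of the tuple, so equal
      tuples come from the same side.\<close>
    have "t (ld z) = t (ld z')"
      using \<Phi>_0[OF t_mem[OF z0(1)], of z'] \<Phi>_0[OF t_mem[OF z0(2)], of z] \<Phi>_t[OF z0(1)] \<Phi>_t[OF z0(2)] eq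
      by (metis linorder_neqE_nat)
    hence ldeq: "ld z = ld z'" using z0 by (intro t_inj) (auto simp: L_def)
    obtain w where w: "fd z z' w" using fd_ex[OF zz ne] by blast
    have wI: "w \<in> I" using w by (simp add: fd_def)
    have "\<not> ld z \<prec> w" using ld[OF z0(1)] ld[OF z0(2)] w ldeq by (auto simp: fd_def)
    hence "w = ld z \<or> w \<prec> ld z" using Idist[OF wI, of "ld z"] ld[OF z0(1)] by auto
    hence wB: "w \<in> Br' z" "w \<in> Br' z'" using w fd_sym[OF w] zz wI ldeq by (auto simp: Br'_def Br_def)
    \<comment> \<open>Two zeros that first differ at \<open>w\<close> have the same branchings above
      \<open>w\<close>: a third zero parts from both at the same place. Hence \<open>w\<close> is
      stored at the same position for both.\<close>
    have sub: "{v\<in>Br' x. w \<prec> v} \<subseteq> {v\<in>Br' y. w \<prec> v}" if "fd x y w" "ld x = ld y" for x y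
    proof
      fix v assume v: "v \<in> {v\<in>Br' x. w \<prec> v}"
      show "v \<in> {v\<in>Br' y. w \<prec> v}"
      proof (cases "v = ld x")
        case True thus ?thesis using v that(2) by (auto simp: Br'_def)
      next
        case False
        then obtain x' where x': "v \<in> I" "v \<prec> ld x" "x' \<in> zeros" "fd x x' v" using v by (auto simp: Br'_def Br_def)
        have ag: "c x u = c y u" if "u \<in> I" "u = v \<or> v \<prec> u" for u
          using that v \<open>fd x y w\<close> by (auto simp: fd_def intro: vlt_trans)
        have "fd y x' v" using x'(4) ag by (auto simp: fd_def)
        thus ?thesis using v x' that(2) by (auto simp: Br'_def Br_def)
      qed
    qed
    have "{v\<in>Br' z. w \<prec> v} = {v\<in>Br' z'. w \<prec> v}"
      using sub[OF w ldeq] sub[OF fd_sym[OF w] ldeq[symmetric]] by blast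
    hence "pos z w = pos z' w" by (simp add: pos_def ldeq)
    hence "c z w = c z' w" using \<Phi>_pos[OF z0(1) wB(1)] \<Phi>_pos[OF z0(2) wB(2)] eq by simp
    thus False using w by (simp add: fd_def)
  qed
  moreover have "\<Phi> ` zeros \<subseteq> extensional {1..k}" by (auto simp: \<Phi>_def)
  moreover have "\<Phi> z m \<in> frob_fixed j" if z: "z \<in> zeros" "(\<sigma> ^^ j) z = z" "m \<in> {1..k}" for z j m
  proof -
    have *: "(\<sigma> ^^ i) z \<in> zeros \<and> (\<forall>w\<in>I. c ((\<sigma> ^^ i) z) w = c z w ^ (q ^ i))" for i
    proof (induction i)
      case (Suc i)
      have "c (\<sigma> ((\<sigma> ^^ i) z)) w = c z w ^ (q ^ Suc i)" if "w \<in> I" for w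
        using Suc c\<sigma>[of "(\<sigma> ^^ i) z" w] that by (simp add: mult.commute flip: power_mult)
      thus ?case using embeddings_zeros[OF \<sigma>] Suc by simp
    qed (use z in simp)
    have cj: "c z w \<in> frob_fixed j" if "w \<in> I" for w using *[of j] z(2) that by (simp add: frob_fixed_def)
    show ?thesis
    proof (cases "z \<noteq> 0 \<and> (\<exists>w\<in>Br' z. pos z w = m)")
      case True
      then obtain w where w: "z \<noteq> 0" "w \<in> Br' z" "pos z w = m" by blast
      hence "\<Phi> z m = c z w" using \<Phi>_pos z by blast
      thus ?thesis using cj Br'I[of z] w z by auto
    next
      case False
      hence "\<Phi> z m = 0" using z(3) by (auto simp: \<Phi>_def)
      thus ?thesis by simp
    qed
  qed
  ultimately show ?thesis using \<sigma> that by blast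
qed

end

section \<open>Counting tuples\<close>

lemma moebius_mu_prime_mult:
  assumes "prime (p::nat)" "\<not> p dvd d" shows "moebius_mu (p * d) = - moebius_mu d"
proof -
  have d0: "d \<noteq> 0" using assms(2) by (intro notI) simp
  have cop: "coprime p d" using assms by (simp add: prime_imp_coprime)
  have "squarefree (p * d) \<longleftrightarrow> squarefree d"
    using squarefree_mult_coprime[OF cop] squarefree_prime[OF assms(1)] squarefree_multD(2) by blast
  moreover have "prime_factors (p * d) = insert p (prime_factors d)"
    using assms d0 by (simp add: prime_factors_product prime_factorization_prime prime_gt_0_nat)
  moreover have "p \<notin> prime_factors d" using assms(2) by auto
  ultimately show ?thesis by (simp add: moebius_mu_def)
qed

text \<open>For a prime \<open>p\<close> dividing \<open>n\<close>, each squarefree divisor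
  \<open>i\<close> prime to \<open>p\<close> is paired with \<open>p * i\<close>, which has the
  opposite sign.\<close>

lemma sum_moebius_mu:
  assumes "n > 0" shows "(\<Sum>i | i dvd n. moebius_mu i) = (if n = 1 then 1 else 0)"
proof (cases "n = 1")
  case True
  thus ?thesis by (simp add: moebius_mu_def)
next
  case False
  then obtain p where p: "prime p" "p dvd n" using prime_factor_nat by blast
  define A where "A = {i. i dvd n \<and> squarefree i \<and> \<not> p dvd i}"
  have fin: "finite {i. i dvd n}" using assms by simp
  have finA: "finite A" using fin by (rule finite_subset[rotated]) (auto simp: A_def)
  have p0: "p > 0" using p prime_gt_0_nat by blast
  have inj: "inj_on (\<lambda>i. p * i) A" using p0 by (auto intro: inj_onI)
  have im: "(\<lambda>i. p * i) ` A = {i. i dvd n \<and> squarefree i \<and> p dvd i}"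
  proof (intro equalityI subsetI)
    fix i assume "i \<in> (\<lambda>i. p * i) ` A"
    then obtain j where j: "i = p * j" "j dvd n" "squarefree j" "\<not> p dvd j" by (auto simp: A_def)
    have "coprime p j" using p j by (simp add: prime_imp_coprime)
    thus "i \<in> {i. i dvd n \<and> squarefree i \<and> p dvd i}"
      using j p by (auto simp: divides_mult squarefree_mult_coprime squarefree_prime)
  next
    fix i assume i: "i \<in> {i. i dvd n \<and> squarefree i \<and> p dvd i}"
    then obtain j where j: "i = p * j" by auto
    have "\<not> p dvd j"
    proof
      assume "p dvd j"
      hence "p\<^sup>2 dvd i" by (auto simp: j power2_eq_square)
      hence "is_unit p" using i by (auto simp: squarefree_def)
      thus False using p by (simp add: not_prime_unit)
    qed
    moreover have "j dvd n" "squarefree j" using i j by (auto intro: dvd_mult_right squarefree_multD)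
    ultimately show "i \<in> (\<lambda>i. p * i) ` A" using j by (auto simp: A_def)
  qed
  have "(\<Sum>i | i dvd n. moebius_mu i) = (\<Sum>i | i dvd n \<and> squarefree i. moebius_mu i)"
    using fin by (intro sum.mono_neutral_right) (auto simp: moebius_mu_def)
  also have "{i. i dvd n \<and> squarefree i} = A \<union> (\<lambda>i. p * i) ` A" unfolding im by (auto simp: A_def)
  also have "(\<Sum>i\<in>A \<union> (\<lambda>i. p * i) ` A. moebius_mu i) = (\<Sum>i\<in>A. moebius_mu i) + (\<Sum>i\<in>(\<lambda>i. p * i) ` A. moebius_mu i)"
    using finA by (intro sum.union_disjoint) (auto simp: A_def)
  also have "(\<Sum>i\<in>(\<lambda>i. p * i) ` A. moebius_mu i) = (\<Sum>i\<in>A. - moebius_mu i)"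
    unfolding sum.reindex[OF inj] using moebius_mu_prime_mult[OF p(1)] by (intro sum.cong) (auto simp: A_def)
  finally show ?thesis using False by (simp add: sum_negf)
qed

lemma moebius_inversion:
  fixes e g :: "nat \<Rightarrow> int"
  assumes g: "\<And>i. i > 0 \<Longrightarrow> g i = (\<Sum>l | l dvd i. e l)" and j: "j > 0"
  shows "(\<Sum>i | i dvd j. g i * moebius_mu (j div i)) = e j"
proof -
  have "(\<Sum>i | i dvd j. g i * moebius_mu (j div i)) = (\<Sum>i | i dvd j. \<Sum>l | l dvd i. e l * moebius_mu (j div i))"
    using j by (intro sum.cong) (auto simp: g sum_distrib_right dvd_pos_nat)
  also have "\<dots> = (\<Sum>i | i dvd j. \<Sum>l | l dvd j \<and> l dvd i. e l * moebius_mu (j div i))"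
    by (intro sum.cong refl) (auto intro: dvd_trans)
  also have "\<dots> = (\<Sum>l | l dvd j. \<Sum>i | i dvd j \<and> l dvd i. e l * moebius_mu (j div i))"
    using sum.swap_restrict[of "{i. i dvd j}" "{l. l dvd j}" "\<lambda>i l. e l * moebius_mu (j div i)" "\<lambda>i l. l dvd i"] j
    by simp
  also have "\<dots> = (\<Sum>l | l dvd j. if l = j then e l else 0)"
  proof (intro sum.cong refl)
    fix l assume "l \<in> {l. l dvd j}"
    then obtain m where m: "j = l * m" by auto
    have lm: "l > 0" "m > 0" using j m by auto
    have "(\<Sum>i | i dvd j \<and> l dvd i. e l * moebius_mu (j div i)) = (\<Sum>i | i dvd m. e l * moebius_mu i)"
      by (rule sum.reindex_bij_witness[of _ "\<lambda>i. j div i" "\<lambda>i. j div i"])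
         (use lm in \<open>auto simp: m elim!: dvdE\<close>)
    also have "\<dots> = e l * (if m = 1 then 1 else 0)"
      using sum_moebius_mu[OF lm(2)] by (simp flip: sum_distrib_left)
    also have "\<dots> = (if l = j then e l else 0)" using lm by (auto simp: m)
    finally show "(\<Sum>i | i dvd j \<and> l dvd i. e l * moebius_mu (j div i)) = (if l = j then e l else 0)" .
  qed
  also have "\<dots> = e j" using j by simp
  finally show ?thesis .
qed

context residually_finite
begin

lemma frob_fixed_add_iff:
  assumes "x \<in> frob_fixed a" shows "x \<in> frob_fixed (a + b) \<longleftrightarrow> x \<in> frob_fixed b"
proof -
  have "x ^ (q ^ (a + b)) = (x ^ (q ^ a)) ^ (q ^ b)" by (simp add: power_add power_mult)
  thus ?thesis using assms by (simp add: frob_fixed_def)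
qed

text \<open>A Euclidean step: the exponents that fix \<open>x\<close> are closed under remainders,
  so the least positive one divides all others.\<close>

lemma frob_fixed_mod_iff:
  assumes "x \<in> frob_fixed a" shows "x \<in> frob_fixed b \<longleftrightarrow> x \<in> frob_fixed (b mod a)"
  using frob_fixed_add_iff[OF frob_fixed_mono[OF assms, of "b div a"], of "b mod a"] by simp

text \<open>The number of points of degree at most \<open>d\<close> of affine \<open>k\<close>-space over \<open>\<bbbF>\<^sub>q\<close>.\<close>
lemma card_tuples:
  fixes k d :: nat
  defines "T \<equiv> {t \<in> extensional {1..k}. \<exists>j\<in>{1..d}. \<forall>m\<in>{1..k}. t m \<in> frob_fixed j}"
  shows "finite T" and "int (card T) = (\<Sum>j=1..d. \<Sum>i | i dvd j. int q ^ (i * k) * moebius_mu (j div i))"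
proof -
  define A where "A = (\<lambda>j. {1..k} \<rightarrow>\<^sub>E frob_fixed j)"
  \<comment> \<open>The tuples of exact degree \<open>j\<close>: their entries lie in the field with
    \<open>q ^ j\<close> elements, but in none with \<open>q ^ i\<close> for
    \<open>0 < i < j\<close>. Over the divisors \<open>i\<close> of \<open>j\<close>, the sets
    \<open>E i\<close> partition \<open>A j\<close>, which is the situation of Moebius
    inversion.\<close>
  define E where "E = (\<lambda>j. {t \<in> A j. \<forall>i\<in>{1..<j}. t \<notin> A i})"
  have finA: "finite (A j)" if "j > 0" for j
    unfolding A_def using finite_frob_fixed[OF that] by (intro finite_PiE) auto
  have finE: "finite (E j)" if "j > 0" for j using finA[OF that] by (simp add: E_def)
  have cardA: "card (A j) = q ^ (j * k)" if "j > 0" for j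
    unfolding A_def using card_frob_fixed[OF that] by (simp add: card_PiE power_mult)
  have disj: "E i \<inter> E j = {}" if "i \<noteq> j" "0 < i" "0 < j" for i j
    using that by (auto simp: E_def linorder_neq_iff)
  have least: "\<exists>i\<in>{1..j}. t \<in> E i" if "t \<in> A j" "j > 0" for t j
  proof -
    have "\<exists>i. (0 < i \<and> t \<in> A i) \<and> (\<forall>l<i. \<not> (0 < l \<and> t \<in> A l))"
      using exists_least_iff[of "\<lambda>i. 0 < i \<and> t \<in> A i"] that by blast
    then obtain i where i: "0 < i" "t \<in> A i" "\<forall>l<i. \<not> (0 < l \<and> t \<in> A l)" by blast
    hence "i \<le> j" using that not_le by blast
    thus ?thesis using i by (intro bexI[of _ i]) (auto simp: E_def)
  qed
  have AE: "A j = (\<Union>i\<in>{i. i dvd j}. E i)" if j: "j > 0" for j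
  proof (intro equalityI subsetI)
    fix t assume t: "t \<in> A j"
    then obtain i where i: "i \<in> {1..j}" "t \<in> E i" using least j by blast
    have "i dvd j"
    proof (rule ccontr)
      assume "\<not> i dvd j"
      hence "j mod i \<in> {1..<i}" using i(1) by (auto simp: dvd_eq_mod_eq_0)
      moreover have "t \<in> A (j mod i)"
        using t i(2) frob_fixed_mod_iff[of _ i j] by (auto simp: A_def E_def PiE_iff)
      ultimately show False using i(2) by (auto simp: E_def)
    qed
    thus "t \<in> (\<Union>i\<in>{i. i dvd j}. E i)" using i by auto
  next
    fix t assume "t \<in> (\<Union>i\<in>{i. i dvd j}. E i)"
    then obtain i where i: "i dvd j" "t \<in> A i" by (auto simp: E_def)
    from i(1) obtain m where "j = i * m" by (elim dvdE)
    with i(2) show "t \<in> A j" using frob_fixed_mono by (auto simp: A_def PiE_iff)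
  qed
  have decomp: "int (card (A j)) = (\<Sum>i | i dvd j. int (card (E i)))" if j: "j > 0" for j
  proof -
    have "card (\<Union>i\<in>{i. i dvd j}. E i) = (\<Sum>i | i dvd j. card (E i))"
      using j finE disj dvd_pos_nat[OF j] by (intro card_UN_disjoint) auto
    thus ?thesis using AE[OF j] by simp
  qed
  have cardE: "int (card (E j)) = (\<Sum>i | i dvd j. int q ^ (i * k) * moebius_mu (j div i))" if j: "j > 0" for j
  proof -
    have "int (card (E j)) = (\<Sum>i | i dvd j. int (card (A i)) * moebius_mu (j div i))"
      by (rule moebius_inversion[OF decomp j, symmetric])
    also have "\<dots> = (\<Sum>i | i dvd j. int q ^ (i * k) * moebius_mu (j div i))"
      using cardA dvd_pos_nat[OF j] by (intro sum.cong) auto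
    finally show ?thesis .
  qed
  have TE: "T = (\<Union>j\<in>{1..d}. E j)"
  proof (intro equalityI subsetI)
    fix t assume "t \<in> T"
    then obtain j where j: "j \<in> {1..d}" "t \<in> A j" by (auto simp: T_def A_def PiE_iff)
    then obtain i where "i \<in> {1..j}" "t \<in> E i" using least[of t j] by auto
    thus "t \<in> (\<Union>j\<in>{1..d}. E j)" using j by auto
  next
    fix t assume "t \<in> (\<Union>j\<in>{1..d}. E j)"
    thus "t \<in> T" by (auto simp: T_def E_def A_def PiE_iff)
  qed
  show "finite T" unfolding TE using finE by auto
  have "card T = (\<Sum>j=1..d. card (E j))"
    unfolding TE using finE disj by (intro card_UN_disjoint) auto
  thus "int (card T) = (\<Sum>j=1..d. \<Sum>i | i dvd j. int q ^ (i * k) * moebius_mu (j div i))"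
    using cardE by (auto intro!: sum.cong)
qed

end

section \<open>Degrees and residue fields\<close>

lemma is_subfield_range_to_ac: "is_subfield (range (to_ac :: 'a::field \<Rightarrow> 'a alg_closure))"
  unfolding is_subfield_def
  by (auto simp flip: to_ac_diff to_ac_mult to_ac_inverse)

lemma algebraic_over_to_ac: "algebraic_over (range to_ac) (z :: 'a::field alg_closure)"
proof -
  obtain P :: "'a poly" where "P \<noteq> 0" "poly (map_poly to_ac P) z = 0" by (rule alg_closure_algebraic)
  thus ?thesis unfolding algebraic_over_def
    by (intro exI[of _ "map_poly to_ac P"]) (auto simp: coeff_map_poly map_poly_eq_0_iff)
qed

text \<open>The ring \<open>K[z]\<close> is already a field, since the inverse of the algebraic
  element \<open>P(z)\<close> is a polynomial in \<open>P(z)\<close>, hence in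
  \<open>z\<close>.\<close>

lemma adjoin_subset_poly:
  fixes z :: "'a::field alg_closure"
  assumes "x \<in> adjoin z"
  obtains P where "\<And>i. coeff P i \<in> range to_ac" "x = poly P z"
proof -
  let ?K = "range (to_ac :: 'a \<Rightarrow> _)"
  define L where "L = {poly P z | P. \<forall>i. coeff P i \<in> ?K}"
  have K: "is_subfield ?K" by (rule is_subfield_range_to_ac)
  have K0: "0 \<in> ?K" and K1: "1 \<in> ?K" by (metis rangeI to_ac_0, metis rangeI to_ac_1)
  have Kdiff: "x - y \<in> ?K" and Kmult: "x * y \<in> ?K" if "x \<in> ?K" "y \<in> ?K" for x y
    using K that by (auto simp: is_subfield_def)
  have mult: "\<forall>i. coeff (P * Q) i \<in> ?K" if "\<forall>i. coeff P i \<in> ?K" "\<forall>i. coeff Q i \<in> ?K" for P Q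
    using that by (auto simp: coeff_mult intro!: subfield_sum[OF K] Kmult)
  have "is_subfield L"
    unfolding is_subfield_def
  proof (intro conjI ballI)
    show "1 \<in> L" unfolding L_def using K0 K1 by (intro CollectI exI[of _ 1]) (auto simp: coeff_1)
    fix x y assume "x \<in> L" "y \<in> L"
    then obtain P Q where PQ: "x = poly P z" "\<forall>i. coeff P i \<in> ?K" "y = poly Q z" "\<forall>i. coeff Q i \<in> ?K"
      by (auto simp: L_def)
    have "x - y = poly (P - Q) z" "x * y = poly (P * Q) z" using PQ by auto
    moreover have "\<forall>i. coeff (P - Q) i \<in> ?K" using PQ(2,4) Kdiff by simp
    ultimately show "x - y \<in> L" "x * y \<in> L" unfolding L_def using mult[OF PQ(2,4)] by blast+
  next
    fix x assume "x \<in> L"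
    then obtain P where P: "x = poly P z" "\<forall>i. coeff P i \<in> ?K" by (auto simp: L_def)
    obtain Q where Q: "\<And>i. coeff Q i \<in> ?K" "inverse x = poly Q x"
      using inverse_eq_poly[OF K algebraic_over_to_ac] by blast
    have "\<forall>i. coeff (pcompose S P) i \<in> ?K" if "\<forall>i. coeff S i \<in> ?K" for S
      using that
    proof (induction S)
      case (pCons a S)
      have aK: "a \<in> ?K" and SK: "\<forall>i. coeff S i \<in> ?K"
        using pCons.prems by (auto dest: spec[of _ 0], metis coeff_pCons_Suc)
      have "coeff [:a:] i \<in> ?K" for i using aK K0 by (auto simp: coeff_pCons split: nat.splits)
      moreover have "x + y \<in> ?K" if "x \<in> ?K" "y \<in> ?K" for x y
        using Kdiff[OF that(1) Kdiff[OF K0 that(2)]] by simp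
      ultimately show ?case using mult[OF P(2) pCons.IH[OF SK]] by (simp add: pcompose_pCons)
    qed (use K0 in simp)
    hence "\<forall>i. coeff (pcompose Q P) i \<in> ?K" using Q by blast
    thus "inverse x \<in> L" unfolding L_def using Q(2) P(1) by (auto simp: poly_pcompose intro!: exI[of _ "pcompose Q P"])
  qed
  moreover have "?K \<subseteq> L"
  proof
    fix x assume "x \<in> ?K"
    thus "x \<in> L" unfolding L_def using K0
      by (intro CollectI exI[of _ "[:x:]"]) (auto simp: coeff_pCons split: nat.splits)
  qed
  moreover have "z \<in> L" unfolding L_def using K0 K1
    by (intro CollectI exI[of _ "[:0, 1:]"]) (auto simp: coeff_pCons split: nat.splits)
  ultimately have "adjoin z \<subseteq> L" by (auto simp: adjoin_def)
  thus ?thesis using assms that by (auto simp: L_def)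
qed

lemma is_subfield_adjoin: "is_subfield (adjoin z)"
  by (auto simp: adjoin_def is_subfield_def)

text \<open>\<open>K(z)\<close> contains \<open>ext_degree z + 1\<close> powers of \<open>z\<close>,
  which must be dependent. That the powers below the degree of some annihilator span
  \<open>K(z)\<close> shows the dimension to be finite, so that it is not the default value
  0.\<close>

lemma annihilator_of_ext_degree:
  fixes z :: "'a::field alg_closure"
  obtains P where "P \<noteq> 0" "\<And>i. coeff P i \<in> range to_ac" "poly P z = 0" "degree P \<le> ext_degree z"
proof -
  let ?K = "range (to_ac :: 'a \<Rightarrow> _)"
  have K: "is_subfield ?K" by (rule is_subfield_range_to_ac)
  have scale: "to_ac c * x \<in> ac.span T" if "x \<in> ac.span T" for c :: 'a and x T
    using ac.span_scale[OF that] .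
  obtain P0 :: "'a poly" where P0: "P0 \<noteq> 0" "poly (map_poly to_ac P0) z = 0" by (rule alg_closure_algebraic)
  define N where "N = degree P0"
  define T where "T = (\<lambda>i. z ^ i) ` {..<N}"
  have pow: "z ^ m \<in> ac.span T" for m
  proof (induction m rule: less_induct)
    case (less m)
    show ?case
    proof (cases "m < N")
      case True
      thus ?thesis by (intro ac.span_base) (auto simp: T_def)
    next
      case False
      have lc: "coeff P0 N \<noteq> 0" using P0 by (simp add: N_def)
      have "(\<Sum>i\<le>N. to_ac (coeff P0 i) * z ^ i) = 0"
        using P0(2) by (simp add: poly_altdef N_def coeff_map_poly map_poly_degree_eq P0(1))
      hence "to_ac (coeff P0 N) * z ^ N = - (\<Sum>i<N. to_ac (coeff P0 i) * z ^ i)"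
        by (simp add: add_eq_0_iff flip: lessThan_Suc_atMost)
      hence "z ^ N = to_ac (- 1 / coeff P0 N) * (\<Sum>i<N. to_ac (coeff P0 i) * z ^ i)"
        using lc by (simp add: field_simps)
      hence "z ^ (m - N) * z ^ N = to_ac (- 1 / coeff P0 N) * (\<Sum>i<N. to_ac (coeff P0 i) * z ^ (m - N + i))"
        by (simp add: sum_distrib_left power_add mult_ac)
      also have "z ^ (m - N) * z ^ N = z ^ m" using False by (simp flip: power_add)
      finally have eq: "z ^ m = to_ac (- 1 / coeff P0 N) * (\<Sum>i<N. to_ac (coeff P0 i) * z ^ (m - N + i))" .
      have "to_ac (coeff P0 i) * z ^ (m - N + i) \<in> ac.span T" if "i \<in> {..<N}" for i
        using that False by (intro scale less) auto
      hence "(\<Sum>i<N. to_ac (coeff P0 i) * z ^ (m - N + i)) \<in> ac.span T" by (rule ac.span_sum)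
      thus ?thesis unfolding eq by (rule scale)
    qed
  qed
  have adj: "adjoin z \<subseteq> ac.span T"
  proof
    fix x assume "x \<in> adjoin z"
    then obtain P where P: "\<And>i. coeff P i \<in> ?K" "x = poly P z"
      using adjoin_subset_poly by blast
    have "coeff P i * z ^ i \<in> ac.span T" for i
      using P(1)[of i] scale[OF pow] by auto
    thus "x \<in> ac.span T" unfolding P(2) poly_altdef by (intro ac.span_sum)
  qed
  obtain B where B: "B \<subseteq> adjoin z" "ac.independent B" "adjoin z \<subseteq> ac.span B" "card B = ac.dim (adjoin z)"
    using ac.basis_exists by blast
  have finT: "finite T" by (simp add: T_def)
  have finB: "finite B" using ac.independent_span_bound[OF finT B(2)] B(1) adj by blast
  define D where "D = ext_degree z"
  have powadj: "z ^ i \<in> adjoin z" for i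
  proof -
    have "z \<in> adjoin z" by (auto simp: adjoin_def)
    thus ?thesis using is_subfield_adjoin[of z] by (induction i) (auto simp: is_subfield_def)
  qed
  show ?thesis
  \<comment> \<open>If two of the powers coincide, the set of powers may be too small for a
    dimension count, but their difference gives an annihilator at once.\<close>
  proof (cases "inj_on (\<lambda>i. z ^ i) {..D}")
    case False
    then obtain i j where ij: "i \<le> D" "j \<le> D" "i \<noteq> j" "z ^ i = z ^ j" by (auto simp: inj_on_def)
    define P where "P = monom (1::'a) i - monom 1 j"
    have "coeff P i = 1" using ij(3) by (simp add: P_def)
    hence "P \<noteq> 0" by auto
    moreover have "degree P \<le> D" unfolding P_def using ij(1,2) by (intro degree_diff_le) (auto intro: le_trans[OF degree_monom_le])
    moreover have "map_poly to_ac P = monom (1::'a alg_closure) i - monom 1 j"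
      by (intro poly_eqI) (simp add: coeff_map_poly P_def)
    hence "poly (map_poly to_ac P) z = 0" using ij(4) by (simp add: poly_monom)
    ultimately show ?thesis
      by (intro that[of "map_poly to_ac P"]) (auto simp: coeff_map_poly map_poly_eq_0_iff D_def intro: le_trans[OF map_poly_degree_leq])
  next
    case True
    define S where "S = (\<lambda>i. z ^ i) ` {..D}"
    have "\<not> ac.independent S"
    proof
      assume "ac.independent S"
      moreover have "S \<subseteq> ac.span B" using powadj B(3) by (auto simp: S_def)
      ultimately have "card S \<le> card B" using ac.independent_span_bound[OF finB] by blast
      thus False using B(4) card_image[OF True] by (simp add: S_def D_def ext_degree_def)
    qed
    then obtain u where u: "\<exists>v\<in>S. u v \<noteq> 0" "(\<Sum>v\<in>S. to_ac (u v) * v) = 0"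
      using ac.dependent_finite[of S] by (auto simp: S_def)
    define P where "P = (\<Sum>i\<le>D. monom (to_ac (u (z ^ i))) i)"
    have coeffP: "coeff P i = (if i \<le> D then to_ac (u (z ^ i)) else 0)" for i
      by (simp add: P_def coeff_sum)
    have "P \<noteq> 0"
    proof
      assume "P = 0"
      hence "u (z ^ i) = 0" if "i \<le> D" for i using coeffP[of i] that by simp
      thus False using u(1) by (auto simp: S_def)
    qed
    moreover have "degree P \<le> D" by (rule degree_le) (simp add: coeffP)
    moreover have "coeff P i \<in> ?K" for i by (auto simp: coeffP intro: range_eqI[of _ _ 0])
    moreover have "poly P z = (\<Sum>v\<in>S. to_ac (u v) * v)"
      unfolding S_def sum.reindex[OF True] by (simp add: P_def poly_sum poly_monom)
    ultimately show ?thesis using u(2) by (intro that[of P]) (auto simp: D_def)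
  qed
qed

section \<open>The residue field, in terms of representatives\<close>

context valuation_subring
begin

lemma coeff_synthetic_div_mem:
  "c \<in> R \<Longrightarrow> (\<And>i. coeff P i \<in> R) \<Longrightarrow> coeff (synthetic_div P c) i \<in> R"
proof (induction P arbitrary: i)
  case (pCons a P)
  have PR: "coeff P i \<in> R" for i using pCons.prems(2)[of "Suc i"] by simp
  have "poly P c \<in> R" unfolding poly_altdef using PR pCons.prems(1) by (intro sum_mem mult_mem power_mem)
  thus ?case using pCons.IH[OF pCons.prems(1) PR] by (auto simp: coeff_pCons split: nat.splits)
qed simp

text \<open>The bound on the number of roots over the residue field, with \<open>T\<close>
  representing distinct residues. Synthetic division at one root \<open>t\<close> leaves a quotient
  that reduces to 0 at the others, since there \<open>x - t\<close> is a unit.\<close>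

lemma many_residue_roots:
  assumes "finite T" "\<And>t. t \<in> T \<Longrightarrow> t \<in> R" "\<And>t t'. t \<in> T \<Longrightarrow> t' \<in> T \<Longrightarrow> t \<noteq> t' \<Longrightarrow> t - t' \<notin> max_ideal"
    and "\<And>i. coeff P i \<in> R" "\<And>t. t \<in> T \<Longrightarrow> poly P t \<in> max_ideal" "degree P < card T"
  shows "coeff P i \<in> max_ideal"
  using assms
proof (induction T arbitrary: P i rule: finite_induct)
  case (insert t T)
  define Q where "Q = synthetic_div P t"
  have P: "P = [:-t, 1:] * Q + [:poly P t:]" unfolding Q_def by (rule synthetic_div_correct'[symmetric])
  have tR: "t \<in> R" using insert.prems(1) by simp
  have QR: "coeff Q i \<in> R" for i unfolding Q_def using tR insert.prems(3) by (intro coeff_synthetic_div_mem)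
  have QM: "coeff Q i \<in> max_ideal" for i
  proof (cases "Q = 0")
    case False
    have "degree P \<noteq> 0"
      using False synthetic_div_eq_0_iff[of P t] by (simp add: Q_def)
    hence deg: "degree Q < card T" using insert.prems(5) insert.hyps by (simp add: Q_def degree_synthetic_div)
    show ?thesis
    proof (rule insert.IH[OF _ _ QR _ deg])
      show "x \<in> R" if "x \<in> T" for x using insert.prems(1) that by simp
      show "x - y \<notin> max_ideal" if "x \<in> T" "y \<in> T" "x \<noteq> y" for x y using insert.prems(2) that by simp
      fix x assume x: "x \<in> T"
      have "poly P x = (x - t) * poly Q x + poly P t" by (subst P) (simp add: algebra_simps)
      hence "(x - t) * poly Q x \<in> max_ideal"
        using max_ideal_diff[OF insert.prems(4)[of x] insert.prems(4)[of t]] x by simp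
      moreover have "x - t \<notin> max_ideal" using insert.prems(2)[of x t] insert.hyps x by auto
      moreover have "x - t \<in> R" "poly Q x \<in> R"
        using insert.prems(1) x tR QR by (auto simp: poly_altdef intro!: diff_mem sum_mem mult_mem power_mem)
      ultimately show "poly Q x \<in> max_ideal" using max_ideal_prime by blast
    qed
  qed simp
  have "coeff P i = coeff (pCons 0 Q) i - t * coeff Q i + coeff [:poly P t:] i"
    by (subst P) simp
  also have "\<dots> \<in> max_ideal"
    using QM tR insert.prems(4)[of t]
    by (intro max_ideal_add max_ideal_diff max_ideal_mult') (auto simp: coeff_pCons split: nat.splits)
  finally show ?case .
qed simp

text \<open>
  Fermat's little theorem in the residue field shows that \<open>(X + 1)\<^sup>q - X\<^sup>q - 1\<close> has too many
  roots there, so \<open>p\<close> divides all the inner binomial coefficients of \<open>q\<close>.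
\<close>
lemma residue_field_card:
  fixes q p :: nat
  defines "r \<equiv> {(a, b). a \<in> R \<and> b \<in> R \<and> a - b \<in> max_ideal}"
  assumes fin: "finite (R // r)" and q: "card (R // r) = q" and p: "prime p" "CHAR('c) = p"
  shows "\<exists>s>0. q = p ^ s" "\<And>x. x \<in> R \<Longrightarrow> x ^ q - x \<in> max_ideal"
proof -
  have equiv: "equiv R r"
  proof (rule equivI)
    show "r \<subseteq> R \<times> R" "refl_on R r" by (auto simp: refl_on_def r_def)
    show "sym r" using max_ideal_uminus by (fastforce simp: sym_def r_def)
    show "trans r" using max_ideal_add by (fastforce simp: trans_def r_def)
  qed
  define \<rho> where "\<rho> = (\<lambda>x. SOME y. y \<in> r `` {x})"
  have \<rho>: "\<rho> x \<in> R" "x - \<rho> x \<in> max_ideal" if "x \<in> R" for x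
  proof -
    have "x \<in> r `` {x}" using that by (simp add: r_def)
    hence "\<rho> x \<in> r `` {x}" unfolding \<rho>_def by (rule someI)
    thus "\<rho> x \<in> R" "x - \<rho> x \<in> max_ideal" by (auto simp: r_def)
  qed
  have \<rho>_eq: "\<rho> x = \<rho> y" if "x \<in> R" "y \<in> R" "x - y \<in> max_ideal" for x y
  proof -
    have "r `` {x} = r `` {y}" using that by (intro equiv_class_eq[OF equiv]) (auto simp: r_def)
    thus ?thesis by (simp only: \<rho>_def)
  qed
  define T where "T = \<rho> ` R"
  have TR: "t \<in> R" if "t \<in> T" for t using that \<rho> by (auto simp: T_def)
  have \<rho>T: "\<rho> t = t" if "t \<in> T" for t using that \<rho> by (auto simp: T_def intro!: \<rho>_eq) (metis max_ideal_uminus minus_diff_eq \<rho>(2))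
  have Tdist: "t - t' \<notin> max_ideal" if "t \<in> T" "t' \<in> T" "t \<noteq> t'" for t t'
    using \<rho>_eq[OF TR TR] \<rho>T that by metis
  have "bij_betw (\<lambda>t. r `` {t}) T (R // r)"
    unfolding bij_betw_def
  proof
    show "inj_on (\<lambda>t. r `` {t}) T"
    proof (rule inj_onI)
      fix t t' assume t: "t \<in> T" "t' \<in> T" "r `` {t} = r `` {t'}"
      hence "(t, t') \<in> r" using TR by (intro eq_equiv_class[OF _ equiv]) auto
      thus "t = t'" using Tdist[OF t(1,2)] by (auto simp: r_def)
    qed
    show "(\<lambda>t. r `` {t}) ` T = R // r"
    proof (intro equalityI subsetI)
      fix C assume "C \<in> R // r"
      then obtain x where x: "x \<in> R" "C = r `` {x}" by (auto elim: quotientE)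
      have "r `` {x} = r `` {\<rho> x}" using x \<rho> by (intro equiv_class_eq[OF equiv]) (auto simp: r_def)
      thus "C \<in> (\<lambda>t. r `` {t}) ` T" using x by (auto simp: T_def)
    qed (use TR in \<open>auto intro: quotientI\<close>)
  qed
  hence finT: "finite T" and cardT: "card T = q" using fin q bij_betw_finite bij_betw_same_card by blast+

  define U where "U = {t \<in> T. t \<notin> max_ideal}"
  have finU: "finite U" and UR: "\<And>t. t \<in> U \<Longrightarrow> t \<in> R" using finT TR by (auto simp: U_def)
  have TU: "T = insert (\<rho> 0) U" and 0: "\<rho> 0 \<notin> U"
  proof -
    have "\<rho> 0 \<in> max_ideal" using \<rho>(2)[of 0] max_ideal_uminus[of "- \<rho> 0"] by simp
    thus "\<rho> 0 \<notin> U" by (simp add: U_def)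
    have "t = \<rho> 0" if "t \<in> T" "t \<in> max_ideal" for t
      using \<rho>_eq[of t 0] \<rho>T[OF that(1)] TR[OF that(1)] that(2) by simp
    thus "T = insert (\<rho> 0) U" by (auto simp: U_def T_def)
  qed
  have cardU: "q = Suc (card U)" using cardT TU 0 finU by simp
  have "U \<noteq> {}"
  proof -
    have "\<rho> 1 \<notin> max_ideal" using max_ideal_add[OF \<rho>(2)[of 1], of "\<rho> 1"] by auto
    thus ?thesis by (auto simp: U_def T_def)
  qed
  hence q2: "q \<ge> 2" using cardU finU by (cases "card U") auto

  show fermat: "x ^ q - x \<in> max_ideal" if x: "x \<in> R" for x
  proof (cases "x \<in> max_ideal")
    case True
    have "x * (x ^ card U - 1) \<in> max_ideal"
      using True x one_mem by (intro max_ideal_mult diff_mem power_mem)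
    thus ?thesis by (simp add: cardU algebra_simps)
  next
    case False
    \<comment> \<open>Multiplication by \<open>x\<close> permutes the nonzero residues, represented
      by \<open>U\<close>; comparing the products of all of them gives \<open>x ^ card U = 1\<close>
      in the residue field.\<close>
    have inj: "inj_on (\<lambda>t. \<rho> (x * t)) U"
    proof (rule inj_onI, rule ccontr)
      fix t t' assume t: "t \<in> U" "t' \<in> U" "\<rho> (x * t) = \<rho> (x * t')" "t \<noteq> t'"
      have "(x * t - \<rho> (x * t)) - (x * t' - \<rho> (x * t')) \<in> max_ideal"
        using UR t(1,2) x by (intro max_ideal_diff \<rho> mult_mem)
      hence "x * (t - t') \<in> max_ideal" using t(3) by (simp add: algebra_simps)
      hence "t - t' \<in> max_ideal" using max_ideal_prime[of x "t - t'"] x False UR t(1,2) diff_mem by blast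
      thus False using Tdist[of t t'] t by (auto simp: U_def)
    qed
    have "(\<lambda>t. \<rho> (x * t)) ` U \<subseteq> U"
    proof
      fix y assume "y \<in> (\<lambda>t. \<rho> (x * t)) ` U"
      then obtain t where t: "t \<in> U" "y = \<rho> (x * t)" by auto
      have xt: "x * t \<in> R" using x UR t(1) by (intro mult_mem)
      have "x * t \<notin> max_ideal" using max_ideal_prime[OF x UR[OF t(1)]] False t(1) by (auto simp: U_def)
      hence "y \<notin> max_ideal" using max_ideal_add[OF \<rho>(2)[OF xt]] t(2) by fastforce
      thus "y \<in> U" using t xt by (auto simp: U_def T_def)
    qed
    hence im: "(\<lambda>t. \<rho> (x * t)) ` U = U" using endo_inj_surj[OF finU _ inj] by blast
    have prod_cong: "prod g J - prod h J \<in> max_ideal \<and> prod g J \<in> R \<and> prod h J \<in> R"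
      if "finite J" "\<And>i. i \<in> J \<Longrightarrow> g i \<in> R" "\<And>i. i \<in> J \<Longrightarrow> h i \<in> R" "\<And>i. i \<in> J \<Longrightarrow> g i - h i \<in> max_ideal"
      for g h :: "'c \<Rightarrow> 'c" and J
      using that
    proof (induction J rule: finite_induct)
      case (insert i J)
      have "g i * (prod g J - prod h J) + (g i - h i) * prod h J \<in> max_ideal"
        using insert by (intro max_ideal_add max_ideal_mult max_ideal_mult') auto
      thus ?case using insert by (auto simp: algebra_simps intro: mult_mem)
    qed auto
    have "(\<Prod>t\<in>U. x * t) - (\<Prod>t\<in>U. \<rho> (x * t)) \<in> max_ideal"
      using prod_cong[OF finU, of "\<lambda>t. x * t" "\<lambda>t. \<rho> (x * t)"] UR x \<rho> mult_mem by auto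
    also have "(\<Prod>t\<in>U. \<rho> (x * t)) = (\<Prod>t\<in>U. t)"
      using prod.reindex[OF inj, of "\<lambda>t. t"] im by simp
    also have "(\<Prod>t\<in>U. x * t) - (\<Prod>t\<in>U. t) = (x ^ card U - 1) * (\<Prod>t\<in>U. t)"
      by (simp add: prod.distrib algebra_simps)
    finally have "(x ^ card U - 1) * (\<Prod>t\<in>U. t) \<in> max_ideal" .
    moreover have "(\<Prod>t\<in>U. t) \<notin> max_ideal" using max_ideal_prod[OF finU, of "\<lambda>t. t"] UR by (auto simp: U_def)
    moreover have "(\<Prod>t\<in>U. t) \<in> R" using prod_cong[OF finU, of "\<lambda>t. t" "\<lambda>t. t"] UR by auto
    ultimately have "x ^ card U - 1 \<in> max_ideal"
      using max_ideal_prime[OF diff_mem[OF power_mem[OF x] one_mem]] by blast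
    hence "x * (x ^ card U - 1) \<in> max_ideal" using x by (intro max_ideal_mult')
    thus ?thesis by (simp add: cardU algebra_simps)
  qed

  define P :: "'c poly" where "P = (\<Sum>i\<in>{1..<q}. monom (of_nat (q choose i)) i)"
  have coeffP: "coeff P i = (if i \<in> {1..<q} then of_nat (q choose i) else 0)" for i
    by (simp add: P_def coeff_sum)
  have of_nat_R: "of_nat m \<in> R" for m :: nat by (induction m) (auto intro: add_mem)
  hence PR: "coeff P i \<in> R" for i by (simp add: coeffP)
  have "poly P x \<in> max_ideal" if "x \<in> T" for x
  proof -
    have "(x + 1) ^ q = (\<Sum>i\<le>q. of_nat (q choose i) * x ^ i)" by (simp add: binomial_ring)
    also have "{..q} = insert 0 (insert q {1..<q})" using q2 by auto
    finally have "poly P x = (x + 1) ^ q - x ^ q - 1" using q2 by (simp add: P_def poly_sum poly_monom)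
    also have "\<dots> = ((x + 1) ^ q - (x + 1)) - (x ^ q - x)" by simp
    also have "\<dots> \<in> max_ideal" using TR[OF that] by (intro max_ideal_diff fermat add_mem one_mem)
    finally show ?thesis .
  qed
  moreover have "degree P < card T"
  proof -
    have "degree P \<le> q - 1" by (rule degree_le) (auto simp: coeffP)
    thus ?thesis using q2 cardT by simp
  qed
  ultimately have PM: "coeff P i \<in> max_ideal" for i
    using many_residue_roots[OF finT TR Tdist PR] by blast
  have dvd: "p dvd (q choose i)" if i: "0 < i" "i < q" for i
  proof (rule ccontr)
    assume "\<not> p dvd (q choose i)"
    then obtain a b where ab: "int (q choose i) * a + int p * b = 1"
      using p(1) bezout_int[of "int (q choose i)" "int p"]
      by (metis coprime_commute coprime_int_iff coprime_iff_gcd_eq_1 mult.commute prime_imp_coprime)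
    hence "of_int (int (q choose i) * a + int p * b) = (1 :: 'c)" by simp
    moreover have "of_nat p = (0 :: 'c)" using p by (simp add: of_nat_eq_0_iff_char_dvd)
    ultimately have "of_nat (q choose i) * of_int a = (1 :: 'c)" by simp
    moreover have "of_int a \<in> R" using of_nat_R by (cases a) (auto intro!: uminus_mem diff_mem)
    moreover have "of_nat (q choose i) \<in> max_ideal" using PM[of i] i by (simp add: coeffP)
    ultimately show False using max_ideal_mult one_notin_max_ideal by metis
  qed
  obtain s m where sm: "q = p ^ s * m" "\<not> p dvd m"
    using prime_power_canonical[of p q] p q2 by (metis mult.commute less_le_trans zero_less_numeral)
  have "m > 0" using sm q2 by (intro Nat.gr0I) auto
  \<comment> \<open>The binomial coefficient of \<open>q\<close> over \<open>p ^ s\<close> contains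
    \<open>p\<close> exactly as often as \<open>m\<close> does, that is, not at all; so
    \<open>p ^ s\<close> cannot be an inner index.\<close>
  have "m = 1"
  proof (rule ccontr)
    assume "m \<noteq> 1"
    hence "p ^ s < q" using sm(1) \<open>m > 0\<close> p(1) prime_gt_0_nat[of p] by simp
    hence "p dvd (q choose (p ^ s))" using p(1) prime_gt_0_nat[of p] by (intro dvd) auto
    moreover have "q choose (p ^ s) > 0" using \<open>p ^ s < q\<close> by simp
    ultimately have "multiplicity p (q choose (p ^ s)) > 0"
      using p(1) by (simp add: prime_multiplicity_gt_zero_iff)
    moreover have "multiplicity p (q choose (p ^ s)) = multiplicity p m"
      unfolding sm(1) using \<open>m > 0\<close> p(1) by (intro const_p_fac)
    ultimately show False using sm(2) by (simp add: not_dvd_imp_multiplicity_0)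
  qed
  hence "q = p ^ s" using sm by simp
  moreover from this have "s > 0" using q2 by (intro Nat.gr0I) auto
  ultimately show "\<exists>s>0. q = p ^ s" by blast
qed

end

lemma valuation_ring_valuation_subring:
  assumes v: "krull_valuation v"
  shows "valuation_subring (valuation_ring v)" "valuation_subring.max_ideal (valuation_ring v) = valuation_ideal v"
proof -
  have mult: "v (x * y) = v x + v y" if "x \<noteq> 0" "y \<noteq> 0" for x y
    using v that by (auto simp: krull_valuation_def)
  have add: "min (v x) (v y) \<le> v (x + y)" if "x \<noteq> 0" "y \<noteq> 0" "x + y \<noteq> 0" for x y
    using v that by (auto simp: krull_valuation_def)
  have v1: "v 1 = 0" using mult[of 1 1] by simp
  have vinv: "v (inverse x) = - v x" if "x \<noteq> 0" for x
    using mult[of x "inverse x"] that v1 by (simp add: eq_neg_iff_add_eq_0 add.commute)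
  \<comment> \<open>Ordered groups have no torsion, so \<open>v (-1)\<close> is 0 and signs do not
    affect sizes.\<close>
  have "v (-1) + v (-1) = 0" using mult[of "-1" "-1"] v1 by simp
  hence "v (-1) = 0" by simp
  hence vneg: "v (- x) = v x" if "x \<noteq> 0" for x using mult[of "-1" x] that by simp
  show sub: "valuation_subring (valuation_ring v)"
  proof
    show "1 \<in> valuation_ring v" using v1 by (simp add: valuation_ring_def)
    fix x y
    show "x - y \<in> valuation_ring v" if "x \<in> valuation_ring v" "y \<in> valuation_ring v"
    proof (cases "x = 0 \<or> y = 0 \<or> x = y")
      case True thus ?thesis using that vneg[of y] by (cases "y = 0") (auto simp: valuation_ring_def)
    next
      case False
      hence "0 \<le> min (v x) (v (- y))" using that vneg[of y] by (auto simp: valuation_ring_def)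
      also have "\<dots> \<le> v (x - y)" using add[of x "- y"] False by simp
      finally show ?thesis by (simp add: valuation_ring_def)
    qed
    show "x * y \<in> valuation_ring v" if "x \<in> valuation_ring v" "y \<in> valuation_ring v"
      using that mult[of x y] by (cases "x = 0 \<or> y = 0") (auto simp: valuation_ring_def)
    show "x \<in> valuation_ring v \<or> inverse x \<in> valuation_ring v"
      using vinv[of x] by (auto simp: valuation_ring_def)
  qed
  show "valuation_subring.max_ideal (valuation_ring v) = valuation_ideal v"
  proof (rule Set.set_eqI)
    fix x
    show "x \<in> valuation_subring.max_ideal (valuation_ring v) \<longleftrightarrow> x \<in> valuation_ideal v"
      unfolding valuation_subring.max_ideal_def[OF sub] unfolding valuation_ring_def valuation_ideal_def
      by (cases "x = 0") (auto simp: vinv)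
  qed
qed

theorem theorem2:
  fixes v :: "'a::field \<Rightarrow> 'g::linordered_ab_group_add"
    and p q d k :: nat
    and a :: "nat \<Rightarrow> 'a"
    and n :: "nat \<Rightarrow> nat"
    and f :: "'a poly"
  assumes "prime p" and "CHAR('a) = p"
    and "krull_valuation v"
    and "finite (residue_field v)" and "card (residue_field v) = q"
    and "1 \<le> d"
    and "\<And>i. i \<le> k \<Longrightarrow> a i \<noteq> 0"
    and "inj_on n {..k}"
    and "f = (\<Sum>i\<le>k. monom (a i) (n i))"
  shows "finite {z. poly (map_poly to_ac f) z = 0 \<and> ext_degree z \<le> d} \<and>
    int (card {z. poly (map_poly to_ac f) z = 0 \<and> ext_degree z \<le> d})
      \<le> (\<Sum>j=1..d. \<Sum>i | i dvd j. int q ^ (i * k) * moebius_mu (j div i))"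
proof -
  let ?K = "range (to_ac :: 'a \<Rightarrow> _)"
  interpret V: valuation_subring "valuation_ring v" using assms(3) by (rule valuation_ring_valuation_subring)
  have VM: "V.max_ideal = valuation_ideal v" using assms(3) by (rule valuation_ring_valuation_subring)
  have "\<exists>s>0. q = p ^ s" and fermat: "\<And>x. x \<in> valuation_ring v \<Longrightarrow> x ^ q - x \<in> valuation_ideal v"
    using V.residue_field_card[of q p] assms(1,2,4,5) unfolding VM residue_field_def by blast+
  then obtain s where s: "s > 0" "q = p ^ s" by blast
  have "is_subfield ?K" by (rule is_subfield_range_to_ac)
  then obtain R where R: "valuation_subring R" "R \<inter> ?K = to_ac ` valuation_ring v"
  proof (rule valuation_subring_extension)
    show "to_ac ` valuation_ring v \<subseteq> ?K" by auto
    show "1 \<in> to_ac ` valuation_ring v" using image_eqI[of 1 to_ac 1] by simp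
    show "x - y \<in> to_ac ` valuation_ring v \<and> x * y \<in> to_ac ` valuation_ring v"
      if "x \<in> to_ac ` valuation_ring v" "y \<in> to_ac ` valuation_ring v" for x y
      using that V.diff_mem V.mult_mem by (auto simp flip: to_ac_diff to_ac_mult)
    show "x \<in> to_ac ` valuation_ring v \<or> inverse x \<in> to_ac ` valuation_ring v" if x: "x \<in> ?K" for x
    proof -
      obtain y where y: "x = to_ac y" using x by auto
      have "y \<in> valuation_ring v \<or> inverse y \<in> valuation_ring v" by (rule V.mem_or_inverse_mem)
      thus ?thesis unfolding y to_ac_inverse[symmetric] by blast
    qed
  qed
  interpret R: valuation_subring R by (rule R(1))
  have mem_R: "to_ac x \<in> R \<longleftrightarrow> x \<in> valuation_ring v" for x
    using R(2) inj_image_mem_iff[OF inj_to_ac, of x "valuation_ring v"] by blast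
  interpret residually_finite R ?K p s q
  proof
    show "is_subfield ?K" by (rule is_subfield_range_to_ac)
    show "algebraic_over ?K x" for x by (rule algebraic_over_to_ac)
    show "prime p" "CHAR('a alg_closure) = p" "q = p ^ s" "s > 0" using assms s by auto
    fix x assume "x \<in> ?K" "x \<in> R"
    then obtain y where y: "x = to_ac y" "y \<in> valuation_ring v" using mem_R by auto
    define w where "w = y ^ q - y"
    have "w \<in> V.max_ideal" using fermat[OF y(2)] VM by (simp add: w_def)
    hence "to_ac w \<in> R.max_ideal"
      unfolding V.max_ideal_def R.max_ideal_def mem_Collect_eq mem_R to_ac_inverse[symmetric] by simp
    thus "x ^ q - x \<in> R.max_ideal" using y by (simp add: w_def)
  qed
  interpret sparse_polynomial R ?K p s q k "\<lambda>i. to_ac (a i)" n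
    using assms(7,8) by unfold_locales auto
  have "map_poly to_ac f = f_poly"
    unfolding assms(9) f_poly_def by (intro poly_eqI) (auto simp: coeff_map_poly coeff_sum to_ac_sum intro!: sum.cong)
  hence zeros: "zeros = {z. poly (map_poly to_ac f) z = 0}" by (simp add: zeros_eq)
  define Z where "Z = {z. poly (map_poly to_ac f) z = 0 \<and> ext_degree z \<le> d}"
  have ZZ: "Z \<subseteq> zeros" by (auto simp: Z_def zeros)
  obtain \<sigma> \<Phi> where \<sigma>: "\<sigma> \<in> embeddings ?K" and \<Phi>: "inj_on \<Phi> zeros" "\<Phi> ` zeros \<subseteq> extensional {1..k}"
    "\<And>z j m. z \<in> zeros \<Longrightarrow> (\<sigma> ^^ j) z = z \<Longrightarrow> m \<in> {1..k} \<Longrightarrow> \<Phi> z m \<in> frob_fixed j"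
    by (rule tuple_embedding) blast
  define T where "T = {t \<in> extensional {1..k}. \<exists>j\<in>{1..d}. \<forall>m\<in>{1..k}. t m \<in> frob_fixed j}"
  have "\<Phi> z \<in> T" if z: "z \<in> Z" for z
  proof -
    obtain P where P: "P \<noteq> 0" "\<And>i. coeff P i \<in> ?K" "poly P z = 0" "degree P \<le> ext_degree z"
      using annihilator_of_ext_degree[of z] by blast
    \<comment> \<open>\<sigma> permutes the roots of \<open>P\<close>, of which there are at most
      \<open>d\<close>, so the orbit of \<open>z\<close> closes up after some \<open>j\<close> in
      \<open>{1..d}\<close> steps.\<close>
    define S where "S = {x. poly P x = 0}"
    have "finite S" "card S \<le> degree P" "z \<in> S" "\<And>x. x \<in> S \<Longrightarrow> \<sigma> x \<in> S"
      unfolding S_def using poly_roots_finite[OF P(1)] card_poly_roots_bound[OF P(1)] P(3) embeddings_root[OF \<sigma> P(2)] by auto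
    then obtain j where j: "1 \<le> j" "j \<le> card S" "(\<sigma> ^^ j) z = z"
      using funpow_return[OF embeddings_inj[OF \<sigma>], of S z] by blast
    have "j \<in> {1..d}" using j \<open>card S \<le> degree P\<close> P(4) z by (auto simp: Z_def)
    thus ?thesis using \<Phi>(2,3) j(3) z ZZ unfolding T_def by blast
  qed
  hence "\<Phi> ` Z \<subseteq> T" by blast
  hence "card Z \<le> card T"
    using inj_on_subset[OF \<Phi>(1) ZZ] card_tuples(1)[of k d] unfolding T_def by (intro card_inj_on_le)
  moreover have "finite Z" using finite_zeros ZZ finite_subset by blast
  ultimately show ?thesis
    using card_tuples(2)[of k d] unfolding Z_def T_def by simp
qed

end
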